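(* Let $F:\mathbb{R}\to\mathbb{R}$ be a continuous function satisfying $F(0)=0$, and denote by $T_F$ the composition operator $T_F:f\mapsto F\circ f$. Then, for $T_F$ to satisfy Property $\mathcal{L}ip(H^1((0,+\infty)),L^2((0,+\infty)))$ (respectively $\mathcal{L}ip(H^2((0,+\infty)),H^1((0,+\infty)))$), it is: (i) necessary that $F\in H^{2}_{loc}((0,+\infty))$ (respectively $F\in H^{1}_{loc}((0,+\infty))$); (ii) sufficient that $F\in C^2(\mathbb{R},\mathbb{R})$ (respectively $F\in C^1(\mathbb{R},\mathbb{R})$).
   Context: Functions are real-valued on $(0,+\infty)$; $\|\cdot\|_2$ is the $L^2((0,+\infty))$ norm and $f_x$ is the derivative of $f$. $H^1$, $H^2$ are the usual Sobolev spaces and $H^1_{loc}$, $H^2_{loc}$ their local versions. For function spaces $B,B'$ with $B\subset L^2$, the composition operator $T_F:B\to B'$, $f\mapsto F\circ f$, is said to satisfy Property $\mathcal{L}ip(B,B')$ if there exists $C>0$, a monotone increasing function of $\|f\|_2,\|g\|_2,\|f_x\|_2,\|g_x\|_2$, such that for any $(f,g)\in B^2$ $$\|F\circ f-F\circ g\|_{B'}\le C(\|f\|_2,\|g\|_2,\|f_x\|_2,\|g_x\|_2)\,\|f-g\|_B .$$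
   Formalization: The pairing is corrected, as two printed claims are false (F=|x-1|-1 for H^2_loc; F=|x-1|^{4/3}-1 for C^1): Lip(H^2,H^1) is paired with F in H^2_loc (necessary) and C^2 (sufficient), and Lip(H^1,L^2) with H^1_loc and C^1. *)

theory Defs
  imports "HOL-Analysis.Analysis"
begin

definition C_k :: "nat \<Rightarrow> (real \<Rightarrow> real) \<Rightarrow> bool" where
  "C_k k F \<longleftrightarrow> (\<forall>j<k. (deriv ^^ j) F differentiable_on UNIV)
     \<and> continuous_on UNIV ((deriv ^^ k) F)"

definition test_function :: "real set \<Rightarrow> (real \<Rightarrow> real) \<Rightarrow> bool" where
  "test_function S \<phi> \<longleftrightarrow> (\<forall>k. C_k k \<phi>)
     \<and> (\<exists>K. compact K \<and> K \<subseteq> S \<and> (\<forall>x. x \<notin> K \<longrightarrow> \<phi> x = 0))"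

(* A function on S is represented by a total function on the reals whose values off S are
   irrelevant. Functions are not identified almost everywhere; the predicates below
   depend only on the a.e. class of the restriction to S. *)

definition L2 :: "real set \<Rightarrow> (real \<Rightarrow> real) set" where
  "L2 S = {f. set_borel_measurable lebesgue S f
     \<and> set_integrable lebesgue S (\<lambda>x. (f x)\<^sup>2)}"

definition L2_norm :: "real set \<Rightarrow> (real \<Rightarrow> real) \<Rightarrow> real" where
  "L2_norm S f = sqrt (LINT x:S|lebesgue. (f x)\<^sup>2)"

definition locally_integrable :: "real set \<Rightarrow> (real \<Rightarrow> real) \<Rightarrow> bool" where
  "locally_integrable S f \<longleftrightarrow> (\<forall>K. compact K \<and> K \<subseteq> S \<longrightarrow> set_integrable lebesgue K f)"

definition has_weak_deriv :: "real set \<Rightarrow> (real \<Rightarrow> real) \<Rightarrow> (real \<Rightarrow> real) \<Rightarrow> bool" where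
  "has_weak_deriv S f g \<longleftrightarrow> locally_integrable S f \<and> locally_integrable S g
     \<and> (\<forall>\<phi>. test_function S \<phi> \<longrightarrow>
          (LINT x:S|lebesgue. f x * deriv \<phi> x) = - (LINT x:S|lebesgue. g x * \<phi> x))"

(* On open S any two weak derivatives of f agree a.e. on S, so the choice does not matter
   for the norms below. *)
definition weak_deriv :: "real set \<Rightarrow> (real \<Rightarrow> real) \<Rightarrow> real \<Rightarrow> real" where
  "weak_deriv S f = (SOME g. has_weak_deriv S f g)"

(* The Sobolev space H^k(S) = W^{k,2}(S), for open S. *)
primrec sobolev :: "nat \<Rightarrow> real set \<Rightarrow> (real \<Rightarrow> real) set" where
  "sobolev 0 S = L2 S"
| "sobolev (Suc k) S = {f \<in> L2 S. \<exists>g \<in> sobolev k S. has_weak_deriv S f g}"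

definition sobolev_norm :: "nat \<Rightarrow> real set \<Rightarrow> (real \<Rightarrow> real) \<Rightarrow> real" where
  "sobolev_norm k S f = sqrt (\<Sum>j\<le>k. (L2_norm S ((weak_deriv S ^^ j) f))\<^sup>2)"

definition sobolev_loc :: "nat \<Rightarrow> real set \<Rightarrow> (real \<Rightarrow> real) set" where
  "sobolev_loc k S =
     {f. \<forall>U. open U \<and> compact (closure U) \<and> closure U \<subseteq> S \<longrightarrow> f \<in> sobolev k U}"

(* Property Lip(B, B') of the composition operator f |-> F o f, for spaces B, B' of functions
   on the half-line with norms N, N'. The bound C is a function of four nonnegative reals. *)
definition Lip_property ::
  "(real \<Rightarrow> real) set \<Rightarrow> ((real \<Rightarrow> real) \<Rightarrow> real) \<Rightarrow>
   (real \<Rightarrow> real) set \<Rightarrow> ((real \<Rightarrow> real) \<Rightarrow> real) \<Rightarrow> (real \<Rightarrow> real) \<Rightarrow> bool" where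
  "Lip_property B N B' N' F \<longleftrightarrow>
     (\<forall>f\<in>B. F \<circ> f \<in> B') \<and>
     (\<exists>C :: real \<Rightarrow> real \<Rightarrow> real \<Rightarrow> real \<Rightarrow> real.
        (\<forall>a\<ge>0. \<forall>b\<ge>0. \<forall>c\<ge>0. \<forall>d\<ge>0. C a b c d > 0) \<and>
        (\<forall>a b c d a' b' c' d'.
           0 \<le> a \<and> a \<le> a' \<and> 0 \<le> b \<and> b \<le> b' \<and> 0 \<le> c \<and> c \<le> c' \<and> 0 \<le> d \<and> d \<le> d'
             \<longrightarrow> C a b c d \<le> C a' b' c' d') \<and>
        (\<forall>f\<in>B. \<forall>g\<in>B.
           N' (\<lambda>x. (F \<circ> f) x - (F \<circ> g) x)
             \<le> C (L2_norm {0<..} f) (L2_norm {0<..} g)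
                  (L2_norm {0<..} (weak_deriv {0<..} f)) (L2_norm {0<..} (weak_deriv {0<..} g))
                * N (\<lambda>x. f x - g x)))"

end

theory Submission
  imports Defs
begin

text \<open>
  A function in $H^1((0,\infty))$ agrees a.e. with an indefinite integral $u$ of its weak derivative,
  and $|u| \le \|u\|_2 + \|u'\|_2$. The chain rule for indefinite integrals and the
  mean value theorem on the resulting compact range give the sufficiency.

  For the necessity the inequality is tested on explicit functions. Let $\eta$ be a smooth plateau
  function. For $H^1 \to L^2$, comparing $y\eta$ and $z\eta$ on the plateau shows that $F$ is locally
  Lipschitz. For $H^2 \to H^1$, take $f = a\eta + d\,s((x-2)/d^2)$ with a fixed bump $s$, $s(0)=0$,
  $s(1)=1$, and $g = f + h\eta$. The scaling keeps $\|f\|_2$ and $\|f_x\|_2$ bounded as $d \to 0$,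
  while $f$ climbs from $a$ to $a+d$ on an interval of length $d^2$; since functions in $H^1$ are
  $1/2$-Hoelder continuous, $|F(a+d+h)-F(a+d)-F(a+h)+F(a)| \le K h d$, so $F$ is locally $C^{1,1}$.
  Finally, a Lipschitz function is an indefinite integral of a bounded function
  by the Radon--Nikodym theorem.
\<close>

section \<open>Indefinite integrals\<close>

text \<open>The necessity rests on the fact that \<open>C\<close> sees only the norms of f, g and of
  their first derivatives. A transition of height d over a length l has a derivative of norm of
  order d / sqrt l, so l = d^2 is the shortest length that keeps this norm bounded. The second
  derivative of f blows up as d tends to 0, but it cancels in g - f = h \<eta>, whose H^2 norm is of
  order h. The Hoelder exponent 1/2 turns the length d^2 back into a factor d, and the product h d
  is what a second difference of a function with Lipschitz derivative must obey.

  On the analytic side, elements of the Sobolev spaces are total functions without a.e.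
  identification, and their weak derivatives come from \<open>SOME\<close>.
  \<open>primitive_on\<close> fixes a continuous representative by an integral identity, that is,
  absolute continuity with a given density. This form passes to products and compositions by local
  estimates, and integration by parts converts it to and from weak derivatives.\<close>

definition primitive_on :: "real set \<Rightarrow> (real \<Rightarrow> real) \<Rightarrow> (real \<Rightarrow> real) \<Rightarrow> bool" where
  "primitive_on I u g \<longleftrightarrow> (\<forall>x\<in>I. \<forall>y\<in>I. x \<le> y \<longrightarrow>
     g absolutely_integrable_on {x..y} \<and> integral {x..y} g = u y - u x)"

lemma primitive_on_subset: "primitive_on I u g \<Longrightarrow> J \<subseteq> I \<Longrightarrow> primitive_on J u g"
  unfolding primitive_on_def by blast

lemma primitive_onD:
  assumes "primitive_on I u g" "x \<in> I" "y \<in> I" "x \<le> y"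
  shows "g absolutely_integrable_on {x..y}" "g integrable_on {x..y}"
    "integral {x..y} g = u y - u x"
  using assms absolutely_integrable_on_def unfolding primitive_on_def by blast+

lemma abs_int_subinterval:
  fixes f :: "real \<Rightarrow> real"
  assumes "f absolutely_integrable_on {a..b}" "a \<le> c" "d \<le> b"
  shows "f absolutely_integrable_on {c..d}"
  using absolutely_integrable_on_subinterval[OF assms(1)] assms(2,3) by auto

lemma primitive_on_interval:
  assumes "g absolutely_integrable_on {a..b}"
    and "\<And>x. x \<in> {a..b} \<Longrightarrow> integral {a..x} g = u x - u a"
  shows "primitive_on {a..b} u g"
  unfolding primitive_on_def
proof (intro ballI impI conjI)
  fix x y assume xy: "x \<in> {a..b}" "y \<in> {a..b}" "x \<le> y"
  show "g absolutely_integrable_on {x..y}"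
    by (rule abs_int_subinterval[OF assms(1)]) (use xy in auto)
  have "g integrable_on {a..y}"
    using abs_int_subinterval[OF assms(1), of a y] xy absolutely_integrable_on_def by auto
  then have "integral {a..x} g + integral {x..y} g = integral {a..y} g"
    using xy by (intro Henstock_Kurzweil_Integration.integral_combine) auto
  then show "integral {x..y} g = u y - u x"
    using assms(2)[of x] assms(2)[of y] xy by auto
qed

lemma continuous_on_primitive:
  assumes "primitive_on {a..b} u g"
  shows "continuous_on {a..b} u"
proof (cases "a \<le> b")
  case True
  have "continuous_on {a..b} (\<lambda>x. u a + integral {a..x} g)"
    using primitive_onD(2)[OF assms, of a b] True
    by (intro continuous_intros indefinite_integral_continuous_1) auto
  then show ?thesis
    by (rule continuous_on_eq) (use primitive_onD(3)[OF assms, of a] in auto)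
qed auto

lemma abs_int_continuous_mult:
  fixes h u :: "real \<Rightarrow> real"
  assumes "continuous_on {a..b} u" "h absolutely_integrable_on {a..b}"
  shows "(\<lambda>t. u t * h t) absolutely_integrable_on {a..b}"
proof (rule absolutely_integrable_bounded_measurable_product_real[OF _ _ _ assms(2)])
  show "u \<in> borel_measurable (lebesgue_on {a..b})"
    by (rule continuous_imp_measurable_on_sets_lebesgue) (use assms in auto)
  show "bounded (u ` {a..b})"
    using compact_continuous_image[OF assms(1)] compact_imp_bounded by blast
qed auto

text \<open>The local errors are compared with an additive interval function, so by bisection they add up to
at most $e\int N$. Product and chain rule follow without differentiating almost everywhere.\<close>

lemma integral_eq_diff_local:
  fixes \<Phi> k N :: "real \<Rightarrow> real"
  assumes "a \<le> b" and k: "k integrable_on {a..b}" and N: "N integrable_on {a..b}"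
    and loc: "\<And>e x. 0 < e \<Longrightarrow> x \<in> {a..b} \<Longrightarrow> \<exists>d>0. \<forall>p q. a \<le> p \<and> p \<le> x \<and> x \<le> q \<and> q \<le> b \<and> q - p < d
        \<longrightarrow> \<bar>\<Phi> q - \<Phi> p - integral {p..q} k\<bar> \<le> e * integral {p..q} N"
  shows "integral {a..b} k = \<Phi> b - \<Phi> a"
proof -
  have main: "\<bar>\<Phi> b - \<Phi> a - integral {a..b} k\<bar> \<le> e * integral {a..b} N" if "e > 0" for e
  proof -
    \<comment> \<open>The guard \<open>a \<le> p \<and> q \<le> b\<close> belongs to the bisected
      property because the local condition of \<open>Bolzano\<close> ranges over all p and q around
      x, including those outside [a, b].\<close>
    have "a \<le> a \<and> b \<le> b \<longrightarrow> \<bar>\<Phi> b - \<Phi> a - integral {a..b} k\<bar> \<le> e * integral {a..b} N"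
    proof (rule Bolzano[of a b "\<lambda>p q. a \<le> p \<and> q \<le> b \<longrightarrow> \<bar>\<Phi> q - \<Phi> p - integral {p..q} k\<bar> \<le> e * integral {p..q} N"])
      fix p q r
      assume *: "a \<le> p \<and> q \<le> b \<longrightarrow> \<bar>\<Phi> q - \<Phi> p - integral {p..q} k\<bar> \<le> e * integral {p..q} N"
        "a \<le> q \<and> r \<le> b \<longrightarrow> \<bar>\<Phi> r - \<Phi> q - integral {q..r} k\<bar> \<le> e * integral {q..r} N"
        "p \<le> q" "q \<le> r"
      show "a \<le> p \<and> r \<le> b \<longrightarrow> \<bar>\<Phi> r - \<Phi> p - integral {p..r} k\<bar> \<le> e * integral {p..r} N"
      proof
        assume pr: "a \<le> p \<and> r \<le> b"
        have "k integrable_on {p..r}" "N integrable_on {p..r}"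
          using integrable_subinterval_real[OF k] integrable_subinterval_real[OF N] pr by auto
        then have "integral {p..q} k + integral {q..r} k = integral {p..r} k"
          "integral {p..q} N + integral {q..r} N = integral {p..r} N"
          using * by (auto intro: Henstock_Kurzweil_Integration.integral_combine)
        then show "\<bar>\<Phi> r - \<Phi> p - integral {p..r} k\<bar> \<le> e * integral {p..r} N"
          using * pr by (simp add: distrib_left flip: \<open>integral {p..q} N + integral {q..r} N = integral {p..r} N\<close>)
      qed
    next
      fix x assume "a \<le> x" "x \<le> b"
      then show "\<exists>d>0. \<forall>p q. p \<le> x \<and> x \<le> q \<and> q - p < d \<longrightarrow> a \<le> p \<and> q \<le> b \<longrightarrow>
          \<bar>\<Phi> q - \<Phi> p - integral {p..q} k\<bar> \<le> e * integral {p..q} N"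
        using loc[OF that, of x] by fastforce
    qed (use assms in auto)
    then show ?thesis by simp
  qed
  have "\<bar>\<Phi> b - \<Phi> a - integral {a..b} k\<bar> \<le> 0"
  proof (rule field_le_epsilon)
    fix e :: real assume "e > 0"
    \<comment> \<open>The added 1 keeps \<open>M\<close> positive when the integral of N
      vanishes.\<close>
    define M where "M = \<bar>integral {a..b} N\<bar> + 1"
    have "M > 0" by (simp add: M_def)
    have "\<bar>\<Phi> b - \<Phi> a - integral {a..b} k\<bar> \<le> e / M * integral {a..b} N"
      using main[of "e / M"] \<open>e > 0\<close> \<open>M > 0\<close> by simp
    also have "\<dots> \<le> e / M * M"
      using \<open>e > 0\<close> \<open>M > 0\<close> by (intro mult_left_mono) (auto simp: M_def)
    finally show "\<bar>\<Phi> b - \<Phi> a - integral {a..b} k\<bar> \<le> 0 + e" using \<open>M > 0\<close> by simp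
  qed
  then show ?thesis by simp
qed

section \<open>Product and chain rule for indefinite integrals\<close>

lemma uniform_oscillation:
  fixes u :: "real \<Rightarrow> real"
  assumes "continuous_on {a..b} u" "x \<in> {a..b}" "0 < e"
  obtains d where "d > 0"
    "\<And>s t. s \<in> {a..b} \<Longrightarrow> t \<in> {a..b} \<Longrightarrow> \<bar>s - x\<bar> < d \<Longrightarrow> \<bar>t - x\<bar> < d \<Longrightarrow> \<bar>u s - u t\<bar> \<le> e"
proof -
  obtain d where d: "d > 0" "\<And>t. t \<in> {a..b} \<Longrightarrow> dist t x < d \<Longrightarrow> dist (u t) (u x) < e / 2"
    using assms unfolding continuous_on_iff by (metis half_gt_zero)
  show thesis
  proof (rule that[OF d(1)])
    fix s t assume "s \<in> {a..b}" "t \<in> {a..b}" "\<bar>s - x\<bar> < d" "\<bar>t - x\<bar> < d"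
    then have "\<bar>u s - u x\<bar> < e / 2" "\<bar>u t - u x\<bar> < e / 2"
      using d(2)[of s] d(2)[of t] by (auto simp: dist_real_def)
    then show "\<bar>u s - u t\<bar> \<le> e" by linarith
  qed
qed

lemma primitive_on_mult:
  assumes u: "primitive_on {a..b} u g" and v: "primitive_on {a..b} v h"
  shows "primitive_on {a..b} (\<lambda>x. u x * v x) (\<lambda>x. u x * h x + v x * g x)"
proof (cases "a \<le> b")
  case ab: True
  have cu: "continuous_on {a..b} u" and cv: "continuous_on {a..b} v"
    using continuous_on_primitive u v by auto
  have g: "g absolutely_integrable_on {a..b}" and h: "h absolutely_integrable_on {a..b}"
    using primitive_onD(1) u v ab by auto
  have k: "(\<lambda>x. u x * h x + v x * g x) absolutely_integrable_on {a..b}"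
    using abs_int_continuous_mult[OF cu h] abs_int_continuous_mult[OF cv g] by simp
  have N: "(\<lambda>x. \<bar>h x\<bar> + \<bar>g x\<bar>) absolutely_integrable_on {a..b}"
    using g h by (simp add: set_integrable_abs)
  show ?thesis
  proof (rule primitive_on_interval[OF k])
    fix y assume y: "y \<in> {a..b}"
    show "integral {a..y} (\<lambda>x. u x * h x + v x * g x) = u y * v y - u a * v a"
    proof (rule integral_eq_diff_local[where \<Phi> = "\<lambda>x. u x * v x" and N = "\<lambda>x. \<bar>h x\<bar> + \<bar>g x\<bar>"])
      fix e x :: real assume e: "0 < e" and x: "x \<in> {a..y}"
      then have x': "x \<in> {a..b}" using y by auto
      obtain d1 where d1: "d1 > 0" "\<And>s t. s \<in> {a..b} \<Longrightarrow> t \<in> {a..b} \<Longrightarrow> \<bar>s - x\<bar> < d1 \<Longrightarrow> \<bar>t - x\<bar> < d1 \<Longrightarrow> \<bar>u s - u t\<bar> \<le> e"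
        using uniform_oscillation[OF cu x' e] by metis
      obtain d2 where d2: "d2 > 0" "\<And>s t. s \<in> {a..b} \<Longrightarrow> t \<in> {a..b} \<Longrightarrow> \<bar>s - x\<bar> < d2 \<Longrightarrow> \<bar>t - x\<bar> < d2 \<Longrightarrow> \<bar>v s - v t\<bar> \<le> e"
        using uniform_oscillation[OF cv x' e] by metis
      have "\<bar>u q * v q - u p * v p - integral {p..q} (\<lambda>x. u x * h x + v x * g x)\<bar>
              \<le> e * integral {p..q} (\<lambda>x. \<bar>h x\<bar> + \<bar>g x\<bar>)"
        if pq: "a \<le> p" "p \<le> x" "x \<le> q" "q \<le> y" "q - p < min d1 d2" for p q
      proof -
        have sub: "p \<in> {a..b}" "q \<in> {a..b}" "p \<le> q" using pq y by auto
        have G: "g integrable_on {p..q}" "integral {p..q} g = u q - u p"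
          and H: "h integrable_on {p..q}" "integral {p..q} h = v q - v p"
          using primitive_onD[OF u sub] primitive_onD[OF v sub] by auto
        have K: "(\<lambda>x. u x * h x + v x * g x) integrable_on {p..q}"
          and N': "(\<lambda>x. \<bar>h x\<bar> + \<bar>g x\<bar>) integrable_on {p..q}"
          using abs_int_subinterval[OF k, of p q] abs_int_subinterval[OF N, of p q] sub
            absolutely_integrable_on_def by auto
        have "u q * v q - u p * v p = u q * integral {p..q} h + v p * integral {p..q} g"
          by (simp add: G H algebra_simps)
        also have "\<dots> = integral {p..q} (\<lambda>t. u q * h t + v p * g t)"
          using G H by (simp add: Henstock_Kurzweil_Integration.integral_add integrable_on_mult_right)
        finally have "u q * v q - u p * v p - integral {p..q} (\<lambda>x. u x * h x + v x * g x)
            = integral {p..q} (\<lambda>t. (u q * h t + v p * g t) - (u t * h t + v t * g t))"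
          using G H K by (simp add: Henstock_Kurzweil_Integration.integral_diff integrable_add integrable_on_mult_right)
        also have "norm \<dots> \<le> integral {p..q} (\<lambda>t. e * (\<bar>h t\<bar> + \<bar>g t\<bar>))"
        proof (rule integral_norm_bound_integral)
          fix t assume t: "t \<in> {p..q}"
          have "\<bar>u q - u t\<bar> \<le> e" "\<bar>v p - v t\<bar> \<le> e"
            using d1(2)[of q t] d2(2)[of p t] t pq sub by auto
          then have "\<bar>(u q - u t) * h t\<bar> \<le> e * \<bar>h t\<bar>" "\<bar>(v p - v t) * g t\<bar> \<le> e * \<bar>g t\<bar>"
            by (auto simp: abs_mult intro: mult_right_mono)
          then show "norm ((u q * h t + v p * g t) - (u t * h t + v t * g t)) \<le> e * (\<bar>h t\<bar> + \<bar>g t\<bar>)"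
            by (auto simp: algebra_simps)
        qed (use G H K N' in \<open>auto intro!: integrable_diff integrable_add integrable_on_mult_right\<close>)
        finally show ?thesis by simp
      qed
      then show "\<exists>d>0. \<forall>p q. a \<le> p \<and> p \<le> x \<and> x \<le> q \<and> q \<le> y \<and> q - p < d \<longrightarrow>
          \<bar>u q * v q - u p * v p - integral {p..q} (\<lambda>x. u x * h x + v x * g x)\<bar>
              \<le> e * integral {p..q} (\<lambda>x. \<bar>h x\<bar> + \<bar>g x\<bar>)"
        using d1(1) d2(1) by (intro exI[of _ "min d1 d2"]) auto
    qed (use y abs_int_subinterval[OF k, of a y] abs_int_subinterval[OF N, of a y] absolutely_integrable_on_def in auto)
  qed
qed (auto simp: primitive_on_def)

text \<open>The mean value theorem writes the increment over [p, q] as F'(z) times the integral of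
  g, with z close to u(x). Since u(t) is close to u(x) as well, replacing F'(z) by F'(u(t)) under
  the integral costs at most e |g|.\<close>

lemma primitive_on_compose:
  assumes u: "primitive_on {a..b} u g"
    and F: "\<And>y. (F has_real_derivative F' y) (at y)" and F': "continuous_on UNIV F'"
  shows "primitive_on {a..b} (\<lambda>x. F (u x)) (\<lambda>x. F' (u x) * g x)"
proof (cases "a \<le> b")
  case ab: True
  have cu: "continuous_on {a..b} u" using continuous_on_primitive u by auto
  have cFu: "continuous_on {a..b} (\<lambda>x. F' (u x))"
    using continuous_on_compose2[OF F' cu] by auto
  have g: "g absolutely_integrable_on {a..b}" using primitive_onD(1) u ab by auto
  have k: "(\<lambda>x. F' (u x) * g x) absolutely_integrable_on {a..b}"
    using abs_int_continuous_mult[OF cFu g] .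
  have N: "(\<lambda>x. \<bar>g x\<bar>) absolutely_integrable_on {a..b}"
    using g by (simp add: set_integrable_abs)
  show ?thesis
  proof (rule primitive_on_interval[OF k])
    fix y assume y: "y \<in> {a..b}"
    show "integral {a..y} (\<lambda>x. F' (u x) * g x) = F (u y) - F (u a)"
    proof (rule integral_eq_diff_local[where \<Phi> = "\<lambda>x. F (u x)" and N = "\<lambda>x. \<bar>g x\<bar>"])
      fix e x :: real assume e: "0 < e" and x: "x \<in> {a..y}"
      then have x': "x \<in> {a..b}" using y by auto
      have "isCont F' (u x)" using F' continuous_on_eq_continuous_at by blast
      then obtain r where r: "r > 0" "\<And>z. \<bar>z - u x\<bar> < r \<Longrightarrow> \<bar>F' z - F' (u x)\<bar> < e / 2"
        using e unfolding continuous_at_eps_delta dist_real_def by (metis half_gt_zero)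
      obtain d where d: "d > 0" "\<And>t. t \<in> {a..b} \<Longrightarrow> \<bar>t - x\<bar> < d \<Longrightarrow> \<bar>u t - u x\<bar> < r"
        using cu x' r(1) unfolding continuous_on_iff dist_real_def by metis
      have "\<bar>F (u q) - F (u p) - integral {p..q} (\<lambda>x. F' (u x) * g x)\<bar>
              \<le> e * integral {p..q} (\<lambda>x. \<bar>g x\<bar>)"
        if pq: "a \<le> p" "p \<le> x" "x \<le> q" "q \<le> y" "q - p < d" for p q
      proof -
        have sub: "p \<in> {a..b}" "q \<in> {a..b}" "p \<le> q" using pq y by auto
        have G: "g integrable_on {p..q}" "integral {p..q} g = u q - u p"
          using primitive_onD[OF u sub] by auto
        have K: "(\<lambda>x. F' (u x) * g x) integrable_on {p..q}"
          and N': "(\<lambda>x. \<bar>g x\<bar>) integrable_on {p..q}"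
          using abs_int_subinterval[OF k, of p q] abs_int_subinterval[OF N, of p q] sub
            absolutely_integrable_on_def by auto
        have near: "\<bar>u p - u x\<bar> < r" "\<bar>u q - u x\<bar> < r"
          using d(2)[of p] d(2)[of q] sub pq by auto
        obtain z where z: "F (u q) - F (u p) = (u q - u p) * F' z" "\<bar>z - u x\<bar> < r"
        proof (cases "u p" "u q" rule: linorder_cases)
          case less
          from MVT2[OF this F] obtain z where "u p < z" "z < u q" "F (u q) - F (u p) = (u q - u p) * F' z"
            by auto
          then show thesis using near by (intro that[of z]) auto
        next
          case equal
          then show thesis using r(1) by (intro that[of "u x"]) auto
        next
          case greater
          from MVT2[OF this F] obtain z where "u q < z" "z < u p" "F (u p) - F (u q) = (u p - u q) * F' z"
            by auto
          then show thesis using near by (intro that[of z]) (auto simp: algebra_simps)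
        qed
        have "F (u q) - F (u p) - integral {p..q} (\<lambda>x. F' (u x) * g x)
            = integral {p..q} (\<lambda>t. F' z * g t - F' (u t) * g t)"
          using G K z(1) by (simp add: Henstock_Kurzweil_Integration.integral_diff integrable_on_mult_right)
        also have "norm \<dots> \<le> integral {p..q} (\<lambda>t. e * \<bar>g t\<bar>)"
        proof (rule integral_norm_bound_integral)
          fix t assume t: "t \<in> {p..q}"
          then have "\<bar>u t - u x\<bar> < r" using d(2)[of t] pq sub by auto
          then have "\<bar>F' z - F' (u t)\<bar> \<le> e" using r(2)[of "u t"] r(2)[OF z(2)] by linarith
          then have "\<bar>(F' z - F' (u t)) * g t\<bar> \<le> e * \<bar>g t\<bar>"
            by (auto simp: abs_mult intro: mult_right_mono)
          then show "norm (F' z * g t - F' (u t) * g t) \<le> e * \<bar>g t\<bar>"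
            by (simp add: left_diff_distrib)
        qed (use G K N' in \<open>auto intro!: integrable_diff integrable_on_mult_right\<close>)
        finally show ?thesis by simp
      qed
      then show "\<exists>d>0. \<forall>p q. a \<le> p \<and> p \<le> x \<and> x \<le> q \<and> q \<le> y \<and> q - p < d \<longrightarrow>
          \<bar>F (u q) - F (u p) - integral {p..q} (\<lambda>x. F' (u x) * g x)\<bar>
              \<le> e * integral {p..q} (\<lambda>x. \<bar>g x\<bar>)"
        using d(1) by (intro exI[of _ d]) auto
    qed (use y abs_int_subinterval[OF k, of a y] abs_int_subinterval[OF N, of a y] absolutely_integrable_on_def in auto)
  qed
qed (auto simp: primitive_on_def)

lemma primitive_on_C1:
  assumes "\<And>x. (u has_real_derivative u' x) (at x)" "continuous_on UNIV u'"
  shows "primitive_on I u u'"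
  unfolding primitive_on_def
proof (intro ballI impI conjI)
  fix x y :: real assume "x \<le> y"
  show "u' absolutely_integrable_on {x..y}"
    using assms(2) continuous_on_subset by (intro absolutely_integrable_continuous_real) blast
  have "(u' has_integral u y - u x) {x..y}"
    using assms(1) \<open>x \<le> y\<close>
    by (intro fundamental_theorem_of_calculus)
       (auto simp: has_real_derivative_iff_has_vector_derivative has_vector_derivative_at_within)
  then show "integral {x..y} u' = u y - u x" by blast
qed

text \<open>By Henstock's lemma the Riemann sums of $|v|$ are arbitrarily small.\<close>

lemma AE_zero_of_zero_integrals:
  fixes v :: "real \<Rightarrow> real"
  assumes v: "v absolutely_integrable_on {a..b}"
    and zero: "\<And>x y. a \<le> x \<Longrightarrow> x \<le> y \<Longrightarrow> y \<le> b \<Longrightarrow> integral {x..y} v = 0"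
  shows "AE x in lebesgue. x \<in> {a..b} \<longrightarrow> v x = 0"
proof -
  have int: "v integrable_on cbox a b" using v absolutely_integrable_on_def by auto
  have "((\<lambda>x. \<bar>v x\<bar>) has_integral 0) (cbox a b)"
    unfolding has_integral
  proof (intro allI impI)
    fix e :: real assume "e > 0"
    obtain \<gamma> where \<gamma>: "gauge \<gamma>" "\<And>p. \<lbrakk>p tagged_partial_division_of (cbox a b); \<gamma> fine p\<rbrakk> \<Longrightarrow>
             sum (\<lambda>(x,k). norm (measure lborel k *\<^sub>R v x - integral k v)) p < e"
      by (rule Henstock_lemma[OF int \<open>e > 0\<close>]) (erule that, blast)
    have "norm ((\<Sum>(x, k)\<in>\<D>. measure lborel k *\<^sub>R \<bar>v x\<bar>) - 0) < e"
      if D: "\<D> tagged_division_of cbox a b" "\<gamma> fine \<D>" for \<D>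
    proof -
      have "norm ((\<Sum>(x, k)\<in>\<D>. measure lborel k *\<^sub>R \<bar>v x\<bar>) - 0) = (\<Sum>(x, k)\<in>\<D>. measure lborel k *\<^sub>R \<bar>v x\<bar>)"
        by (simp, rule abs_of_nonneg, rule sum_nonneg, auto)
      \<comment> \<open>As v integrates to zero over every cell, each term of the Riemann sum equals
        the Henstock error of its cell.\<close>
      also have "\<dots> = (\<Sum>(x, k)\<in>\<D>. norm (measure lborel k *\<^sub>R v x - integral k v))"
      proof (rule sum.cong, safe)
        fix x K assume xK: "(x, K) \<in> \<D>"
        then obtain c d where K: "K = cbox c d" "x \<in> K" "K \<subseteq> cbox a b"
          using tagged_division_ofD(2)[OF D(1) xK] tagged_division_ofD(3)[OF D(1) xK] tagged_division_ofD(4)[OF D(1) xK] by blast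
        then have "integral K v = 0" using zero[of c d] by auto
        then show "measure lborel K *\<^sub>R \<bar>v x\<bar> = norm (measure lborel K *\<^sub>R v x - integral K v)"
          by (simp add: abs_mult)
      qed
      also have "\<dots> < e" by (rule \<gamma>(2)) (use D in \<open>auto simp: tagged_division_of_def\<close>)
      finally show ?thesis .
    qed
    then show "\<exists>\<gamma>. gauge \<gamma> \<and> (\<forall>\<D>. \<D> tagged_division_of cbox a b \<and> \<gamma> fine \<D> \<longrightarrow>
        norm ((\<Sum>(x, k)\<in>\<D>. measure lborel k *\<^sub>R \<bar>v x\<bar>) - 0) < e)"
      using \<gamma>(1) by blast
  qed
  moreover have v': "(\<lambda>x. \<bar>v x\<bar>) absolutely_integrable_on {a..b}" using v by (simp add: set_integrable_abs)
  ultimately have "(LINT x:{a..b}|lebesgue. \<bar>v x\<bar>) = 0"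
    using set_lebesgue_integral_eq_integral(2)[OF v'] by (simp add: integral_unique)
  then have "AE x in lebesgue. indicator {a..b} x *\<^sub>R \<bar>v x\<bar> = 0"
    using v' unfolding set_lebesgue_integral_def set_integrable_def
    by (subst (asm) integral_nonneg_eq_0_iff_AE) auto
  then show ?thesis by eventually_elim (auto simp: indicator_def)
qed

section \<open>Test functions\<close>

lemma C_k_0: "C_k 0 f \<longleftrightarrow> continuous_on UNIV f"
  by (simp add: C_k_def)

text \<open>Peels off the first derivative instead of the last, so that inductions on k can run
  along f, f', f'' and so on.\<close>

lemma C_k_Suc: "C_k (Suc k) f \<longleftrightarrow> f differentiable_on UNIV \<and> C_k k (deriv f)"
  by (auto simp: C_k_def funpow_swap1 All_less_Suc2)

lemma has_deriv_of_differentiable_on_UNIV: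
  fixes f :: "real \<Rightarrow> real"
  assumes "f differentiable_on UNIV"
  shows "(f has_real_derivative deriv f x) (at x)"
  using assms unfolding differentiable_on_def
  by (simp add: DERIV_deriv_iff_real_differentiable)

lemma C_k_SucI:
  assumes "\<And>x. (f has_real_derivative f' x) (at x)" "C_k k f'"
  shows "C_k (Suc k) f"
proof -
  have "deriv f = f'" using assms(1) DERIV_imp_deriv by blast
  moreover have "f differentiable_on UNIV"
    using assms(1) by (auto simp: differentiable_on_def real_differentiable_def)
  ultimately show ?thesis using assms(2) by (simp add: C_k_Suc)
qed

abbreviation smooth :: "(real \<Rightarrow> real) \<Rightarrow> bool" where
  "smooth f \<equiv> \<forall>k. C_k k f"

text \<open>Smoothness by coinduction: a class of functions closed under differentiation replaces
  explicit formulas for the k-th derivative.\<close>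

lemma smooth_coinduct:
  assumes closed: "\<And>f. f \<in> A \<Longrightarrow> \<exists>f'\<in>A. \<forall>x. (f has_real_derivative f' x) (at x)" and "f \<in> A"
  shows "smooth f"
proof
  fix k show "C_k k f" using \<open>f \<in> A\<close>
  proof (induction k arbitrary: f)
    case 0
    then obtain f' where "\<forall>x. (f has_real_derivative f' x) (at x)" using closed by blast
    then show ?case by (auto simp: C_k_0 intro!: continuous_at_imp_continuous_on DERIV_isCont)
  next
    case (Suc k)
    then show ?case using closed C_k_SucI by metis
  qed
qed

lemma smooth_has_deriv: "smooth f \<Longrightarrow> (f has_real_derivative deriv f x) (at x)"
  by (rule has_deriv_of_differentiable_on_UNIV) (metis C_k_Suc)

lemma smooth_deriv: "smooth f \<Longrightarrow> smooth (deriv f)"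
  using C_k_Suc by blast

lemma smooth_continuous: "smooth f \<Longrightarrow> continuous_on T f"
  using C_k_0 continuous_on_subset by blast

lemma smooth_linear_combination:
  assumes "smooth f" "smooth g"
  shows "smooth (\<lambda>x. \<alpha> * f x + \<beta> * g x)"
proof (rule smooth_coinduct[where A = "{\<lambda>x. \<alpha> * f x + \<beta> * g x | f g. smooth f \<and> smooth g}"])
  fix h assume "h \<in> {\<lambda>x. \<alpha> * f x + \<beta> * g x | f g. smooth f \<and> smooth g}"
  then obtain f g where h: "h = (\<lambda>x. \<alpha> * f x + \<beta> * g x)" "smooth f" "smooth g" by auto
  have "(h has_real_derivative \<alpha> * deriv f x + \<beta> * deriv g x) (at x)" for x
    unfolding h(1) using smooth_has_deriv[OF h(2)] smooth_has_deriv[OF h(3)]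
    by (auto intro!: derivative_eq_intros)
  then show "\<exists>f'\<in>{\<lambda>x. \<alpha> * f x + \<beta> * g x | f g. smooth f \<and> smooth g}. \<forall>x. (h has_real_derivative f' x) (at x)"
    using smooth_deriv[OF h(2)] smooth_deriv[OF h(3)]
    by (intro bexI[of _ "\<lambda>x. \<alpha> * deriv f x + \<beta> * deriv g x"]) blast+
qed (use assms in blast)

lemma smooth_affine:
  assumes "smooth f"
  shows "smooth (\<lambda>x. f (m * x + q))"
proof (rule smooth_coinduct[where A = "{\<lambda>x. c * f (m * x + q) | c f. smooth f}"])
  fix h assume "h \<in> {\<lambda>x. c * f (m * x + q) | c f. smooth f}"
  then obtain c f where h: "h = (\<lambda>x. c * f (m * x + q))" "smooth f" by auto
  have "(h has_real_derivative (c * m) * deriv f (m * x + q)) (at x)" for x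
    unfolding h(1)
    by (auto intro!: derivative_eq_intros DERIV_chain'[where g=f] smooth_has_deriv[OF h(2)])
  then show "\<exists>f'\<in>{\<lambda>x. c * f (m * x + q) | c f. smooth f}. \<forall>x. (h has_real_derivative f' x) (at x)"
    using smooth_deriv[OF h(2)]
    by (intro bexI[of _ "\<lambda>x. (c * m) * deriv f (m * x + q)"]) blast+
next
  show "(\<lambda>x. f (m * x + q)) \<in> {\<lambda>x. c * f (m * x + q) | c f. smooth f}"
    using assms by (auto intro!: exI[of _ 1] exI[of _ f])
qed

section \<open>Flat exponentials and smooth bumps\<close>

definition flat_exp :: "real \<Rightarrow> nat \<Rightarrow> real \<Rightarrow> real" where
  "flat_exp c n x = (if x > 0 then exp (- c / x) / x ^ n else 0)"

text \<open>A single term of the exponential series bounds exp(c/x) from below. Its order is n + 2: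
  n powers absorb the factor 1/x^n, and the two remaining ones make the difference quotient at 0
  tend to 0.\<close>

lemma flat_exp_le:
  assumes "c > 0"
  shows "\<bar>flat_exp c n x\<bar> \<le> fact (n + 2) / c ^ (n + 2) * x\<^sup>2"
proof (cases "x > 0")
  case True
  have "(c / x) ^ (n + 2) / fact (n + 2) \<le> exp (c / x)"
  proof -
    have "(\<Sum>k\<in>{n+2}. inverse (fact k) *\<^sub>R (c / x) ^ k) \<le> (\<Sum>k. inverse (fact k) *\<^sub>R (c / x) ^ k)"
      using True assms by (intro sum_le_suminf summable_exp_generic) auto
    then show ?thesis by (simp add: exp_def divide_inverse mult.commute)
  qed
  moreover have "1 / E \<le> f / t" if "t / f \<le> E" "0 < t" "0 < f" "0 < E" for t f E :: real
    using that by (simp add: field_simps)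
  ultimately have "exp (- (c / x)) \<le> fact (n + 2) / (c / x) ^ (n + 2)"
    using True assms by (simp only: exp_minus inverse_eq_divide) (meson divide_pos_pos exp_gt_zero fact_gt_zero zero_less_power)
  then have "exp (- (c / x)) / x ^ n \<le> fact (n + 2) / (c / x) ^ (n + 2) / x ^ n"
    using True by (intro divide_right_mono) auto
  also have "\<dots> = fact (n + 2) / c ^ (n + 2) * x\<^sup>2"
    using True assms by (simp add: power_divide power_add power2_eq_square)
  finally show ?thesis using True by (simp add: flat_exp_def)
qed (use assms in \<open>auto simp: flat_exp_def\<close>)

text \<open>Every differentiation raises the power of 1/x, so the index \<open>n\<close> is what
  closes the family under derivatives. Only the point 0 requires an estimate.\<close>

lemma has_derivative_flat_exp:
  assumes "c > 0"
  shows "(flat_exp c n has_real_derivative c * flat_exp c (n + 2) x - real n * flat_exp c (n + 1) x) (at x)"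
proof (cases x "0::real" rule: linorder_cases)
  case less
  have "((\<lambda>_. 0) has_real_derivative 0) (at x)" by simp
  then have "(flat_exp c n has_real_derivative 0) (at x)"
    by (rule has_field_derivative_transform_within_open[where S = "{..<0}"]) (use less in \<open>auto simp: flat_exp_def\<close>)
  then show ?thesis using less by (simp add: flat_exp_def)
next
  case equal
  define K where "K = fact (n + 2) / c ^ (n + 2)"
  have "(\<lambda>h. (flat_exp c n (0 + h) - flat_exp c n 0) / h) \<midarrow>0\<rightarrow> 0"
  proof (rule Lim_null_comparison)
    show "\<forall>\<^sub>F h in at 0. norm ((flat_exp c n (0 + h) - flat_exp c n 0) / h) \<le> K * \<bar>h\<bar>"
    proof (rule eventually_mono[OF eventually_neq_at_within[of 0]])
      fix h :: real assume "h \<noteq> 0"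
      have "norm ((flat_exp c n (0 + h) - flat_exp c n 0) / h) = \<bar>flat_exp c n h\<bar> / \<bar>h\<bar>"
        by (simp add: flat_exp_def)
      also have "\<dots> \<le> (K * h\<^sup>2) / \<bar>h\<bar>"
        using flat_exp_le[OF assms, of n h] by (intro divide_right_mono) (auto simp: K_def)
      also have "\<dots> = K * \<bar>h\<bar>"
        using \<open>h \<noteq> 0\<close> by (auto simp: power2_eq_square field_simps abs_if)
      finally show "norm ((flat_exp c n (0 + h) - flat_exp c n 0) / h) \<le> K * \<bar>h\<bar>" .
    qed
    have "((\<lambda>h. K * \<bar>h\<bar>) \<longlongrightarrow> K * \<bar>0\<bar>) (at (0::real))" by (intro tendsto_intros)
    then show "((\<lambda>h. K * \<bar>h\<bar>) \<longlongrightarrow> 0) (at (0::real))" by simp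
  qed
  then have "(flat_exp c n has_real_derivative 0) (at 0)" by (simp only: DERIV_def)
  then show ?thesis using equal by (simp add: flat_exp_def)
next
  case greater
  have "((\<lambda>x. exp (- c / x) / x ^ n) has_real_derivative c * flat_exp c (n + 2) x - real n * flat_exp c (n + 1) x) (at x)"
    using greater
    by (auto intro!: derivative_eq_intros simp: flat_exp_def field_simps power2_eq_square power_add)
       (cases n; simp add: field_simps)
  then show ?thesis
    by (rule has_field_derivative_transform_within_open[where S = "{0<..}"]) (use greater in \<open>auto simp: flat_exp_def\<close>)
qed

text \<open>An algebra closed under differentiation that contains the bumps on $[a,b]$; all its members are smooth.\<close>

inductive_set flat_algebra :: "real \<Rightarrow> real \<Rightarrow> real \<Rightarrow> (real \<Rightarrow> real) set" for a b c where
  left: "(\<lambda>x. flat_exp c n (x - a)) \<in> flat_algebra a b c"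
| right: "(\<lambda>x. flat_exp c n (b - x)) \<in> flat_algebra a b c"
| scale: "f \<in> flat_algebra a b c \<Longrightarrow> (\<lambda>x. r * f x) \<in> flat_algebra a b c"
| add: "f \<in> flat_algebra a b c \<Longrightarrow> g \<in> flat_algebra a b c \<Longrightarrow> (\<lambda>x. f x + g x) \<in> flat_algebra a b c"
| mult: "f \<in> flat_algebra a b c \<Longrightarrow> g \<in> flat_algebra a b c \<Longrightarrow> (\<lambda>x. f x * g x) \<in> flat_algebra a b c"

lemma flat_algebra_deriv:
  assumes "c > 0" "f \<in> flat_algebra a b c"
  shows "\<exists>f'\<in>flat_algebra a b c. \<forall>x. (f has_real_derivative f' x) (at x)"
  using assms(2)
proof induction
  case (left n)
  have "(\<lambda>x. c * flat_exp c (n + 2) (x - a) + (- real n) * flat_exp c (n + 1) (x - a)) \<in> flat_algebra a b c"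
    by (intro flat_algebra.intros)
  moreover have "((\<lambda>x. flat_exp c n (x - a)) has_real_derivative
      c * flat_exp c (n + 2) (x - a) + (- real n) * flat_exp c (n + 1) (x - a)) (at x)" for x
  proof -
    have "((\<lambda>x. x - a) has_real_derivative 1) (at x)" by (auto intro!: derivative_eq_intros)
    from DERIV_chain2[OF has_derivative_flat_exp[OF assms(1), of n "x - a"] this]
    show ?thesis by simp
  qed
  ultimately show ?case by (intro rev_bexI allI)
next
  case (right n)
  have "(\<lambda>x. (- c) * flat_exp c (n + 2) (b - x) + real n * flat_exp c (n + 1) (b - x)) \<in> flat_algebra a b c"
    by (intro flat_algebra.intros)
  moreover have "((\<lambda>x. flat_exp c n (b - x)) has_real_derivative
      (- c) * flat_exp c (n + 2) (b - x) + real n * flat_exp c (n + 1) (b - x)) (at x)" for x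
  proof -
    have "((\<lambda>x. b - x) has_real_derivative - 1) (at x)" by (auto intro!: derivative_eq_intros)
    from DERIV_chain2[OF has_derivative_flat_exp[OF assms(1), of n "b - x"] this]
    show ?thesis by (simp add: algebra_simps)
  qed
  ultimately show ?case by (intro rev_bexI allI)
next
  case (scale f r)
  then obtain f' where f': "f' \<in> flat_algebra a b c" "\<And>x. (f has_real_derivative f' x) (at x)" by blast
  show ?case
    by (rule bexI[OF _ flat_algebra.scale[OF f'(1), of r]]) (auto intro!: derivative_eq_intros f'(2))
next
  case (add f g)
  then obtain f' g' where f': "f' \<in> flat_algebra a b c" "\<And>x. (f has_real_derivative f' x) (at x)"
    and g': "g' \<in> flat_algebra a b c" "\<And>x. (g has_real_derivative g' x) (at x)" by blast
  show ?case
    by (rule bexI[OF _ flat_algebra.add[OF f'(1) g'(1)]]) (auto intro!: derivative_eq_intros f'(2) g'(2))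
next
  case (mult f g)
  then obtain f' g' where f': "f' \<in> flat_algebra a b c" "\<And>x. (f has_real_derivative f' x) (at x)"
    and g': "g' \<in> flat_algebra a b c" "\<And>x. (g has_real_derivative g' x) (at x)" by blast
  have "(\<lambda>x. f' x * g x + g' x * f x) \<in> flat_algebra a b c"
    using f'(1) g'(1) mult.hyps by (intro flat_algebra.intros)
  moreover have "((\<lambda>x. f x * g x) has_real_derivative f' x * g x + g' x * f x) (at x)" for x
    using f'(2) g'(2) by (rule DERIV_mult)
  ultimately show ?case by (intro rev_bexI allI)
qed

definition bump :: "real \<Rightarrow> real \<Rightarrow> real \<Rightarrow> real \<Rightarrow> real" where
  "bump a b c x = flat_exp c 0 (x - a) * flat_exp c 0 (b - x)"

lemma bump_eq: "bump a b c x = (if a < x \<and> x < b then exp (- c / (x - a)) * exp (- c / (b - x)) else 0)"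
  by (auto simp: bump_def flat_exp_def)

lemma test_function_bump:
  assumes "c > 0" "{a..b} \<subseteq> S"
  shows "test_function S (bump a b c)"
proof -
  have "bump a b c \<in> flat_algebra a b c"
    unfolding bump_def[abs_def] by (intro flat_algebra.intros)
  then have "smooth (bump a b c)"
    using smooth_coinduct[OF flat_algebra_deriv[OF assms(1)]] by blast
  moreover have "\<forall>x. x \<notin> {a..b} \<longrightarrow> bump a b c x = 0" by (auto simp: bump_eq)
  ultimately show ?thesis unfolding test_function_def using assms(2) by blast
qed

lemma bump_bounds: "c > 0 \<Longrightarrow> 0 \<le> bump a b c x" "c > 0 \<Longrightarrow> bump a b c x \<le> 1"
  by (auto simp: bump_eq intro!: mult_le_one)

text \<open>The parameter \<open>c\<close> of the bumps is kept free for this limit: as it tends to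
  0, both exponentials tend to 1 inside the interval. Together with the bounds 0 and 1 this lets
  test functions approximate an indicator under dominated convergence.\<close>

lemma bump_tendsto: "(\<lambda>n. bump a b (1 / real (Suc n)) x) \<longlonglongrightarrow> indicator {a<..<b} x"
proof (cases "a < x \<and> x < b")
  case True
  have *: "(\<lambda>n. 1 / real (Suc n)) \<longlonglongrightarrow> 0" using LIMSEQ_inverse_real_of_nat by (simp add: inverse_eq_divide)
  have "(\<lambda>n. exp (- (1 / real (Suc n)) / (x - a)) * exp (- (1 / real (Suc n)) / (b - x)))
      \<longlonglongrightarrow> exp (- 0 / (x - a)) * exp (- 0 / (b - x))"
    using True by (intro tendsto_intros *) auto
  then show ?thesis using True by (simp add: bump_eq)
qed (auto simp: bump_eq)

lemma smooth_test: "test_function S \<phi> \<Longrightarrow> smooth \<phi>"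
  by (simp add: test_function_def)

section \<open>Supports and primitives of test functions\<close>

lemma test_function_mono: "test_function S \<phi> \<Longrightarrow> S \<subseteq> T \<Longrightarrow> test_function T \<phi>"
  unfolding test_function_def by blast

lemma test_functionI:
  assumes "smooth \<phi>" "{a..b} \<subseteq> S" "\<And>x. x \<notin> {a..b} \<Longrightarrow> \<phi> x = 0"
  shows "test_function S \<phi>"
  unfolding test_function_def using assms compact_Icc by blast

lemma compact_pos_subset_Icc:
  fixes K :: "real set"
  assumes "compact K" "K \<subseteq> {0<..}"
  obtains a b where "0 < a" "a < b" "K \<subseteq> {a..b}"
proof (cases "K = {}")
  case True
  then show thesis by (intro that[of 1 2]) auto
next
  case False
  obtain l where l: "l \<in> K" "\<forall>x\<in>K. l \<le> x" using compact_attains_inf[OF assms(1) False] by auto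
  obtain u where u: "u \<in> K" "\<forall>x\<in>K. x \<le> u" using compact_attains_sup[OF assms(1) False] by auto
  have "0 < l" "l < u + 1" using l(1) assms(2) u(2) by force+
  then show thesis using l(2) u(2) by (intro that[of l "u + 1"]) force+
qed

lemma test_function_pos_support:
  assumes "test_function {0<..} \<phi>"
  obtains a b where "0 < a" "a < b" "\<And>x. x \<notin> {a..b} \<Longrightarrow> \<phi> x = 0"
proof -
  obtain K where K: "compact K" "K \<subseteq> {0<..}" "\<forall>x. x \<notin> K \<longrightarrow> \<phi> x = 0"
    using assms unfolding test_function_def by blast
  obtain a b where "0 < a" "a < b" "K \<subseteq> {a..b}" using compact_pos_subset_Icc[OF K(1,2)] by metis
  then show thesis using K(3) by (intro that[of a b]) auto
qed

lemma deriv_zero_outside: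
  fixes \<phi> :: "real \<Rightarrow> real"
  assumes "closed K" "\<And>x. x \<notin> K \<Longrightarrow> \<phi> x = 0" "x \<notin> K"
  shows "deriv \<phi> x = 0"
proof (rule DERIV_imp_deriv)
  show "(\<phi> has_real_derivative 0) (at x)"
    by (rule has_field_derivative_transform_within_open[where S = "- K" and f = "\<lambda>_. 0"])
       (use assms in auto)
qed

lemma test_function_deriv:
  assumes "test_function {0<..} \<phi>"
  shows "test_function {0<..} (deriv \<phi>)"
proof -
  obtain a b where ab: "0 < a" "a < b" "\<And>x. x \<notin> {a..b} \<Longrightarrow> \<phi> x = 0"
    using test_function_pos_support[OF assms] by metis
  show ?thesis
    by (rule test_functionI[of _ a b])
       (use ab smooth_deriv[OF smooth_test[OF assms]] deriv_zero_outside[OF closed_atLeastAtMost ab(3)] in auto)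
qed

lemma test_function_linear_combination:
  assumes "test_function {0<..} f" "test_function {0<..} g"
  shows "test_function {0<..} (\<lambda>x. \<alpha> * f x + \<beta> * g x)"
proof -
  obtain a b where ab: "0 < a" "a < b" "\<And>x. x \<notin> {a..b} \<Longrightarrow> f x = 0"
    using test_function_pos_support[OF assms(1)] by metis
  obtain c d where cd: "0 < c" "c < d" "\<And>x. x \<notin> {c..d} \<Longrightarrow> g x = 0"
    using test_function_pos_support[OF assms(2)] by metis
  have "smooth (\<lambda>x. \<alpha> * f x + \<beta> * g x)"
    by (rule smooth_linear_combination) (use assms smooth_test in blast)+
  then show ?thesis
  proof (rule test_functionI[of _ "min a c" "max b d"])
    fix x assume "x \<notin> {min a c..max b d}"
    then have "x \<notin> {a..b}" "x \<notin> {c..d}" by auto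
    then show "\<alpha> * f x + \<beta> * g x = 0" using ab(3) cd(3) by simp
  qed (use ab cd in auto)
qed

text \<open>Mean zero makes the primitive vanish again to the right of b, hence keeps its support
  compact. This turns mean-zero test functions into derivatives of test functions.\<close>

lemma test_function_antiderivative:
  assumes psi: "test_function {0<..} \<psi>" and ab: "0 < a" "a < b" "\<And>x. x \<notin> {a..b} \<Longrightarrow> \<psi> x = 0"
    and zero: "integral {a..b} \<psi> = 0"
  shows "test_function {0<..} (\<lambda>x. integral {a..x} \<psi>)"
    and "((\<lambda>x. integral {a..x} \<psi>) has_real_derivative \<psi> x) (at x)"
proof -
  define \<phi> where "\<phi> = (\<lambda>x. integral {a..x} \<psi>)"
  have cont: "continuous_on T \<psi>" for T using smooth_continuous smooth_test psi by blast
  have int: "\<psi> integrable_on {p..q}" for p q using cont integrable_continuous_real by blast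
  have out: "\<phi> x = 0" if "x \<notin> {a..b}" for x
  proof (cases "x < a")
    case False
    then have "x > b" using that by auto
    have "integral {a..b} \<psi> + integral {b..x} \<psi> = integral {a..x} \<psi>"
      using \<open>x > b\<close> ab by (intro Henstock_Kurzweil_Integration.integral_combine int) auto
    moreover have "integral {b..x} \<psi> = integral {b..x} (\<lambda>_. 0)"
      by (rule integral_spike[of "{b}"]) (use ab in auto)
    ultimately show ?thesis using zero by (simp add: \<phi>_def)
  qed (simp add: \<phi>_def)
  have der: "(\<phi> has_real_derivative \<psi> x) (at x)" for x
  proof -
    \<comment> \<open>The integral over {a..y} has an empty domain for y < a, which obstructs a
      two-sided derivative at points x \<le> a. Starting at \<open>l\<close>, strictly to the left
      of both a and x, gives the same function because \<psi> vanishes before a.\<close>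
    define l where "l = min a x - 1"
    have *: "((\<lambda>y. integral {l..y} \<psi>) has_real_derivative \<psi> x) (at x within {l..x+1})"
      using integral_has_real_derivative[OF cont, of x l "x+1"] by (auto simp: l_def)
    have "((\<lambda>y. integral {l..y} \<psi>) has_real_derivative \<psi> x) (at x)"
      using * at_within_Icc_at[of l x "x+1"] by (simp add: l_def)
    moreover have "integral {l..y} \<psi> = \<phi> y" for y
    proof (cases "y < a")
      case True
      have "integral {l..y} \<psi> = integral {l..y} (\<lambda>_. 0)"
        by (rule integral_cong) (use ab True in auto)
      then show ?thesis using True by (simp add: \<phi>_def)
    next
      case False
      have "integral {l..a} \<psi> + integral {a..y} \<psi> = integral {l..y} \<psi>"
        using False by (intro Henstock_Kurzweil_Integration.integral_combine int) (auto simp: l_def)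
      moreover have "integral {l..a} \<psi> = integral {l..a} (\<lambda>_. 0)"
        by (rule integral_spike[of "{a}"]) (use ab in auto)
      ultimately show ?thesis by (simp add: \<phi>_def)
    qed
    ultimately show ?thesis by simp
  qed
  have "C_k k \<phi>" for k
  proof (cases k)
    case 0
    then show ?thesis using der by (auto simp: C_k_0 intro!: continuous_at_imp_continuous_on DERIV_isCont)
  next
    case (Suc m)
    then show ?thesis using C_k_SucI[OF der] smooth_test[OF psi] by blast
  qed
  then have "test_function {0<..} \<phi>"
    by (intro test_functionI[of \<phi> a b]) (use ab out in auto)
  then show "test_function {0<..} (\<lambda>x. integral {a..x} \<psi>)"
    and "((\<lambda>x. integral {a..x} \<psi>) has_real_derivative \<psi> x) (at x)"
    using der by (auto simp: \<phi>_def)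
qed

section \<open>Weak derivatives on the half-line\<close>

lemma locally_integrable_pos_iff:
  "locally_integrable {0<..} f \<longleftrightarrow> (\<forall>a b. 0 < a \<longrightarrow> f absolutely_integrable_on {a..b})"
proof
  assume "locally_integrable {0<..} f"
  then show "\<forall>a b. 0 < a \<longrightarrow> f absolutely_integrable_on {a..b}"
    unfolding locally_integrable_def by (auto simp: subset_eq)
next
  assume *: "\<forall>a b. 0 < a \<longrightarrow> f absolutely_integrable_on {a..b}"
  show "locally_integrable {0<..} f"
    unfolding locally_integrable_def
  proof (intro allI impI, elim conjE)
    fix K :: "real set" assume K: "compact K" "K \<subseteq> {0<..}"
    obtain a b where ab: "0 < a" "K \<subseteq> {a..b}" using compact_pos_subset_Icc[OF K] by metis
    then have "f absolutely_integrable_on {a..b}" using * by blast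
    then show "f absolutely_integrable_on K"
      by (rule set_integrable_subset) (use K(1) ab in \<open>auto intro: lmeasurable_compact fmeasurableD\<close>)
  qed
qed

lemma locally_integrable_diff:
  "locally_integrable S f \<Longrightarrow> locally_integrable S g \<Longrightarrow> locally_integrable S (\<lambda>x. f x - g x)"
  unfolding locally_integrable_def by auto

lemma locally_integrable_primitive:
  assumes "primitive_on {0<..} u g"
  shows "locally_integrable {0<..} u" "locally_integrable {0<..} g"
  unfolding locally_integrable_pos_iff
proof (safe)
  fix a b :: real assume "0 < a"
  then have "primitive_on {a..b} u g" by (intro primitive_on_subset[OF assms]) auto
  then show "u absolutely_integrable_on {a..b}"
    using absolutely_integrable_continuous_real continuous_on_primitive by blast
next
  fix a b :: real assume "0 < a"
  then show "g absolutely_integrable_on {a..b}"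
    using primitive_onD(1)[OF assms, of a b] by (cases "a \<le> b") auto
qed

lemma abs_int_test:
  assumes "f absolutely_integrable_on {a..b}" "test_function S \<phi>"
  shows "(\<lambda>x. f x * \<phi> x) absolutely_integrable_on {a..b}"
  using abs_int_continuous_mult[OF smooth_continuous[OF smooth_test[OF assms(2)]] assms(1)]
  by (simp add: mult.commute)

lemma LINT_test_eq_integral:
  assumes "{a..b} \<subseteq> S" "\<And>x. x \<notin> {a..b} \<Longrightarrow> \<phi> x = 0" "test_function T \<phi>"
    and "f absolutely_integrable_on {a..b}"
  shows "(LINT x:S|lebesgue. f x * \<phi> x) = integral {a..b} (\<lambda>x. f x * \<phi> x)"
proof -
  have "(LINT x:S|lebesgue. f x * \<phi> x) = (LINT x:{a..b}|lebesgue. f x * \<phi> x)"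
    unfolding set_lebesgue_integral_def
    by (rule Bochner_Integration.integral_cong) (use assms(1,2) in \<open>auto simp: indicator_def\<close>)
  then show ?thesis
    using set_lebesgue_integral_eq_integral(2)[OF abs_int_test[OF assms(4,3)]] by simp
qed

text \<open>Integration by parts: the product rule is integrated over an interval at whose ends
  \<phi> is zero.\<close>

lemma has_weak_deriv_primitive:
  assumes u: "primitive_on {0<..} u g"
  shows "has_weak_deriv {0<..} u g"
  unfolding has_weak_deriv_def
proof (intro conjI allI impI locally_integrable_primitive[OF u])
  fix \<phi> assume test: "test_function {0<..} \<phi>"
  obtain a' b' where ab': "0 < a'" "a' < b'" "\<And>x. x \<notin> {a'..b'} \<Longrightarrow> \<phi> x = 0"
    using test_function_pos_support[OF test] by metis
  \<comment> \<open>The interval is enlarged so that its endpoints lie outside [a', b'], where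
    \<phi> is known to vanish; halving a' keeps it inside the half-line.\<close>
  define a b where "a = a' / 2" and "b = b' + 1"
  have ab: "0 < a" "a < b" "{a..b} \<subseteq> {0<..}" "\<phi> a = 0" "\<phi> b = 0"
    and out: "\<And>x. x \<notin> {a..b} \<Longrightarrow> \<phi> x = 0"
    using ab' by (auto simp: a_def b_def)
  have ug: "u absolutely_integrable_on {a..b}" "g absolutely_integrable_on {a..b}"
    using locally_integrable_primitive[OF u] ab(1) by (auto simp: locally_integrable_pos_iff)
  have "primitive_on {a..b} \<phi> (deriv \<phi>)"
    using test smooth_test smooth_has_deriv smooth_continuous smooth_deriv
    by (intro primitive_on_C1) blast+
  then have "primitive_on {a..b} (\<lambda>x. u x * \<phi> x) (\<lambda>x. u x * deriv \<phi> x + \<phi> x * g x)"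
    using primitive_on_subset[OF u ab(3)] primitive_on_mult by blast
  then have "integral {a..b} (\<lambda>x. u x * deriv \<phi> x + \<phi> x * g x) = 0"
    using primitive_onD(3)[of "{a..b}" _ _ a b] ab by auto
  moreover have "integral {a..b} (\<lambda>x. u x * deriv \<phi> x + \<phi> x * g x)
      = integral {a..b} (\<lambda>x. u x * deriv \<phi> x) + integral {a..b} (\<lambda>x. g x * \<phi> x)"
    using abs_int_test[OF ug(1) test_function_deriv[OF test]] abs_int_test[OF ug(2) test]
    by (subst Henstock_Kurzweil_Integration.integral_add[symmetric])
       (auto simp: absolutely_integrable_on_def mult.commute)
  ultimately show "(LINT x:{0<..}|lebesgue. u x * deriv \<phi> x) = - (LINT x:{0<..}|lebesgue. g x * \<phi> x)"
    using LINT_test_eq_integral[OF ab(3) _ test_function_deriv[OF test] ug(1)]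
      LINT_test_eq_integral[OF ab(3) _ test ug(2)] out deriv_zero_outside[of "{a..b}" \<phi>]
    by simp
qed

section \<open>Uniqueness of weak derivatives and the lemma of du Bois-Reymond\<close>

lemma AE_lebesgue_negligible:
  assumes "AE x in lebesgue. P x"
  obtains N where "negligible N" "\<And>x. x \<notin> N \<Longrightarrow> P x"
  using assms unfolding eventually_ae_filter_negligible by blast

lemma has_weak_deriv_cong_AE:
  assumes "has_weak_deriv {0<..} f g"
    and f: "AE x in lebesgue. 0 < x \<longrightarrow> f x = f' x" and g: "AE x in lebesgue. 0 < x \<longrightarrow> g x = g' x"
  shows "has_weak_deriv {0<..} f' g'"
proof -
  obtain N where N: "negligible N" "\<And>x. x \<notin> N \<Longrightarrow> (0 < x \<longrightarrow> f x = f' x) \<and> (0 < x \<longrightarrow> g x = g' x)"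
    using AE_lebesgue_negligible[OF AE_conjI[OF f g]] by blast
  have fg: "f absolutely_integrable_on {a..b}" "g absolutely_integrable_on {a..b}" if "0 < a" for a b
    using assms(1) that by (auto simp: has_weak_deriv_def locally_integrable_pos_iff)
  have fg': "f' absolutely_integrable_on {a..b}" "g' absolutely_integrable_on {a..b}" if "0 < a" for a b
    using absolutely_integrable_spike[OF fg(1) N(1)] absolutely_integrable_spike[OF fg(2) N(1)] N(2) that
    by force+
  show ?thesis
    unfolding has_weak_deriv_def
  proof (intro conjI allI impI)
    fix \<phi> assume test: "test_function {0<..} \<phi>"
    obtain a b where ab: "0 < a" "a < b" and out: "\<And>x. x \<notin> {a..b} \<Longrightarrow> \<phi> x = 0"
      using test_function_pos_support[OF test] by metis
    have sub: "{a..b} \<subseteq> {0<..}" using ab by auto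
    have out': "\<And>x. x \<notin> {a..b} \<Longrightarrow> deriv \<phi> x = 0" using deriv_zero_outside[of "{a..b}" \<phi>] out by blast
    note test' = test_function_deriv[OF test]
    have "integral {a..b} (\<lambda>x. f x * deriv \<phi> x) = integral {a..b} (\<lambda>x. f' x * deriv \<phi> x)"
      "integral {a..b} (\<lambda>x. g x * \<phi> x) = integral {a..b} (\<lambda>x. g' x * \<phi> x)"
      using N ab by (auto intro!: integral_spike[OF N(1)])
    moreover have "(LINT x:{0<..}|lebesgue. f x * deriv \<phi> x) = - (LINT x:{0<..}|lebesgue. g x * \<phi> x)"
      using assms(1) test unfolding has_weak_deriv_def by blast
    ultimately show "(LINT x:{0<..}|lebesgue. f' x * deriv \<phi> x) = - (LINT x:{0<..}|lebesgue. g' x * \<phi> x)"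
      using LINT_test_eq_integral[OF sub out' test' fg(1)[OF ab(1)]]
        LINT_test_eq_integral[OF sub out' test' fg'(1)[OF ab(1)]]
        LINT_test_eq_integral[OF sub out test fg(2)[OF ab(1)]]
        LINT_test_eq_integral[OF sub out test fg'(2)[OF ab(1)]] by simp
  qed (use fg' in \<open>auto simp: locally_integrable_pos_iff\<close>)
qed

text \<open>Testing with bumps that converge to the indicator of (a, b) shows that v has integral
  zero over every compact interval, which forces v = 0 a.e.\<close>

lemma fundamental_lemma:
  assumes v: "locally_integrable {0<..} v"
    and zero: "\<And>\<phi>. test_function {0<..} \<phi> \<Longrightarrow> (LINT x:{0<..}|lebesgue. v x * \<phi> x) = 0"
  shows "AE x in lebesgue. 0 < x \<longrightarrow> v x = 0"
proof -
  have av: "v absolutely_integrable_on {a..b}" if "0 < a" for a b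
    using v that by (auto simp: locally_integrable_pos_iff)
  have int0: "integral {a..b} v = 0" if ab: "0 < a" "a \<le> b" for a b
  proof -
    let ?c = "\<lambda>n. 1 / real (Suc n)"
    have test: "test_function {0<..} (bump a b (?c n))" for n
      by (rule test_function_bump) (use ab in auto)
    have sub: "{a..b} \<subseteq> {0<..}" using ab by auto
    have "integral {a..b} (\<lambda>x. v x * bump a b (?c n) x) = 0" for n
    proof -
      have "(LINT x:{0<..}|lebesgue. v x * bump a b (?c n) x) = integral {a..b} (\<lambda>x. v x * bump a b (?c n) x)"
        by (rule LINT_test_eq_integral[OF sub _ test av[OF ab(1)]]) (auto simp: bump_eq)
      then show ?thesis using zero[OF test] by simp
    qed
    moreover have "(\<lambda>n. integral {a..b} (\<lambda>x. v x * bump a b (?c n) x))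
        \<longlonglongrightarrow> integral {a..b} (\<lambda>x. v x * indicator {a<..<b} x)"
    proof (rule dominated_convergence(2))
      show "(\<lambda>x. v x * bump a b (?c n) x) integrable_on {a..b}" for n
        using abs_int_test[OF av[OF ab(1)] test] absolutely_integrable_on_def by blast
      show "(\<lambda>x. \<bar>v x\<bar>) integrable_on {a..b}"
        using av[OF ab(1), of b] by (simp add: absolutely_integrable_on_def)
      show "norm (v x * bump a b (?c n) x) \<le> \<bar>v x\<bar>" if "x \<in> {a..b}" for n x
        using bump_bounds[of "?c n" a b x] by (simp add: abs_mult mult_left_le)
      show "(\<lambda>n. v x * bump a b (?c n) x) \<longlonglongrightarrow> v x * indicator {a<..<b} x" for x
        by (intro tendsto_intros bump_tendsto)
    qed
    moreover have "integral {a..b} (\<lambda>x. v x * indicator {a<..<b} x) = integral {a..b} v"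
      by (rule integral_spike[of "{a,b}"]) auto
    ultimately show ?thesis by (simp add: LIMSEQ_const_iff)
  qed
  \<comment> \<open>The intervals [1/(n+1), n+1] exhaust the half-line, and countably many null sets
    have a null union.\<close>
  have "AE x in lebesgue. \<forall>n. x \<in> {1 / real (Suc n)..real (Suc n)} \<longrightarrow> v x = 0"
    unfolding AE_all_countable
  proof
    fix n
    have "0 < 1 / real (Suc n)" by simp
    then show "AE x in lebesgue. x \<in> {1 / real (Suc n)..real (Suc n)} \<longrightarrow> v x = 0"
      by (intro AE_zero_of_zero_integrals av int0; linarith)
  qed
  then show ?thesis
  proof eventually_elim
    fix x assume *: "\<forall>n. x \<in> {1 / real (Suc n)..real (Suc n)} \<longrightarrow> v x = 0"
    show "0 < x \<longrightarrow> v x = 0"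
    proof
      assume "0 < x"
      obtain n :: nat where n: "max x (1 / x) < real n" using reals_Archimedean2 by blast
      have "1 / real (Suc n) \<le> x" "x \<le> real (Suc n)"
        using n \<open>0 < x\<close> by (simp_all add: divide_le_eq less_divide_eq divide_less_eq algebra_simps)
      then show "v x = 0" using * by auto
    qed
  qed
qed

lemma has_weak_deriv_unique:
  assumes "has_weak_deriv {0<..} f g" "has_weak_deriv {0<..} f h"
  shows "AE x in lebesgue. 0 < x \<longrightarrow> g x = h x"
proof -
  have gh: "locally_integrable {0<..} g" "locally_integrable {0<..} h"
    using assms by (auto simp: has_weak_deriv_def)
  have "AE x in lebesgue. 0 < x \<longrightarrow> g x - h x = 0"
  proof (rule fundamental_lemma[OF locally_integrable_diff[OF gh]])
    fix \<phi> assume test: "test_function {0<..} \<phi>"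
    obtain a b where ab: "0 < a" "a < b" and out: "\<And>x. x \<notin> {a..b} \<Longrightarrow> \<phi> x = 0"
      using test_function_pos_support[OF test] by metis
    have sub: "{a..b} \<subseteq> {0<..}" using ab by auto
    have gh': "g absolutely_integrable_on {a..b}" "h absolutely_integrable_on {a..b}"
      using gh ab by (auto simp: locally_integrable_pos_iff)
    have "(LINT x:{0<..}|lebesgue. f x * deriv \<phi> x) = - (LINT x:{0<..}|lebesgue. g x * \<phi> x)"
      "(LINT x:{0<..}|lebesgue. f x * deriv \<phi> x) = - (LINT x:{0<..}|lebesgue. h x * \<phi> x)"
      using assms test unfolding has_weak_deriv_def by blast+
    then have "integral {a..b} (\<lambda>x. g x * \<phi> x) = integral {a..b} (\<lambda>x. h x * \<phi> x)"
      using LINT_test_eq_integral[OF sub out test gh'(1)] LINT_test_eq_integral[OF sub out test gh'(2)] by simp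
    moreover have "integral {a..b} (\<lambda>x. (g x - h x) * \<phi> x)
        = integral {a..b} (\<lambda>x. g x * \<phi> x) - integral {a..b} (\<lambda>x. h x * \<phi> x)"
      using abs_int_test[OF gh'(1) test] abs_int_test[OF gh'(2) test]
      by (simp add: left_diff_distrib absolutely_integrable_on_def Henstock_Kurzweil_Integration.integral_diff)
    ultimately show "(LINT x:{0<..}|lebesgue. (g x - h x) * \<phi> x) = 0"
      using LINT_test_eq_integral[OF sub out test, of "\<lambda>x. g x - h x"] gh' by simp
  qed
  then show ?thesis by eventually_elim simp
qed

lemma weak_deriv_eq_AE:
  assumes "has_weak_deriv {0<..} f g"
  shows "has_weak_deriv {0<..} f (weak_deriv {0<..} f)"
    and "AE x in lebesgue. 0 < x \<longrightarrow> weak_deriv {0<..} f x = g x"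
proof -
  show *: "has_weak_deriv {0<..} f (weak_deriv {0<..} f)"
    unfolding weak_deriv_def by (rule someI[of "has_weak_deriv {0<..} f", OF assms])
  show "AE x in lebesgue. 0 < x \<longrightarrow> weak_deriv {0<..} f x = g x"
    by (rule has_weak_deriv_unique[OF * assms])
qed

lemma primitive_exists:
  assumes "locally_integrable {0<..} g"
  shows "\<exists>u. primitive_on {0<..} u g"
proof -
  \<comment> \<open>The base point is 1 and not 0, because g is only known to be integrable away
    from 0; hence the sign change to the left of 1.\<close>
  define u where "u x = (if 1 \<le> x then integral {1..x} g else - integral {x..1} g)" for x
  have ag: "g absolutely_integrable_on {a..b}" if "0 < a" for a b
    using assms that by (auto simp: locally_integrable_pos_iff)
  have ig: "g integrable_on {a..b}" if "0 < a" for a b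
    using ag[OF that] absolutely_integrable_on_def by blast
  have "primitive_on {0<..} u g"
    unfolding primitive_on_def
  proof (intro ballI impI conjI)
    fix x y :: real assume xy: "x \<in> {0<..}" "y \<in> {0<..}" "x \<le> y"
    show "g absolutely_integrable_on {x..y}" using ag xy by auto
    consider "1 \<le> x" | "x < 1" "1 \<le> y" | "y < 1" by linarith
    then show "integral {x..y} g = u y - u x"
    proof cases
      case 1
      then have "integral {1..x} g + integral {x..y} g = integral {1..y} g"
        using xy by (intro Henstock_Kurzweil_Integration.integral_combine ig) auto
      then show ?thesis using 1 xy by (simp add: u_def)
    next
      case 2
      then have "integral {x..1} g + integral {1..y} g = integral {x..y} g"
        using xy by (intro Henstock_Kurzweil_Integration.integral_combine ig) auto
      then show ?thesis using 2 xy by (simp add: u_def)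
    next
      case 3
      then have "integral {x..y} g + integral {y..1} g = integral {x..1} g"
        using xy by (intro Henstock_Kurzweil_Integration.integral_combine ig) auto
      then show ?thesis using 3 xy by (simp add: u_def)
    qed
  qed
  then show ?thesis by blast
qed

lemma integral_bump_pos:
  assumes "a < b" "c > 0"
  shows "integral {a..b} (bump a b c) > 0"
proof -
  have cont: "continuous_on {a..b} (bump a b c)"
    using smooth_continuous[OF smooth_test[OF test_function_bump[OF assms(2) subset_UNIV]]] .
  have "integral {a..b} (bump a b c) \<noteq> 0"
  proof
    assume "integral {a..b} (bump a b c) = 0"
    then have "bump a b c ((a + b) / 2) = 0"
      using integral_eq_0_iff[OF cont] bump_bounds(1)[OF assms(2)] assms(1) by auto
    then show False using assms(1) by (simp add: bump_eq)
  qed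
  moreover have "integral {a..b} (bump a b c) \<ge> 0"
    using integral_nonneg[OF integrable_continuous_real[OF cont]] bump_bounds(1)[OF assms(2)] by blast
  ultimately show ?thesis by simp
qed

text \<open>The lemma of du Bois-Reymond. The difference w of f and a primitive of g annihilates all
  derivatives of test functions. Subtracting from a test function \<psi> the multiple of one fixed
  bump that removes its mean leaves such a derivative, so the integral of w \<psi> is a constant
  times that of \<psi>, and w is a.e. this constant.\<close>

lemma weak_deriv_imp_primitive:
  assumes fg: "has_weak_deriv {0<..} f g"
  obtains u where "primitive_on {0<..} u g" "AE x in lebesgue. 0 < x \<longrightarrow> f x = u x"
proof -
  have lf: "locally_integrable {0<..} f" and lg: "locally_integrable {0<..} g"
    using fg by (auto simp: has_weak_deriv_def)
  obtain u where u: "primitive_on {0<..} u g" using primitive_exists[OF lg] by blast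
  have lu: "locally_integrable {0<..} u" using locally_integrable_primitive[OF u] by blast
  define w where "w x = f x - u x" for x
  have lw: "locally_integrable {0<..} w"
    unfolding w_def[abs_def] by (rule locally_integrable_diff[OF lf lu])
  have w0: "(LINT x:{0<..}|lebesgue. w x * deriv \<phi> x) = 0" if test: "test_function {0<..} \<phi>" for \<phi>
  proof -
    obtain a b where ab: "0 < a" "a < b" and out: "\<And>x. x \<notin> {a..b} \<Longrightarrow> \<phi> x = 0"
      using test_function_pos_support[OF test] by metis
    have sub: "{a..b} \<subseteq> {0<..}" using ab by auto
    have out': "\<And>x. x \<notin> {a..b} \<Longrightarrow> deriv \<phi> x = 0" using deriv_zero_outside[of "{a..b}" \<phi>] out by blast
    note test' = test_function_deriv[OF test]
    have *: "f absolutely_integrable_on {a..b}" "u absolutely_integrable_on {a..b}" "w absolutely_integrable_on {a..b}"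
      using lf lu lw ab by (auto simp: locally_integrable_pos_iff)
    have "(LINT x:{0<..}|lebesgue. f x * deriv \<phi> x) = - (LINT x:{0<..}|lebesgue. g x * \<phi> x)"
      "(LINT x:{0<..}|lebesgue. u x * deriv \<phi> x) = - (LINT x:{0<..}|lebesgue. g x * \<phi> x)"
      using fg has_weak_deriv_primitive[OF u] test unfolding has_weak_deriv_def by blast+
    then have "integral {a..b} (\<lambda>x. f x * deriv \<phi> x) = integral {a..b} (\<lambda>x. u x * deriv \<phi> x)"
      using LINT_test_eq_integral[OF sub out' test' *(1)] LINT_test_eq_integral[OF sub out' test' *(2)] by simp
    moreover have "integral {a..b} (\<lambda>x. w x * deriv \<phi> x)
        = integral {a..b} (\<lambda>x. f x * deriv \<phi> x) - integral {a..b} (\<lambda>x. u x * deriv \<phi> x)"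
      using abs_int_test[OF *(1) test'] abs_int_test[OF *(2) test']
      by (simp add: w_def left_diff_distrib absolutely_integrable_on_def Henstock_Kurzweil_Integration.integral_diff)
    ultimately show ?thesis using LINT_test_eq_integral[OF sub out' test' *(3)] by simp
  qed
  define I0 where "I0 = integral {1..2} (bump 1 2 1)"
  have "I0 > 0" unfolding I0_def by (rule integral_bump_pos) auto
  have test_bump: "test_function {0<..} (bump 1 2 1)" by (rule test_function_bump) auto
  \<comment> \<open>The weighted mean of w against the fixed bump, the only possible value if w is
    to be constant.\<close>
  define c where "c = (LINT x:{0<..}|lebesgue. w x * bump 1 2 1 x) / I0"
  have "AE x in lebesgue. 0 < x \<longrightarrow> w x - c = 0"
  proof (rule fundamental_lemma)
    show lwc: "locally_integrable {0<..} (\<lambda>x. w x - c)"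
      using locally_integrable_diff[OF lw, of "\<lambda>_. c"] by (simp add: locally_integrable_pos_iff)
    fix \<psi> assume test: "test_function {0<..} \<psi>"
    obtain a' b' where ab': "0 < a'" "a' < b'" and out': "\<And>x. x \<notin> {a'..b'} \<Longrightarrow> \<psi> x = 0"
      using test_function_pos_support[OF test] by metis
    \<comment> \<open>The interval has to contain both the support of \<psi> and [1, 2], the support
      of the fixed bump.\<close>
    define a b where "a = min a' 1" and "b = max b' 2"
    have ab: "0 < a" "a < b" and sub: "{a..b} \<subseteq> {0<..}" using ab' by (auto simp: a_def b_def)
    have out: "\<psi> x = 0" "bump 1 2 1 x = 0" if "x \<notin> {a..b}" for x
    proof -
      have "x \<notin> {a'..b'}" "x \<notin> {1..2}" using that by (auto simp: a_def b_def)
      then show "\<psi> x = 0" "bump 1 2 1 x = 0" using out' by (auto simp: bump_eq)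
    qed
    define J where "J = integral {a..b} \<psi>"
    define \<xi> where "\<xi> x = 1 * \<psi> x + (- J / I0) * bump 1 2 1 x" for x
    have test_chi: "test_function {0<..} \<xi>"
      unfolding \<xi>_def[abs_def] by (rule test_function_linear_combination[OF test test_bump])
    have out_chi: "\<xi> x = 0" if "x \<notin> {a..b}" for x using out[OF that] by (simp add: \<xi>_def)
    have int: "\<psi> integrable_on {a..b}" "bump 1 2 1 integrable_on {a..b}"
      using smooth_continuous[OF smooth_test[OF test]] smooth_continuous[OF smooth_test[OF test_bump]]
        integrable_continuous_real by blast+
    have "integral {a..b} (bump 1 2 1) = I0"
    proof -
      have "(bump 1 2 1 has_integral I0) {1..2}"
        unfolding I0_def using smooth_continuous[OF smooth_test[OF test_bump]]
        by (intro integrable_integral integrable_continuous_real)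
      then have "(bump 1 2 1 has_integral I0) {a..b}"
        by (rule has_integral_on_superset) (auto simp: bump_eq a_def b_def)
      then show ?thesis by (rule integral_unique)
    qed
    moreover have "integral {a..b} \<xi> = J + (- J / I0) * integral {a..b} (bump 1 2 1)"
      unfolding \<xi>_def[abs_def] J_def using Henstock_Kurzweil_Integration.integral_add[OF int(1)
        integrable_on_mult_right[OF int(2), of "- integral {a..b} \<psi> / I0"]] by simp
    ultimately have "integral {a..b} \<xi> = 0" using \<open>I0 > 0\<close> by simp
    note anti = test_function_antiderivative[OF test_chi ab out_chi this]
    have "deriv (\<lambda>x. integral {a..x} \<xi>) = \<xi>"
      by (intro ext DERIV_imp_deriv anti(2))
    then have "(LINT x:{0<..}|lebesgue. w x * \<xi> x) = 0" using w0[OF anti(1)] by simp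
    have aw: "w absolutely_integrable_on {a..b}" using lw ab by (auto simp: locally_integrable_pos_iff)
    have awc: "(\<lambda>x. w x - c) absolutely_integrable_on {a..b}" using lwc ab by (auto simp: locally_integrable_pos_iff)
    have iw: "(\<lambda>x. w x * \<psi> x) integrable_on {a..b}" "(\<lambda>x. w x * bump 1 2 1 x) integrable_on {a..b}"
      using abs_int_test[OF aw test] abs_int_test[OF aw test_bump] absolutely_integrable_on_def by blast+
    have "0 = integral {a..b} (\<lambda>x. w x * \<xi> x)"
      using LINT_test_eq_integral[OF sub out_chi test_chi aw] \<open>(LINT x:{0<..}|lebesgue. w x * \<xi> x) = 0\<close> by simp
    also have "\<dots> = integral {a..b} (\<lambda>x. w x * \<psi> x + (- J / I0) * (w x * bump 1 2 1 x))"
      by (simp add: \<xi>_def algebra_simps)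
    also have "\<dots> = integral {a..b} (\<lambda>x. w x * \<psi> x) + (- J / I0) * integral {a..b} (\<lambda>x. w x * bump 1 2 1 x)"
      using Henstock_Kurzweil_Integration.integral_add[OF iw(1) integrable_on_mult_right[OF iw(2), of "- J / I0"]] by simp
    also have "integral {a..b} (\<lambda>x. w x * bump 1 2 1 x) = c * I0"
      using LINT_test_eq_integral[OF sub out(2) test_bump aw] \<open>I0 > 0\<close> by (simp add: c_def)
    also have "(- J / I0) * (c * I0) = - c * J" using \<open>I0 > 0\<close> by simp
    finally have "integral {a..b} (\<lambda>x. w x * \<psi> x) = c * J" by simp
    moreover have "integral {a..b} (\<lambda>x. (w x - c) * \<psi> x) = integral {a..b} (\<lambda>x. w x * \<psi> x) - c * J"
      unfolding left_diff_distrib J_def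
      using Henstock_Kurzweil_Integration.integral_diff[OF iw(1) integrable_on_mult_right[OF int(1), of c]] by simp
    ultimately show "(LINT x:{0<..}|lebesgue. (w x - c) * \<psi> x) = 0"
      using LINT_test_eq_integral[OF sub out(1) test awc] by simp
  qed
  then have "AE x in lebesgue. 0 < x \<longrightarrow> f x = u x + c"
    by eventually_elim (auto simp: w_def)
  moreover have "primitive_on {0<..} (\<lambda>x. u x + c) g"
    using u by (simp add: primitive_on_def)
  ultimately show thesis using that by blast
qed

text \<open>The normalised primitive of a bump on [1, 2] minus its translate to [3, 4]: it rises to
  1, stays constant on [2, 3] and falls back to 0, the two masses being equal.\<close>

lemma plateau_function:
  obtains \<eta> where "test_function {0<..} \<eta>" "\<And>x. x \<in> {2..3} \<Longrightarrow> \<eta> x = 1"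
proof -
  define I0 where "I0 = integral {1..2} (bump 1 2 1)"
  have "I0 > 0" unfolding I0_def by (rule integral_bump_pos) auto
  define \<psi> where "\<psi> x = 1 * bump 1 2 1 x + (- 1) * bump 3 4 1 x" for x
  have test: "test_function {0<..} \<psi>"
    unfolding \<psi>_def[abs_def] by (intro test_function_linear_combination test_function_bump) auto
  have out: "\<psi> x = 0" if "x \<notin> {1..4}" for x using that by (auto simp: \<psi>_def bump_eq)
  have int: "\<psi> integrable_on {p..q}" for p q
    using smooth_continuous[OF smooth_test[OF test]] integrable_continuous_real by blast
  have "integral {1..2} \<psi> = I0"
    unfolding I0_def by (rule integral_cong) (auto simp: \<psi>_def bump_eq)
  have "integral {3..4} \<psi> = - integral {3..4} (bump 3 4 1)"
    unfolding integral_neg[symmetric] by (rule integral_cong) (auto simp: \<psi>_def bump_eq)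
  also have "bump 3 4 1 = (\<lambda>x. bump 1 2 1 (x + (- 2)))" by (auto simp: bump_eq fun_eq_iff)
  also have "integral {3..4} (\<lambda>x. bump 1 2 1 (x + (- 2))) = I0"
  proof (rule integral_unique)
    have "bump 1 2 1 integrable_on {1..2::real}"
      by (intro integrable_continuous_real smooth_continuous[OF smooth_test[OF test_function_bump[OF _ subset_UNIV]]]) simp
    then have "(bump 1 2 1 has_integral I0) {1..2}" unfolding I0_def by blast
    then show "((\<lambda>x. bump 1 2 1 (x + (- 2))) has_integral I0) {3..4}"
      using has_integral_shift_real_ivl[of "bump 1 2 1" I0 1 2 "- 2"] by simp
  qed
  finally have "integral {3..4} \<psi> = - I0" .
  have mid: "integral {2..y} \<psi> = 0" if "y \<in> {2..3}" for y
  proof -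
    have "integral {2..y} \<psi> = integral {2..y} (\<lambda>_. 0)"
      by (rule integral_cong) (use that in \<open>auto simp: \<psi>_def bump_eq\<close>)
    then show ?thesis by simp
  qed
  have val: "integral {1..y} \<psi> = I0" if "y \<in> {2..3}" for y
    using Henstock_Kurzweil_Integration.integral_combine[of 1 2 y \<psi>] int that mid[OF that] \<open>integral {1..2} \<psi> = I0\<close> by auto
  have "integral {1..4} \<psi> = 0"
    using Henstock_Kurzweil_Integration.integral_combine[of 1 3 4 \<psi>] int val[of 3] \<open>integral {3..4} \<psi> = - I0\<close> by auto
  note anti = test_function_antiderivative(1)[OF test _ _ out this]
  show thesis
  proof (rule that)
    \<comment> \<open>The term \<open>0 * \<psi> x\<close> brings the scaling into the form of
      \<open>test_function_linear_combination\<close>.\<close>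
    show "test_function {0<..} (\<lambda>x. (1 / I0) * integral {1..x} \<psi> + 0 * \<psi> x)"
      by (rule test_function_linear_combination[OF anti test]) auto
  qed (use val \<open>I0 > 0\<close> in auto)
qed

section \<open>Square-integrable functions\<close>

lemma L2_iff:
  assumes "S \<in> sets lebesgue"
  shows "f \<in> L2 S \<longleftrightarrow> f \<in> borel_measurable (lebesgue_on S) \<and> integrable (lebesgue_on S) (\<lambda>x. (f x)\<^sup>2)"
  unfolding L2_def set_borel_measurable_def set_integrable_def using assms
  by (simp add: borel_measurable_restrict_space_iff integrable_restrict_space)

lemma L2_norm_eq:
  assumes "S \<in> sets lebesgue"
  shows "L2_norm S f = sqrt (LINT x|lebesgue_on S. (f x)\<^sup>2)"
  unfolding L2_norm_def set_lebesgue_integral_def using assms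
  by (simp add: integral_restrict_space)

lemma L2_norm_nonneg: "0 \<le> L2_norm S f"
  unfolding L2_norm_def set_lebesgue_integral_def by simp

lemma AE_on_iff:
  assumes "S \<in> sets lebesgue"
  shows "(AE x in lebesgue_on S. Q x) \<longleftrightarrow> (AE x in lebesgue. x \<in> S \<longrightarrow> Q x)"
  using assms by (simp add: AE_restrict_space_iff)

lemma measurable_on_cong_AE:
  fixes f g :: "real \<Rightarrow> real"
  assumes S: "S \<in> sets lebesgue" and f: "f \<in> borel_measurable (lebesgue_on S)"
    and eq: "AE x in lebesgue. x \<in> S \<longrightarrow> f x = g x"
  shows "g \<in> borel_measurable (lebesgue_on S)"
proof -
  have "(\<lambda>x. indicator S x * f x) \<in> borel_measurable lebesgue"
    using S f by (simp add: borel_measurable_restrict_space_iff)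
  then have "(\<lambda>x. indicator S x * g x) \<in> borel_measurable lebesgue"
    by (rule borel_measurable_AE) (use eq in eventually_elim, auto simp: indicator_def)
  then show ?thesis using S by (simp add: borel_measurable_restrict_space_iff)
qed

lemma L2_bound:
  assumes S: "S \<in> sets lebesgue" and f: "f \<in> borel_measurable (lebesgue_on S)" and g: "g \<in> L2 S"
    and le: "AE x in lebesgue. x \<in> S \<longrightarrow> \<bar>f x\<bar> \<le> c * \<bar>g x\<bar>" and "0 \<le> c"
  shows "f \<in> L2 S" and "L2_norm S f \<le> c * L2_norm S g"
proof -
  have g': "integrable (lebesgue_on S) (\<lambda>x. (g x)\<^sup>2)" using g L2_iff[OF S] by blast
  then have cg: "integrable (lebesgue_on S) (\<lambda>x. c\<^sup>2 * (g x)\<^sup>2)" by simp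
  have le2: "AE x in lebesgue_on S. (f x)\<^sup>2 \<le> c\<^sup>2 * (g x)\<^sup>2"
    unfolding AE_on_iff[OF S] using le
  proof eventually_elim
    fix x assume *: "x \<in> S \<longrightarrow> \<bar>f x\<bar> \<le> c * \<bar>g x\<bar>"
    show "x \<in> S \<longrightarrow> (f x)\<^sup>2 \<le> c\<^sup>2 * (g x)\<^sup>2"
      using * power_mono[of "\<bar>f x\<bar>" "c * \<bar>g x\<bar>" 2] by (auto simp: power_mult_distrib)
  qed
  have f': "integrable (lebesgue_on S) (\<lambda>x. (f x)\<^sup>2)"
    by (rule Bochner_Integration.integrable_bound[OF cg]) (use f le2 in auto)
  then show "f \<in> L2 S" using f L2_iff[OF S] by blast
  have "(LINT x|lebesgue_on S. (f x)\<^sup>2) \<le> (LINT x|lebesgue_on S. c\<^sup>2 * (g x)\<^sup>2)"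
    by (rule integral_mono_AE[OF f' cg le2])
  then have "sqrt (LINT x|lebesgue_on S. (f x)\<^sup>2) \<le> sqrt (c\<^sup>2 * (LINT x|lebesgue_on S. (g x)\<^sup>2))"
    by simp
  then show "L2_norm S f \<le> c * L2_norm S g"
    using \<open>0 \<le> c\<close> by (simp add: L2_norm_eq[OF S] real_sqrt_mult)
qed

lemma L2_cong_AE:
  assumes S: "S \<in> sets lebesgue" and f: "f \<in> L2 S" and eq: "AE x in lebesgue. x \<in> S \<longrightarrow> f x = g x"
  shows "g \<in> L2 S" and "L2_norm S g = L2_norm S f"
proof -
  have fm: "f \<in> borel_measurable (lebesgue_on S)" using f L2_iff[OF S] by blast
  have gm: "g \<in> borel_measurable (lebesgue_on S)" by (rule measurable_on_cong_AE[OF S fm eq])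
  have le: "AE x in lebesgue. x \<in> S \<longrightarrow> \<bar>g x\<bar> \<le> 1 * \<bar>f x\<bar>" "AE x in lebesgue. x \<in> S \<longrightarrow> \<bar>f x\<bar> \<le> 1 * \<bar>g x\<bar>"
    using eq by (auto elim: eventually_mono)
  show g: "g \<in> L2 S" using L2_bound(1)[OF S gm f le(1)] by simp
  show "L2_norm S g = L2_norm S f"
    using L2_bound(2)[OF S gm f le(1)] L2_bound(2)[OF S fm g le(2)] by simp
qed

lemma L2_mult_integrable:
  assumes S: "S \<in> sets lebesgue" and f: "f \<in> L2 S" and g: "g \<in> L2 S"
  shows "integrable (lebesgue_on S) (\<lambda>x. f x * g x)"
proof (rule Bochner_Integration.integrable_bound)
  show "integrable (lebesgue_on S) (\<lambda>x. (f x)\<^sup>2 + (g x)\<^sup>2)"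
    using f g by (auto simp: L2_iff[OF S])
  have "\<bar>a * b\<bar> \<le> \<bar>a\<^sup>2 + b\<^sup>2\<bar>" for a b :: real
  proof -
    have "0 \<le> \<bar>a\<bar> * \<bar>b\<bar>" by simp
    moreover have "2 * (\<bar>a\<bar> * \<bar>b\<bar>) \<le> a\<^sup>2 + b\<^sup>2" using sum_squares_bound[of "\<bar>a\<bar>" "\<bar>b\<bar>"] by simp
    ultimately show ?thesis unfolding abs_mult by linarith
  qed
  then show "AE x in lebesgue_on S. norm (f x * g x) \<le> norm ((f x)\<^sup>2 + (g x)\<^sup>2)" by simp
qed (use f g in \<open>auto simp: L2_iff[OF S]\<close>)

lemma L2_linear:
  assumes S: "S \<in> sets lebesgue" and f: "f \<in> L2 S" and g: "g \<in> L2 S"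
  shows "(\<lambda>x. f x + t * g x) \<in> L2 S"
    and "(LINT x|lebesgue_on S. (f x + t * g x)\<^sup>2) = (LINT x|lebesgue_on S. (f x)\<^sup>2)
      + 2 * t * (LINT x|lebesgue_on S. f x * g x) + t\<^sup>2 * (LINT x|lebesgue_on S. (g x)\<^sup>2)"
proof -
  have i: "integrable (lebesgue_on S) (\<lambda>x. (f x)\<^sup>2)" "integrable (lebesgue_on S) (\<lambda>x. (g x)\<^sup>2)"
    "integrable (lebesgue_on S) (\<lambda>x. f x * g x)"
    using f g L2_mult_integrable[OF S f g] by (auto simp: L2_iff[OF S])
  have eq: "(\<lambda>x. (f x + t * g x)\<^sup>2) = (\<lambda>x. ((f x)\<^sup>2 + (2 * t) * (f x * g x)) + t\<^sup>2 * (g x)\<^sup>2)"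
    by (auto simp: power2_eq_square algebra_simps)
  have "integrable (lebesgue_on S) (\<lambda>x. (f x + t * g x)\<^sup>2)"
    unfolding eq using i by (intro Bochner_Integration.integrable_add integrable_mult_right) auto
  then show "(\<lambda>x. f x + t * g x) \<in> L2 S" using f g by (auto simp: L2_iff[OF S])
  show "(LINT x|lebesgue_on S. (f x + t * g x)\<^sup>2) = (LINT x|lebesgue_on S. (f x)\<^sup>2)
      + 2 * t * (LINT x|lebesgue_on S. f x * g x) + t\<^sup>2 * (LINT x|lebesgue_on S. (g x)\<^sup>2)"
    unfolding eq using i by simp
qed

lemma L2_Cauchy_Schwarz:
  assumes S: "S \<in> sets lebesgue" and f: "f \<in> L2 S" and g: "g \<in> L2 S"
  shows "\<bar>LINT x|lebesgue_on S. f x * g x\<bar> \<le> L2_norm S f * L2_norm S g"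
proof -
  define A where "A = (LINT x|lebesgue_on S. (f x)\<^sup>2)"
  define B where "B = (LINT x|lebesgue_on S. f x * g x)"
  define C where "C = (LINT x|lebesgue_on S. (g x)\<^sup>2)"
  have pos: "0 \<le> A + 2 * t * B + t\<^sup>2 * C" for t
  proof -
    have "0 \<le> (LINT x|lebesgue_on S. (f x + t * g x)\<^sup>2)" by simp
    then show ?thesis using L2_linear(2)[OF S f g, of t] by (simp add: A_def B_def C_def)
  qed
  have "0 \<le> C" by (simp add: C_def)
  have "B\<^sup>2 \<le> A * C"
  proof (cases "C = 0")
    case True
    have "B = 0"
    proof (rule ccontr)
      assume "B \<noteq> 0"
      \<comment> \<open>With C = 0 the quadratic in t degenerates to A + 2 t B, and this t would
        give it the value -1.\<close>
      then have "2 * (- (A + 1) / (2 * B)) * B = - (A + 1)" by simp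
      then show False using pos[of "- (A + 1) / (2 * B)"] True by simp
    qed
    then show ?thesis using True by simp
  next
    case False
    then have "C > 0" using \<open>0 \<le> C\<close> by simp
    \<comment> \<open>The minimiser of the quadratic A + 2 t B + t^2 C.\<close>
    define r where "r = - B / C"
    have r: "r * C = - B" using \<open>C > 0\<close> by (simp add: r_def)
    have "0 \<le> (A + 2 * r * B + r\<^sup>2 * C) * C" using pos[of r] \<open>0 \<le> C\<close> by (rule mult_nonneg_nonneg)
    also have "\<dots> = A * C + 2 * (r * C) * B + (r * C)\<^sup>2" by (simp add: algebra_simps power2_eq_square)
    also have "\<dots> = A * C - B\<^sup>2" unfolding r by (simp add: power2_eq_square)
    finally show ?thesis by simp
  qed
  then have "\<bar>B\<bar> \<le> sqrt (A * C)" by (intro real_le_rsqrt) simp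
  then show ?thesis by (simp add: L2_norm_eq[OF S] A_def B_def C_def real_sqrt_mult)
qed

lemma L2_norm_triangle:
  assumes S: "S \<in> sets lebesgue" and f: "f \<in> L2 S" and g: "g \<in> L2 S"
  shows "(\<lambda>x. f x + g x) \<in> L2 S" and "L2_norm S (\<lambda>x. f x + g x) \<le> L2_norm S f + L2_norm S g"
proof -
  show "(\<lambda>x. f x + g x) \<in> L2 S" using L2_linear(1)[OF S f g, of 1] by simp
  define A where "A = (LINT x|lebesgue_on S. (f x)\<^sup>2)"
  define C where "C = (LINT x|lebesgue_on S. (g x)\<^sup>2)"
  have nn: "0 \<le> A" "0 \<le> C" by (auto simp: A_def C_def)
  have "(LINT x|lebesgue_on S. (f x + g x)\<^sup>2) = A + 2 * (LINT x|lebesgue_on S. f x * g x) + C"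
    using L2_linear(2)[OF S f g, of 1] by (simp add: A_def C_def)
  also have "\<dots> \<le> A + 2 * (sqrt A * sqrt C) + C"
    using L2_Cauchy_Schwarz[OF S f g] by (simp add: L2_norm_eq[OF S] A_def C_def)
  also have "\<dots> = (sqrt A + sqrt C)\<^sup>2" using nn by (simp add: power2_sum)
  finally show "L2_norm S (\<lambda>x. f x + g x) \<le> L2_norm S f + L2_norm S g"
    unfolding L2_norm_eq[OF S] using nn real_le_lsqrt[of "sqrt A + sqrt C"] by (simp add: A_def C_def)
qed

lemma L2_diff:
  assumes S: "S \<in> sets lebesgue" and f: "f \<in> L2 S" and g: "g \<in> L2 S"
  shows "(\<lambda>x. f x - g x) \<in> L2 S"
  using L2_linear(1)[OF assms, of "- 1"] by simp

lemma L2_subset: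
  assumes "S \<in> sets lebesgue" "T \<in> sets lebesgue" "T \<subseteq> S" "f \<in> L2 S"
  shows "f \<in> L2 T" and "L2_norm T f \<le> L2_norm S f"
proof -
  have i: "set_integrable lebesgue S (\<lambda>x. (f x)\<^sup>2)" and m: "set_borel_measurable lebesgue S f"
    using assms(4) by (auto simp: L2_def)
  have i': "set_integrable lebesgue T (\<lambda>x. (f x)\<^sup>2)" by (rule set_integrable_subset[OF i assms(2,3)])
  moreover have "set_borel_measurable lebesgue T f"
    by (rule set_borel_measurable_subset[OF m assms(2,3)])
  ultimately show "f \<in> L2 T" by (simp add: L2_def)
  show "L2_norm T f \<le> L2_norm S f"
    unfolding L2_norm_def real_sqrt_le_iff set_lebesgue_integral_def
    by (rule integral_mono) (use i i' assms(3) in \<open>auto simp: set_integrable_def indicator_def\<close>)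
qed

section \<open>Square-integrable functions on bounded intervals and pointwise bounds\<close>

lemma L2_bounded_interval:
  assumes "f \<in> borel_measurable (lebesgue_on {a..b})" "\<And>x. x \<in> {a..b} \<Longrightarrow> \<bar>f x\<bar> \<le> M"
  shows "f \<in> L2 {a..b}"
proof -
  have "(\<lambda>x. (f x)\<^sup>2) absolutely_integrable_on {a..b}"
  proof (rule measurable_bounded_by_integrable_imp_absolutely_integrable)
    show "(\<lambda>x. M\<^sup>2) integrable_on {a..b}" by (rule integrable_const_ivl)
    show "norm ((f x)\<^sup>2) \<le> M\<^sup>2" if "x \<in> {a..b}" for x
      using power_mono[OF assms(2)[OF that], of 2] by simp
  qed (use assms in auto)
  then show ?thesis using assms(1)
    by (simp add: L2_def set_borel_measurable_def borel_measurable_restrict_space_iff)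
qed

text \<open>Cauchy-Schwarz against the constant 1. This is where the Hoelder exponent 1/2 comes
  from.\<close>

lemma L2_integral_interval_le:
  assumes g: "g \<in> L2 {0<..}" and ab: "0 < a" "a \<le> b"
  shows "\<bar>integral {a..b} g\<bar> \<le> L2_norm {0<..} g * sqrt (b - a)"
proof -
  have sub: "{a..b} \<subseteq> {0<..}" using ab by auto
  have g': "g \<in> L2 {a..b}" "L2_norm {a..b} g \<le> L2_norm {0<..} g"
    using L2_subset[OF _ _ sub g] by auto
  have 1: "(\<lambda>_. 1) \<in> L2 {a..b}" by (rule L2_bounded_interval[of _ _ _ 1]) auto
  have n1: "L2_norm {a..b} (\<lambda>_. 1) = sqrt (b - a)"
    using ab by (simp add: L2_norm_eq measure_restrict_space)
  have "integrable (lebesgue_on {a..b}) g" using L2_mult_integrable[OF _ g'(1) 1] by simp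
  then have "integral {a..b} g = (LINT x|lebesgue_on {a..b}. g x * 1)"
    by (simp add: lebesgue_integral_eq_integral)
  also have "\<bar>\<dots>\<bar> \<le> L2_norm {a..b} g * L2_norm {a..b} (\<lambda>_. 1)"
    by (rule L2_Cauchy_Schwarz[OF _ g'(1) 1]) simp
  also have "\<dots> \<le> L2_norm {0<..} g * sqrt (b - a)"
    unfolding n1 using g'(2) ab by (intro mult_right_mono) auto
  finally show ?thesis .
qed

text \<open>On the unit interval to the right of x, which stays in the half-line, the minimum of |u|
  is at most the L^2 norm of u. From a point y attaining it, u changes by at most the L^2 norm of g
  on the way back to x.\<close>

lemma sobolev_sup_bound:
  assumes u: "primitive_on {0<..} u g" "u \<in> L2 {0<..}" "g \<in> L2 {0<..}" and x: "0 < x"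
  shows "\<bar>u x\<bar> \<le> L2_norm {0<..} u + L2_norm {0<..} g"
proof -
  have sub: "{x..x+1} \<subseteq> {0<..}" using x by auto
  have cu: "continuous_on {x..x+1} u"
    by (rule continuous_on_primitive[OF primitive_on_subset[OF u(1) sub]])
  then have "continuous_on {x..x+1} (\<lambda>t. (u t)\<^sup>2)" by (intro continuous_intros)
  then obtain y where y: "y \<in> {x..x+1}" "\<And>t. t \<in> {x..x+1} \<Longrightarrow> (u y)\<^sup>2 \<le> (u t)\<^sup>2"
    using continuous_attains_inf[of "{x..x+1}" "\<lambda>t. (u t)\<^sup>2"] by auto
  have u': "u \<in> L2 {x..x+1}" "L2_norm {x..x+1} u \<le> L2_norm {0<..} u"
    using L2_subset[OF _ _ sub u(2)] by auto
  have c: "(\<lambda>_. u y) \<in> L2 {x..x+1}" by (rule L2_bounded_interval[of _ _ _ "\<bar>u y\<bar>"]) auto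
  have "L2_norm {x..x+1} (\<lambda>_. u y) \<le> 1 * L2_norm {x..x+1} u"
    by (rule L2_bound(2)[OF _ _ u'(1)]) (use abs_le_square_iff[THEN iffD2, OF y(2)] in auto)
  moreover have "L2_norm {x..x+1} (\<lambda>_. u y) = \<bar>u y\<bar>"
    by (simp add: L2_norm_eq measure_restrict_space)
  ultimately have "\<bar>u y\<bar> \<le> L2_norm {0<..} u" using u'(2) by simp
  moreover have "\<bar>u y - u x\<bar> \<le> L2_norm {0<..} g * sqrt (y - x)"
    using L2_integral_interval_le[OF u(3) x, of y] primitive_onD(3)[OF u(1), of x y] x y(1) by auto
  moreover have "L2_norm {0<..} g * sqrt (y - x) \<le> L2_norm {0<..} g * 1"
    using y(1) L2_norm_nonneg by (intro mult_left_mono) auto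
  ultimately show ?thesis by linarith
qed

section \<open>Sufficiency\<close>

lemma sobolev_1_iff: "f \<in> sobolev 1 S \<longleftrightarrow> f \<in> L2 S \<and> (\<exists>g\<in>L2 S. has_weak_deriv S f g)"
  by (simp add: One_nat_def)

lemma sobolev_2_imp_1:
  assumes "f \<in> sobolev 2 S"
  shows "f \<in> sobolev 1 S"
  using assms by (auto simp: numeral_2_eq_2 One_nat_def)

lemma sobolev_norm_1: "sobolev_norm 1 S f = sqrt ((L2_norm S f)\<^sup>2 + (L2_norm S (weak_deriv S f))\<^sup>2)"
  by (simp add: sobolev_norm_def)

lemma sobolev_norm_1_le_2: "sobolev_norm 1 S f \<le> sobolev_norm 2 S f"
  unfolding sobolev_norm_def by (intro real_sqrt_le_mono sum_mono2) auto

lemma sobolev_norm_1_bounds: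
  "L2_norm S f \<le> sobolev_norm 1 S f" "L2_norm S (weak_deriv S f) \<le> sobolev_norm 1 S f"
  "sobolev_norm 1 S f \<le> L2_norm S f + L2_norm S (weak_deriv S f)"
  unfolding sobolev_norm_1 using sqrt_sum_squares_le_sum[OF L2_norm_nonneg[of S f] L2_norm_nonneg[of S "weak_deriv S f"]]
  by auto

lemma pos_in_sets_lebesgue: "{0::real<..} \<in> sets lebesgue"
  by simp

lemma primitive_on_posI:
  assumes "\<And>a b. 0 < a \<Longrightarrow> primitive_on {a..b} u g"
  shows "primitive_on {0<..} u g"
  unfolding primitive_on_def
proof (intro ballI impI)
  fix x y :: real assume "x \<in> {0<..}" "y \<in> {0<..}" "x \<le> y"
  then show "g absolutely_integrable_on {x..y} \<and> integral {x..y} g = u y - u x"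
    using primitive_onD[OF assms[of x y], of x y] by auto
qed

lemma primitive_on_diff:
  assumes "primitive_on I u g" "primitive_on I v h"
  shows "primitive_on I (\<lambda>x. u x - v x) (\<lambda>x. g x - h x)"
  unfolding primitive_on_def
proof (intro ballI impI conjI)
  fix x y assume xy: "x \<in> I" "y \<in> I" "x \<le> y"
  note u = primitive_onD[OF assms(1) xy] and v = primitive_onD[OF assms(2) xy]
  show "(\<lambda>x. g x - h x) absolutely_integrable_on {x..y}" using u(1) v(1) by simp
  show "integral {x..y} (\<lambda>x. g x - h x) = (u y - v y) - (u x - v x)"
    using u v by (simp add: Henstock_Kurzweil_Integration.integral_diff)
qed

text \<open>The density is the chosen \<open>weak_deriv\<close> itself and the bound uses the norms
  of f, because these are the quantities that \<open>Lip_property\<close> feeds into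
  \<open>C\<close>.\<close>

lemma sobolev_representative:
  assumes "f \<in> sobolev 1 {0<..}"
  obtains u where "primitive_on {0<..} u (weak_deriv {0<..} f)"
    "AE x in lebesgue. x \<in> {0<..} \<longrightarrow> f x = u x"
    "u \<in> L2 {0<..}" "weak_deriv {0<..} f \<in> L2 {0<..}"
    "\<forall>x>0. \<bar>u x\<bar> \<le> L2_norm {0<..} f + L2_norm {0<..} (weak_deriv {0<..} f)"
proof -
  obtain g where g: "g \<in> L2 {0<..}" "has_weak_deriv {0<..} f g" and f: "f \<in> L2 {0<..}"
    using assms sobolev_1_iff by auto
  note wd = weak_deriv_eq_AE[OF g(2)]
  have wdL: "weak_deriv {0<..} f \<in> L2 {0<..}"
    by (rule L2_cong_AE(1)[OF pos_in_sets_lebesgue g(1)]) (use wd(2) in \<open>auto elim: eventually_mono\<close>)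
  obtain u where u: "primitive_on {0<..} u (weak_deriv {0<..} f)" "AE x in lebesgue. 0 < x \<longrightarrow> f x = u x"
    using weak_deriv_imp_primitive[OF wd(1)] by blast
  have fu: "AE x in lebesgue. x \<in> {0<..} \<longrightarrow> f x = u x" using u(2) by simp
  note uL = L2_cong_AE[OF pos_in_sets_lebesgue f fu]
  show thesis
    using sobolev_sup_bound[OF u(1) uL(1) wdL] uL(2) by (intro that[OF u(1) fu uL(1) wdL]) simp
qed

text \<open>Makes the norm of the unspecified \<open>weak_deriv\<close> computable from any integral
  representation of an a.e. representative.\<close>

lemma weak_deriv_of_AE_primitive:
  assumes u: "primitive_on {0<..} u g" and f: "AE x in lebesgue. x \<in> {0<..} \<longrightarrow> f x = u x" and g: "g \<in> L2 {0<..}"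
  shows "has_weak_deriv {0<..} f g" "L2_norm {0<..} (weak_deriv {0<..} f) = L2_norm {0<..} g"
proof -
  show *: "has_weak_deriv {0<..} f g"
    by (rule has_weak_deriv_cong_AE[OF has_weak_deriv_primitive[OF u]]) (use f in \<open>auto elim: eventually_mono\<close>)
  show "L2_norm {0<..} (weak_deriv {0<..} f) = L2_norm {0<..} g"
    by (rule L2_cong_AE(2)[OF pos_in_sets_lebesgue g]) (use weak_deriv_eq_AE(2)[OF *] in \<open>auto elim: eventually_mono\<close>)
qed

text \<open>Being monotone in the radius, it yields the monotone \<open>C\<close> that
  \<open>Lip_property\<close> asks for. For negative R the interval is empty, hence the premises
  \<open>0 \<le> R\<close> below.\<close>

definition sup_abs :: "(real \<Rightarrow> real) \<Rightarrow> real \<Rightarrow> real" where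
  "sup_abs G R = (SUP y\<in>{-R..R}. \<bar>G y\<bar>)"

context
  fixes G :: "real \<Rightarrow> real"
  assumes G: "continuous_on UNIV G"
begin

lemma bdd_sup_abs: "bdd_above ((\<lambda>y. \<bar>G y\<bar>) ` {-R..R})"
proof -
  have "continuous_on {-R..R} (\<lambda>y. \<bar>G y\<bar>)" using G continuous_on_subset by (intro continuous_intros) blast
  then have "compact ((\<lambda>y. \<bar>G y\<bar>) ` {-R..R})" by (intro compact_continuous_image) auto
  then show ?thesis by (intro bounded_imp_bdd_above compact_imp_bounded)
qed

lemma sup_abs_upper: "\<bar>y\<bar> \<le> R \<Longrightarrow> \<bar>G y\<bar> \<le> sup_abs G R"
  unfolding sup_abs_def by (rule cSUP_upper[OF _ bdd_sup_abs]) auto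

lemma sup_abs_nonneg: "0 \<le> R \<Longrightarrow> 0 \<le> sup_abs G R"
  using sup_abs_upper[of 0 R] by simp

lemma sup_abs_mono: "0 \<le> R \<Longrightarrow> R \<le> R' \<Longrightarrow> sup_abs G R \<le> sup_abs G R'"
  unfolding sup_abs_def by (rule cSUP_subset_mono[OF _ bdd_sup_abs]) auto

end

section \<open>Lipschitz estimates for the composition operator\<close>

lemma lipschitz_sup_abs_deriv:
  assumes F: "\<And>y. (F has_real_derivative F' y) (at y)" "continuous_on UNIV F'"
    and "\<bar>y\<bar> \<le> R" "\<bar>z\<bar> \<le> R"
  shows "\<bar>F y - F z\<bar> \<le> sup_abs F' R * \<bar>y - z\<bar>"
proof -
  have "norm (F y - F z) \<le> sup_abs F' R * norm (y - z)"
  proof (rule field_differentiable_bound[of "{-R..R}" F F'])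
    show "(F has_field_derivative F' x) (at x within {-R..R})" for x
      using F(1) has_field_derivative_at_within by blast
    show "norm (F' x) \<le> sup_abs F' R" if "x \<in> {-R..R}" for x
      using sup_abs_upper[OF F(2), of x R] that by auto
  qed (use assms in auto)
  then show ?thesis by simp
qed

lemma C_1_derivative:
  assumes "C_k (Suc k) F"
  shows "(F has_real_derivative deriv F y) (at y)" "C_k k (deriv F)"
  using assms has_deriv_of_differentiable_on_UNIV by (auto simp: C_k_Suc)

lemma measurable_compose_continuous:
  fixes G f :: "real \<Rightarrow> real"
  assumes "continuous_on UNIV G" "f \<in> borel_measurable M"
  shows "(\<lambda>x. G (f x)) \<in> borel_measurable M"
  using measurable_compose[OF assms(2) borel_measurable_continuous_onI[OF assms(1)]] .

lemma L2_measurable: "f \<in> L2 {0<..} \<Longrightarrow> f \<in> borel_measurable (lebesgue_on {0<..})"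
  using L2_iff[OF pos_in_sets_lebesgue] by blast

lemma compose_L2_Lipschitz:
  assumes F: "\<And>y. (F has_real_derivative F' y) (at y)" "continuous_on UNIV F'"
    and f: "f \<in> L2 {0<..}" "AE x in lebesgue. x \<in> {0<..} \<longrightarrow> \<bar>f x\<bar> \<le> R"
    and g: "g \<in> L2 {0<..}" "AE x in lebesgue. x \<in> {0<..} \<longrightarrow> \<bar>g x\<bar> \<le> R" and "0 \<le> R"
  shows "(\<lambda>x. F (f x) - F (g x)) \<in> L2 {0<..}"
    and "L2_norm {0<..} (\<lambda>x. F (f x) - F (g x)) \<le> sup_abs F' R * L2_norm {0<..} (\<lambda>x. f x - g x)"
proof -
  have "continuous_on UNIV F"
    using F(1) by (auto intro!: continuous_at_imp_continuous_on DERIV_isCont)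
  then have m: "(\<lambda>x. F (f x) - F (g x)) \<in> borel_measurable (lebesgue_on {0<..})"
    using f(1) g(1) by (intro borel_measurable_diff measurable_compose_continuous[of F] L2_measurable)
  have le: "AE x in lebesgue. x \<in> {0<..} \<longrightarrow> \<bar>F (f x) - F (g x)\<bar> \<le> sup_abs F' R * \<bar>f x - g x\<bar>"
    using f(2) g(2) by eventually_elim (intro impI lipschitz_sup_abs_deriv[OF F]; simp)
  note * = L2_bound[OF pos_in_sets_lebesgue m L2_diff[OF pos_in_sets_lebesgue f(1) g(1)] le sup_abs_nonneg[OF F(2) \<open>0 \<le> R\<close>]]
  show "(\<lambda>x. F (f x) - F (g x)) \<in> L2 {0<..}" by (rule *(1))
  show "L2_norm {0<..} (\<lambda>x. F (f x) - F (g x)) \<le> sup_abs F' R * L2_norm {0<..} (\<lambda>x. f x - g x)" by (rule *(2))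
qed

text \<open>The Lipschitz estimate is applied against the zero function. F 0 = 0 matters here, as
  the half-line has infinite measure.\<close>

lemma compose_in_L2:
  assumes F: "\<And>y. (F has_real_derivative F' y) (at y)" "continuous_on UNIV F'" "F 0 = 0"
    and f: "f \<in> L2 {0<..}" "AE x in lebesgue. x \<in> {0<..} \<longrightarrow> \<bar>f x\<bar> \<le> R" and "0 \<le> R"
  shows "(\<lambda>x. F (f x)) \<in> L2 {0<..}"
proof -
  have "(\<lambda>_. 0) \<in> L2 {0<..}" by (simp add: L2_iff[OF pos_in_sets_lebesgue])
  then show ?thesis
    using compose_L2_Lipschitz(1)[OF F(1,2) f, of "\<lambda>_. 0"] \<open>0 \<le> R\<close> F(3) by simp
qed

lemma sobolev_AE_bound:
  assumes "f \<in> sobolev 1 {0<..}" "L2_norm {0<..} f + L2_norm {0<..} (weak_deriv {0<..} f) \<le> R"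
  shows "AE x in lebesgue. x \<in> {0<..} \<longrightarrow> \<bar>f x\<bar> \<le> R"
proof -
  obtain u where u: "AE x in lebesgue. x \<in> {0<..} \<longrightarrow> f x = u x"
    "\<forall>x>0. \<bar>u x\<bar> \<le> L2_norm {0<..} f + L2_norm {0<..} (weak_deriv {0<..} f)"
    using sobolev_representative[OF assms(1)] by blast
  show ?thesis using u(1)
  proof eventually_elim
    fix x assume "x \<in> {0<..} \<longrightarrow> f x = u x"
    then show "x \<in> {0<..} \<longrightarrow> \<bar>f x\<bar> \<le> R" using u(2) assms(2) by (auto intro: order_trans)
  qed
qed

lemma Lip_property_C1:
  assumes "C_k 1 F" "F 0 = 0"
  shows "Lip_property (sobolev 1 {0<..}) (sobolev_norm 1 {0<..}) (L2 {0<..}) (L2_norm {0<..}) F"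
proof -
  have F: "\<And>y. (F has_real_derivative deriv F y) (at y)" "continuous_on UNIV (deriv F)"
    using C_1_derivative[of 0 F] assms(1) by (auto simp: C_k_0)
  \<comment> \<open>The sum of the four norms bounds both |f| and |g| a.e., so the supremum of |F'|
    up to this radius is a Lipschitz constant on the relevant range. The summand 1 makes
    \<open>C\<close> strictly positive.\<close>
  define C :: "real \<Rightarrow> real \<Rightarrow> real \<Rightarrow> real \<Rightarrow> real" where
    "C a b c d = 1 + sup_abs (deriv F) (a + b + c + d)" for a b c d
  show ?thesis
    unfolding Lip_property_def
  proof (intro conjI ballI exI[of _ C] allI impI)
    fix f assume f: "f \<in> sobolev 1 {0<..}"
    define R where "R = L2_norm {0<..} f + L2_norm {0<..} (weak_deriv {0<..} f)"
    have "f \<in> L2 {0<..}" using f sobolev_1_iff by blast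
    then show "F \<circ> f \<in> L2 {0<..}"
      using compose_in_L2[OF F assms(2) _ sobolev_AE_bound[OF f, of R]] L2_norm_nonneg by (simp add: R_def o_def)
  next
    fix a b c d :: real assume "0 \<le> a" "0 \<le> b" "0 \<le> c" "0 \<le> d"
    then show "0 < C a b c d" using sup_abs_nonneg[OF F(2), of "a + b + c + d"] by (simp add: C_def)
  next
    fix a b c d a' b' c' d' :: real
    assume "0 \<le> a \<and> a \<le> a' \<and> 0 \<le> b \<and> b \<le> b' \<and> 0 \<le> c \<and> c \<le> c' \<and> 0 \<le> d \<and> d \<le> d'"
    then show "C a b c d \<le> C a' b' c' d'"
      unfolding C_def by (intro add_left_mono sup_abs_mono[OF F(2)]) auto
  next
    fix f g assume f: "f \<in> sobolev 1 {0<..}" and g: "g \<in> sobolev 1 {0<..}"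
    define a b c d where abcd: "a = L2_norm {0<..} f" "b = L2_norm {0<..} g"
      "c = L2_norm {0<..} (weak_deriv {0<..} f)" "d = L2_norm {0<..} (weak_deriv {0<..} g)"
    have nn: "0 \<le> a" "0 \<le> b" "0 \<le> c" "0 \<le> d" by (simp_all add: abcd L2_norm_nonneg)
    let ?R = "a + b + c + d" and ?n = "sobolev_norm 1 {0<..} (\<lambda>x. f x - g x)"
    have fL: "f \<in> L2 {0<..}" and gL: "g \<in> L2 {0<..}" using f g sobolev_1_iff by blast+
    have "L2_norm {0<..} (\<lambda>x. (F \<circ> f) x - (F \<circ> g) x) \<le> sup_abs (deriv F) ?R * L2_norm {0<..} (\<lambda>x. f x - g x)"
      unfolding o_def
      by (rule compose_L2_Lipschitz(2)[OF F fL sobolev_AE_bound[OF f] gL sobolev_AE_bound[OF g]])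
         (use nn in \<open>simp_all add: abcd\<close>)
    also have "\<dots> \<le> sup_abs (deriv F) ?R * ?n"
      using sup_abs_nonneg[OF F(2)] nn by (intro mult_left_mono sobolev_norm_1_bounds) auto
    also have "\<dots> \<le> C a b c d * ?n"
      using order_trans[OF L2_norm_nonneg sobolev_norm_1_bounds(1)] by (intro mult_right_mono) (auto simp: C_def)
    finally show "L2_norm {0<..} (\<lambda>x. (F \<circ> f) x - (F \<circ> g) x)
      \<le> C (L2_norm {0<..} f) (L2_norm {0<..} g) (L2_norm {0<..} (weak_deriv {0<..} f)) (L2_norm {0<..} (weak_deriv {0<..} g)) * ?n"
      by (simp add: abcd)
  qed
qed

lemma compose_primitive_pos:
  assumes "primitive_on {0<..} u g" "\<And>y. (F has_real_derivative F' y) (at y)" "continuous_on UNIV F'"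
  shows "primitive_on {0<..} (\<lambda>x. F (u x)) (\<lambda>x. F' (u x) * g x)"
  using assms by (intro primitive_on_posI primitive_on_compose primitive_on_subset[OF assms(1)]) auto

text \<open>The derivative of F(u) - F(v) splits as F'(u) (f' - g') + (F'(u) - F'(v)) g'. The first
  term is controlled by sup |F'|, the second by sup |F''| times the supremum of |u - v| times the
  L^2 norm of g'. The estimate comes out with the H^1 norm of f - g, which the H^2 norm
  dominates.\<close>

lemma Lip_property_C2:
  assumes "C_k 2 F" "F 0 = 0"
  shows "Lip_property (sobolev 2 {0<..}) (sobolev_norm 2 {0<..}) (sobolev 1 {0<..}) (sobolev_norm 1 {0<..}) F"
proof -
  let ?P = "{0::real<..}"
  have "C_k (Suc (Suc 0)) F" using assms(1) by (simp add: numeral_2_eq_2)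
  note C2 = C_1_derivative[OF this] and C2' = C_1_derivative[OF C_1_derivative(2)[OF this]]
  have F: "\<And>y. (F has_real_derivative deriv F y) (at y)" and F': "\<And>y. (deriv F has_real_derivative deriv (deriv F) y) (at y)"
    and cF'': "continuous_on UNIV (deriv (deriv F))"
    by (rule C2(1), rule C2'(1), rule C2'(2)[unfolded C_k_0])
  have cF': "continuous_on UNIV (deriv F)"
    using F' by (auto intro!: continuous_at_imp_continuous_on DERIV_isCont)
  note P = pos_in_sets_lebesgue
  \<comment> \<open>The term 2 sup |F'| collects the difference of the compositions and the first
    part of the derivative. In the last term the 2 comes from the supremum bound on u - v, and d is
    the L^2 norm of g'.\<close>
  define C :: "real \<Rightarrow> real \<Rightarrow> real \<Rightarrow> real \<Rightarrow> real" where
    "C a b c d = 1 + 2 * sup_abs (deriv F) (a + b + c + d) + 2 * (sup_abs (deriv (deriv F)) (a + b + c + d) * d)" for a b c d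
  have fact1: "(\<lambda>x. deriv F (u x) * h x) \<in> L2 ?P \<and>
      L2_norm ?P (\<lambda>x. deriv F (u x) * h x) \<le> sup_abs (deriv F) R * L2_norm ?P h"
    if u: "u \<in> L2 ?P" "\<forall>x>0. \<bar>u x\<bar> \<le> R" and h: "h \<in> L2 ?P" and R: "0 \<le> R" for u h R
  proof -
    have m: "(\<lambda>x. deriv F (u x) * h x) \<in> borel_measurable (lebesgue_on ?P)"
      using u h by (intro borel_measurable_times measurable_compose_continuous[OF cF'] L2_measurable)
    have "AE x in lebesgue. x \<in> ?P \<longrightarrow> \<bar>deriv F (u x) * h x\<bar> \<le> sup_abs (deriv F) R * \<bar>h x\<bar>"
      using u(2) by (auto simp: abs_mult intro!: mult_right_mono sup_abs_upper[OF cF'])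
    from L2_bound[OF P m h this sup_abs_nonneg[OF cF' R]] show ?thesis by (rule conjI)
  qed
  show ?thesis
    unfolding Lip_property_def
  proof (intro conjI ballI exI[of _ C] allI impI)
    fix f assume "f \<in> sobolev 2 ?P"
    then have f: "f \<in> sobolev 1 ?P" by (rule sobolev_2_imp_1)
    define R where "R = L2_norm ?P f + L2_norm ?P (weak_deriv ?P f)"
    have "0 \<le> R" by (simp add: R_def L2_norm_nonneg)
    obtain u where u: "primitive_on ?P u (weak_deriv ?P f)" "AE x in lebesgue. x \<in> ?P \<longrightarrow> f x = u x"
      "u \<in> L2 ?P" "weak_deriv ?P f \<in> L2 ?P" "\<forall>x>0. \<bar>u x\<bar> \<le> R"
      unfolding R_def by (rule sobolev_representative[OF f])
    have fL: "f \<in> L2 ?P" using f sobolev_1_iff by blast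
    have 1: "(\<lambda>x. F (f x)) \<in> L2 ?P"
      by (rule compose_in_L2[OF F cF' assms(2) fL sobolev_AE_bound[OF f] \<open>0 \<le> R\<close>]) (simp add: R_def)
    note 2 = fact1[OF u(3,5,4) \<open>0 \<le> R\<close>]
    have "AE x in lebesgue. x \<in> ?P \<longrightarrow> F (f x) = F (u x)" using u(2) by eventually_elim auto
    then have "has_weak_deriv ?P (\<lambda>x. F (f x)) (\<lambda>x. deriv F (u x) * weak_deriv ?P f x)"
      by (rule weak_deriv_of_AE_primitive(1)[OF compose_primitive_pos[OF u(1) F cF'] _ conjunct1[OF 2]])
    then show "F \<circ> f \<in> sobolev 1 ?P" using 1 2 by (auto simp: sobolev_1_iff o_def)
  next
    fix a b c d :: real assume "0 \<le> a" "0 \<le> b" "0 \<le> c" "0 \<le> d"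
    then show "0 < C a b c d"
      unfolding C_def by (intro add_pos_nonneg mult_nonneg_nonneg sup_abs_nonneg[OF cF'] sup_abs_nonneg[OF cF''] add_nonneg_nonneg) auto
  next
    fix a b c d a' b' c' d' :: real
    assume *: "0 \<le> a \<and> a \<le> a' \<and> 0 \<le> b \<and> b \<le> b' \<and> 0 \<le> c \<and> c \<le> c' \<and> 0 \<le> d \<and> d \<le> d'"
    have "sup_abs (deriv F) (a + b + c + d) \<le> sup_abs (deriv F) (a' + b' + c' + d')"
      using * by (intro sup_abs_mono[OF cF']) auto
    moreover have "sup_abs (deriv (deriv F)) (a + b + c + d) * d \<le> sup_abs (deriv (deriv F)) (a' + b' + c' + d') * d'"
    proof (rule mult_mono)
      show "sup_abs (deriv (deriv F)) (a + b + c + d) \<le> sup_abs (deriv (deriv F)) (a' + b' + c' + d')"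
        using * by (intro sup_abs_mono[OF cF'']) auto
      show "0 \<le> sup_abs (deriv (deriv F)) (a' + b' + c' + d')"
        using * by (intro sup_abs_nonneg[OF cF'']) auto
    qed (use * in auto)
    ultimately show "C a b c d \<le> C a' b' c' d'" unfolding C_def by linarith
  next
    fix f g assume fg2: "f \<in> sobolev 2 ?P" "g \<in> sobolev 2 ?P"
    have f: "f \<in> sobolev 1 ?P" and g: "g \<in> sobolev 1 ?P" by (rule sobolev_2_imp_1[OF fg2(1)], rule sobolev_2_imp_1[OF fg2(2)])
    let ?f' = "weak_deriv ?P f" and ?g' = "weak_deriv ?P g"
    define a b c d where abcd: "a = L2_norm ?P f" "b = L2_norm ?P g" "c = L2_norm ?P ?f'" "d = L2_norm ?P ?g'"
    have nn: "0 \<le> a" "0 \<le> b" "0 \<le> c" "0 \<le> d" by (simp_all add: abcd L2_norm_nonneg)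
    define R where "R = a + b + c + d"
    have R0: "0 \<le> R" using nn by (simp add: R_def)
    define n where "n = sobolev_norm 1 ?P (\<lambda>x. f x - g x)"
    obtain u where u: "primitive_on ?P u ?f'" "AE x in lebesgue. x \<in> ?P \<longrightarrow> f x = u x"
      "u \<in> L2 ?P" "?f' \<in> L2 ?P" "\<forall>x>0. \<bar>u x\<bar> \<le> a + c"
      unfolding abcd by (rule sobolev_representative[OF f])
    obtain v where v: "primitive_on ?P v ?g'" "AE x in lebesgue. x \<in> ?P \<longrightarrow> g x = v x"
      "v \<in> L2 ?P" "?g' \<in> L2 ?P" "\<forall>x>0. \<bar>v x\<bar> \<le> b + d"
      unfolding abcd by (rule sobolev_representative[OF g])
    have R_le: "a + c \<le> R" "b + d \<le> R" using nn by (auto simp: R_def)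
    have uR: "\<forall>x>0. \<bar>u x\<bar> \<le> R" and vR: "\<forall>x>0. \<bar>v x\<bar> \<le> R"
      using u(5) v(5) R_le order_trans by blast+
    have fL: "f \<in> L2 ?P" and gL: "g \<in> L2 ?P" using f g sobolev_1_iff by blast+
    note uv = primitive_on_diff[OF u(1) v(1)]
    note d'L = L2_diff[OF P u(4) v(4)] and dL = L2_diff[OF P fL gL]
    have duv: "AE x in lebesgue. x \<in> ?P \<longrightarrow> f x - g x = u x - v x"
      using u(2) v(2) by eventually_elim auto
    have n1: "L2_norm ?P (\<lambda>x. f x - g x) \<le> n" unfolding n_def by (rule sobolev_norm_1_bounds)
    have n2: "L2_norm ?P (\<lambda>x. ?f' x - ?g' x) \<le> n"
      using sobolev_norm_1_bounds(2)[of ?P "\<lambda>x. f x - g x"] weak_deriv_of_AE_primitive(2)[OF uv duv d'L] by (simp add: n_def)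
    have "0 \<le> n" using n1 L2_norm_nonneg order_trans by blast
    \<comment> \<open>The supremum bound is a sum of two L^2 norms, each at most n.\<close>
    have uvn: "\<bar>u x - v x\<bar> \<le> 2 * n" if "0 < x" for x
      using sobolev_sup_bound[OF uv L2_diff[OF P u(3) v(3)] d'L that] L2_cong_AE(2)[OF P dL duv] n1 n2 by simp
    define M1 M2 where M: "M1 = sup_abs (deriv F) R" "M2 = sup_abs (deriv (deriv F)) R"
    have M0: "0 \<le> M1" "0 \<le> M2" unfolding M using sup_abs_nonneg[OF cF' R0] sup_abs_nonneg[OF cF'' R0] by auto
    let ?A = "\<lambda>x. deriv F (u x) * (?f' x - ?g' x)" and ?B = "\<lambda>x. (deriv F (u x) - deriv F (v x)) * ?g' x"
    let ?w = "\<lambda>x. (F \<circ> f) x - (F \<circ> g) x"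
    have A: "?A \<in> L2 ?P" "L2_norm ?P ?A \<le> M1 * n"
      using fact1[OF u(3) uR d'L R0] mult_left_mono[OF n2 M0(1)] unfolding M by (blast, linarith)
    have Bm: "?B \<in> borel_measurable (lebesgue_on ?P)"
      using u(3) v(3,4) by (intro borel_measurable_times borel_measurable_diff measurable_compose_continuous[OF cF'] L2_measurable)
    have "\<bar>?B x\<bar> \<le> (M2 * (2 * n)) * \<bar>?g' x\<bar>" if "0 < x" for x
    proof -
      have "\<bar>deriv F (u x) - deriv F (v x)\<bar> \<le> M2 * \<bar>u x - v x\<bar>"
        unfolding M using uR vR that by (intro lipschitz_sup_abs_deriv[OF F' cF'']) auto
      also have "\<dots> \<le> M2 * (2 * n)" by (rule mult_left_mono[OF uvn[OF that] M0(2)])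
      finally show ?thesis unfolding abs_mult by (rule mult_right_mono) simp
    qed
    then have Ble: "AE x in lebesgue. x \<in> ?P \<longrightarrow> \<bar>?B x\<bar> \<le> (M2 * (2 * n)) * \<bar>?g' x\<bar>" by simp
    have B: "?B \<in> L2 ?P" "L2_norm ?P ?B \<le> M2 * (2 * n) * d"
      unfolding abcd using M0(2) \<open>0 \<le> n\<close> by (auto intro!: L2_bound[OF P Bm v(4) Ble])
    have W: "primitive_on ?P (\<lambda>x. F (u x) - F (v x)) (\<lambda>x. ?A x + ?B x)"
      using primitive_on_diff[OF compose_primitive_pos[OF u(1) F cF'] compose_primitive_pos[OF v(1) F cF']]
      by (simp add: algebra_simps)
    have "AE x in lebesgue. x \<in> ?P \<longrightarrow> ?w x = F (u x) - F (v x)"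
      using u(2) v(2) by eventually_elim auto
    from weak_deriv_of_AE_primitive(2)[OF W this L2_norm_triangle(1)[OF P A(1) B(1)]]
    have "L2_norm ?P (weak_deriv ?P ?w) \<le> M1 * n + M2 * (2 * n) * d"
      using L2_norm_triangle(2)[OF P A(1) B(1)] A(2) B(2) by linarith
    moreover have "L2_norm ?P ?w \<le> M1 * L2_norm ?P (\<lambda>x. f x - g x)"
      unfolding o_def M
      by (rule compose_L2_Lipschitz(2)[OF F cF' fL sobolev_AE_bound[OF f] gL sobolev_AE_bound[OF g] R0])
         (use nn in \<open>simp_all add: abcd R_def\<close>)
    ultimately have "sobolev_norm 1 ?P ?w \<le> M1 * n + (M1 * n + M2 * (2 * n) * d)"
      using sobolev_norm_1_bounds(3)[of ?P ?w] mult_left_mono[OF n1 M0(1)] by linarith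
    also have "\<dots> = (2 * M1 + 2 * (M2 * d)) * n" by (simp add: algebra_simps)
    also have "\<dots> \<le> C a b c d * n"
      using \<open>0 \<le> n\<close> by (intro mult_right_mono) (auto simp: C_def M R_def)
    also have "\<dots> \<le> C a b c d * sobolev_norm 2 ?P (\<lambda>x. f x - g x)"
    proof (rule mult_left_mono)
      show "n \<le> sobolev_norm 2 ?P (\<lambda>x. f x - g x)" unfolding n_def by (rule sobolev_norm_1_le_2)
      show "0 \<le> C a b c d" using M0 nn by (simp add: C_def M R_def)
    qed
    finally show "sobolev_norm 1 ?P ?w \<le> C (L2_norm ?P f) (L2_norm ?P g) (L2_norm ?P ?f') (L2_norm ?P ?g')
        * sobolev_norm 2 ?P (\<lambda>x. f x - g x)" by (simp add: abcd)
  qed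
qed

section \<open>Lipschitz functions\<close>

text \<open>Push Lebesgue measure forward along the inverse of $G$. The result gives $[x,y]$ the mass $G(y)-G(x)$, and it
is absolutely continuous because $G$ maps null sets to null sets.\<close>

lemma bilipschitz_mono_primitive:
  fixes G :: "real \<Rightarrow> real"
  assumes lo: "\<And>x y. x \<le> y \<Longrightarrow> c * (y - x) \<le> G y - G x" and hi: "\<And>x y. x \<le> y \<Longrightarrow> G y - G x \<le> K * (y - x)"
    and "0 < c"
  shows "\<exists>k\<in>borel_measurable borel. (\<forall>x. 0 \<le> k x) \<and> primitive_on UNIV G k"
proof -
  have mono: "G x \<le> G y \<longleftrightarrow> x \<le> y" for x y
  proof
    assume "G x \<le> G y"
    show "x \<le> y"
    proof (rule ccontr)
      assume "\<not> x \<le> y"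
      then have "0 < c * (x - y)" using \<open>0 < c\<close> by simp
      then show False using lo[of y x] \<open>\<not> x \<le> y\<close> \<open>G x \<le> G y\<close> by simp
    qed
  next
    assume "x \<le> y"
    then have "0 \<le> c * (y - x)" using \<open>0 < c\<close> by simp
    then show "G x \<le> G y" using lo[OF \<open>x \<le> y\<close>] by simp
  qed
  have lipG: "\<bar>G x - G y\<bar> \<le> K * \<bar>x - y\<bar>" for x y
  proof (cases "x \<le> y")
    case True
    then show ?thesis using hi[OF True] mono[of x y] by simp
  next
    case False
    then show ?thesis using hi[of y x] mono[of y x] by simp
  qed
  have K0: "0 \<le> K" using lipG[of 0 1] by simp
  have contG: "continuous_on UNIV G"
    unfolding continuous_on_iff
  proof (intro ballI allI impI)
    fix x e :: real assume "0 < e"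
    have "dist (G x') (G x) < e" if "dist x' x < e / (K + 1)" for x'
    proof -
      have "\<bar>G x' - G x\<bar> \<le> K * \<bar>x' - x\<bar>" by (rule lipG)
      also have "\<dots> \<le> (K + 1) * \<bar>x' - x\<bar>" by (rule mult_right_mono) auto
      also have "\<dots> < e" using that K0 by (simp add: dist_real_def pos_less_divide_eq mult.commute)
      finally show ?thesis by (simp add: dist_real_def)
    qed
    then show "\<exists>d>0. \<forall>x'\<in>UNIV. dist x' x < d \<longrightarrow> dist (G x') (G x) < e"
      using \<open>0 < e\<close> K0 by (intro exI[of _ "e / (K + 1)"]) auto
  qed
  have surjG: "\<exists>x. G x = y" for y
  proof -
    \<comment> \<open>Slopes of at least c move G by at least c r = |y - G 0| on either side of 0,
      so y lies between G(-r) and G(r).\<close>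
    define r where "r = \<bar>y - G 0\<bar> / c"
    have r: "0 \<le> r" "c * r = \<bar>y - G 0\<bar>" using \<open>0 < c\<close> by (auto simp: r_def)
    have "G (- r) \<le> y" "y \<le> G r" using lo[of "- r" 0] lo[of 0 r] r by auto
    then have "\<exists>x\<ge>- r. x \<le> r \<and> G x = y"
      using r(1) contG by (intro IVT') (auto intro: continuous_on_subset)
    then show ?thesis by blast
  qed
  have injG: "inj G" using mono by (metis injI order_antisym order_refl)
  define H where "H = inv G"
  have GH: "G (H y) = y" for y unfolding H_def using surjG by (metis f_inv_into_f rangeI)
  have HG: "H (G x) = x" for x unfolding H_def using injG by simp
  \<comment> \<open>Preimages under H are images under G, so the \<mu>-measure of a Borel null set
    is the Lebesgue measure of its Lipschitz image.\<close>
  have vim: "H -` A = G ` A" for A using GH HG by (auto simp: image_iff) metis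
  have monoH: "mono H" unfolding mono_def using mono GH by metis
  have mH: "H \<in> borel_measurable borel" by (rule borel_measurable_mono[OF monoH])
  define \<mu> where "\<mu> = distr lborel borel H"
  have em: "emeasure \<mu> {x..y} = ennreal (G y - G x)" if "x \<le> y" for x y
  proof -
    have "H -` {x..y} = {G x..G y}"
    proof -
      have "x \<le> H t \<longleftrightarrow> G x \<le> t" "H t \<le> y \<longleftrightarrow> t \<le> G y" for t
        using mono[of x "H t"] mono[of "H t" y] GH[of t] by auto
      then show ?thesis by auto
    qed
    then show ?thesis using mH that mono[of x y] by (simp add: \<mu>_def emeasure_distr)
  qed
  have "absolutely_continuous lborel \<mu>"
    unfolding absolutely_continuous_def
  proof
    fix A :: "real set" assume A: "A \<in> null_sets lborel"
    then have "A \<in> null_sets lebesgue" by (simp add: null_sets_completion_iff null_sets_def)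
    then have "negligible A" by (simp add: negligible_iff_null_sets)
    then have "negligible (G ` A)"
    proof (rule negligible_locally_Lipschitz_image[rotated])
      fix x
      show "\<exists>T B. open T \<and> x \<in> T \<and> (\<forall>y\<in>A \<inter> T. norm (G y - G x) \<le> B * norm (y - x))"
        using lipG by (intro exI[of _ UNIV] exI[of _ K]) auto
    qed simp
    then have "emeasure lebesgue (H -` A) = 0"
      unfolding vim by (simp add: negligible_iff_null_sets null_sets_def)
    moreover have HA: "H -` A \<in> sets borel" using mH A by (auto simp: null_sets_def intro: measurable_sets_borel)
    ultimately have "emeasure lborel (H -` A) = 0" by simp
    then show "A \<in> null_sets \<mu>"
      using A mH by (auto simp: null_sets_def \<mu>_def emeasure_distr)
  qed
  then obtain f where f: "f \<in> borel_measurable lborel" "density lborel f = \<mu>"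
    using sigma_finite_measure.Radon_Nikodym[OF sigma_finite_lborel, of \<mu>] by (auto simp: \<mu>_def)
  have nn: "(\<integral>\<^sup>+t. f t * indicator {x..y} t \<partial>lborel) = ennreal (G y - G x)" if "x \<le> y" for x y
    using em[OF that] emeasure_density[OF f(1), of "{x..y}"] unfolding f(2) by simp
  have fin: "AE t in lborel. f t \<noteq> \<infinity>"
  proof -
    have "AE t in lborel. \<forall>n::nat. f t * indicator {- real n..real n} t \<noteq> \<infinity>"
      unfolding AE_all_countable using f(1) nn by (intro allI nn_integral_PInf_AE) auto
    then show ?thesis
    proof eventually_elim
      fix t assume *: "\<forall>n::nat. f t * indicator {- real n..real n} t \<noteq> \<infinity>"
      obtain n :: nat where "\<bar>t\<bar> \<le> real n" using real_arch_simple by blast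
      then have "t \<in> {- real n..real n}" by auto
      then show "f t \<noteq> \<infinity>" using spec[OF *, of n] by simp
    qed
  qed
  \<comment> \<open>\<open>enn2real\<close> changes f only where f is infinite, which is a null set
    because \<mu> is finite on bounded intervals.\<close>
  define k where "k t = enn2real (f t)" for t
  have mk: "k \<in> borel_measurable borel" unfolding k_def[abs_def] using f(1) by simp
  have k0: "0 \<le> k t" for t by (simp add: k_def)
  have hi_k: "(k has_integral (G y - G x)) {x..y}" if "x \<le> y" for x y
  proof -
    have "(\<integral>\<^sup>+t. ennreal (indicator {x..y} t * k t) \<partial>lborel) = (\<integral>\<^sup>+t. f t * indicator {x..y} t \<partial>lborel)"
      by (rule nn_integral_cong_AE) (use fin in eventually_elim, auto simp: k_def indicator_def less_top)
    then have "((\<lambda>t. indicator {x..y} t * k t) has_integral (G y - G x)) UNIV"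
      using nn[OF that] mono[of x y] that k0 mk by (intro nn_integral_has_integral) auto
    then have "((\<lambda>t. if t \<in> {x..y} then k t else 0) has_integral (G y - G x)) UNIV"
      by (rule has_integral_eq[rotated]) (auto simp: indicator_def)
    then show ?thesis by (simp only: has_integral_restrict_UNIV)
  qed
  have "primitive_on UNIV G k"
    unfolding primitive_on_def
  proof (intro ballI impI conjI)
    fix x y :: real assume "x \<le> y"
    show "k absolutely_integrable_on {x..y}"
      using hi_k[OF \<open>x \<le> y\<close>] k0 by (intro nonnegative_absolutely_integrable_1) auto
    show "integral {x..y} k = G y - G x" using hi_k[OF \<open>x \<le> y\<close>] by (rule integral_unique)
  qed
  then show ?thesis using mk k0 by blast
qed

lemma primitive_on_linear: "primitive_on I (\<lambda>x. r * x) (\<lambda>_. r)"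
  by (rule primitive_on_C1) (auto intro!: derivative_eq_intros)

text \<open>Adding the slope 2 L to F and to -F produces functions with slopes between L and 3 L, to
  which \<open>bilipschitz_mono_primitive\<close> applies.\<close>

lemma Lipschitz_primitive_UNIV:
  fixes F :: "real \<Rightarrow> real"
  assumes lip: "\<And>x y. \<bar>F x - F y\<bar> \<le> L * \<bar>x - y\<bar>" and "0 < L"
  shows "\<exists>k\<in>borel_measurable borel. primitive_on UNIV F k \<and> (AE x in lebesgue. \<bar>k x\<bar> \<le> 2 * L)"
proof -
  \<comment> \<open>The two densities add up to $4L$, and both are nonnegative, hence both are bounded.\<close>
  define G1 where "G1 x = 2 * L * x - (- F x)" for x
  define G2 where "G2 x = 2 * L * x - F x" for x
  have d: "F y - F x \<le> L * (y - x)" "F x - F y \<le> L * (y - x)" if "x \<le> y" for x y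
    using lip[of y x] that by (auto simp: abs_le_iff)
  have "\<exists>k\<in>borel_measurable borel. (\<forall>x. 0 \<le> k x) \<and> primitive_on UNIV G1 k"
  proof (rule bilipschitz_mono_primitive[of L _ "3 * L"])
    fix x y :: real assume "x \<le> y"
    then show "L * (y - x) \<le> G1 y - G1 x" "G1 y - G1 x \<le> 3 * L * (y - x)"
      using d[of x y] by (simp_all add: G1_def algebra_simps)
  qed (rule \<open>0 < L\<close>)
  then obtain k1 where k1: "k1 \<in> borel_measurable borel" "\<And>x. 0 \<le> k1 x" "primitive_on UNIV G1 k1" by auto
  have "\<exists>k\<in>borel_measurable borel. (\<forall>x. 0 \<le> k x) \<and> primitive_on UNIV G2 k"
  proof (rule bilipschitz_mono_primitive[of L _ "3 * L"])
    fix x y :: real assume "x \<le> y"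
    then show "L * (y - x) \<le> G2 y - G2 x" "G2 y - G2 x \<le> 3 * L * (y - x)"
      using d[of x y] by (simp_all add: G2_def algebra_simps)
  qed (rule \<open>0 < L\<close>)
  then obtain k2 where k2: "k2 \<in> borel_measurable borel" "\<And>x. 0 \<le> k2 x" "primitive_on UNIV G2 k2" by auto
  define k where "k x = k1 x - 2 * L" for x
  have F: "primitive_on UNIV F k"
    using primitive_on_diff[OF k1(3) primitive_on_linear[of _ "2 * L"]] by (simp add: k_def[abs_def] G1_def)
  have Fk2: "primitive_on UNIV F (\<lambda>x. 2 * L - k2 x)"
    using primitive_on_diff[OF primitive_on_linear[of _ "2 * L"] k2(3)] by (simp add: G2_def)
  \<comment> \<open>\<open>G1\<close> and \<open>G2\<close> give two densities of F. Their
    difference is a density of 0, so they agree a.e.; one is at least -2 L, the other at most 2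
    L.\<close>
  have zero: "primitive_on UNIV (\<lambda>x. 0) (\<lambda>x. k x - (2 * L - k2 x))"
    using primitive_on_diff[OF F Fk2] by simp
  have "AE x in lebesgue. \<forall>n::nat. x \<in> {- real n..real n} \<longrightarrow> k x - (2 * L - k2 x) = 0"
    unfolding AE_all_countable
    by (intro allI AE_zero_of_zero_integrals) (use primitive_onD[OF zero] in auto)
  then have "AE x in lebesgue. \<bar>k x\<bar> \<le> 2 * L"
  proof eventually_elim
    fix x assume *: "\<forall>n::nat. x \<in> {- real n..real n} \<longrightarrow> k x - (2 * L - k2 x) = 0"
    obtain n :: nat where "\<bar>x\<bar> \<le> real n" using real_arch_simple by blast
    then have "k x = 2 * L - k2 x" using spec[OF *, of n] by auto
    then show "\<bar>k x\<bar> \<le> 2 * L" using k1(2)[of x] k2(2)[of x] by (simp add: k_def abs_le_iff)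
  qed
  moreover have "k \<in> borel_measurable borel" unfolding k_def[abs_def] using k1(1) by simp
  ultimately show ?thesis using F by blast
qed

text \<open>Composing with the nearest-point projection \<open>cl\<close> onto [a, b], which is
  1-Lipschitz, extends F to a Lipschitz function on the line.\<close>

lemma Lipschitz_primitive:
  fixes F :: "real \<Rightarrow> real"
  assumes lip: "\<And>x y. x \<in> {a..b} \<Longrightarrow> y \<in> {a..b} \<Longrightarrow> \<bar>F x - F y\<bar> \<le> L * \<bar>x - y\<bar>" and "0 < L" "a \<le> b"
  shows "\<exists>k\<in>borel_measurable borel. primitive_on {a..b} F k \<and> (AE x in lebesgue. \<bar>k x\<bar> \<le> 2 * L)"
proof -
  define cl where "cl x = max a (min b x)" for x
  have cl: "cl x \<in> {a..b}" "\<bar>cl x - cl y\<bar> \<le> \<bar>x - y\<bar>" for x y using \<open>a \<le> b\<close> by (auto simp: cl_def)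
  have "\<bar>F (cl x) - F (cl y)\<bar> \<le> L * \<bar>x - y\<bar>" for x y
    using lip[OF cl(1) cl(1), of x y] mult_left_mono[OF cl(2)[of x y], of L] \<open>0 < L\<close> by linarith
  from Lipschitz_primitive_UNIV[OF this \<open>0 < L\<close>] obtain k where k: "k \<in> borel_measurable borel"
    "primitive_on UNIV (\<lambda>x. F (cl x)) k" "AE x in lebesgue. \<bar>k x\<bar> \<le> 2 * L" by blast
  have "primitive_on {a..b} F k"
    using primitive_on_subset[OF k(2) subset_UNIV, of "{a..b}"] by (auto simp: primitive_on_def cl_def)
  then show ?thesis using k by blast
qed

section \<open>Weak derivatives on subsets of compact intervals\<close>

lemma has_weak_deriv_subset:
  assumes fg: "has_weak_deriv {0<..} f g" and U: "U \<subseteq> {0<..}" and eq: "\<And>x. x \<in> U \<Longrightarrow> f' x = f x"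
  shows "has_weak_deriv U f' g"
  unfolding has_weak_deriv_def
proof (intro conjI allI impI)
  show "locally_integrable U f'"
    unfolding locally_integrable_def
  proof (intro allI impI)
    fix K assume K: "compact K \<and> K \<subseteq> U"
    then have "set_integrable lebesgue K f" using fg U unfolding has_weak_deriv_def locally_integrable_def by blast
    moreover have "set_integrable lebesgue K f \<longleftrightarrow> set_integrable lebesgue K f'"
      by (rule set_integrable_cong) (use K eq in auto)
    ultimately show "set_integrable lebesgue K f'" by simp
  qed
  show "locally_integrable U g"
    using fg U unfolding has_weak_deriv_def locally_integrable_def by blast
  fix \<phi> assume test: "test_function U \<phi>"
  then obtain K where K: "compact K" "K \<subseteq> U" "\<And>x. x \<notin> K \<Longrightarrow> \<phi> x = 0" unfolding test_function_def by blast
  have out: "deriv \<phi> x = 0" "\<phi> x = 0" if "x \<notin> U" for x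
  proof -
    have "x \<notin> K" using K(2) that by blast
    show "deriv \<phi> x = 0" by (rule deriv_zero_outside[OF compact_imp_closed[OF K(1)] K(3) \<open>x \<notin> K\<close>])
    show "\<phi> x = 0" by (rule K(3)[OF \<open>x \<notin> K\<close>])
  qed
  have "(LINT x:U|lebesgue. f' x * deriv \<phi> x) = (LINT x:{0<..}|lebesgue. f x * deriv \<phi> x)"
    unfolding set_lebesgue_integral_def
    by (rule Bochner_Integration.integral_cong) (use U out eq in \<open>auto simp: indicator_def\<close>)
  moreover have "(LINT x:U|lebesgue. g x * \<phi> x) = (LINT x:{0<..}|lebesgue. g x * \<phi> x)"
    unfolding set_lebesgue_integral_def
    by (rule Bochner_Integration.integral_cong) (use U out in \<open>auto simp: indicator_def\<close>)
  ultimately show "(LINT x:U|lebesgue. f' x * deriv \<phi> x) = - (LINT x:U|lebesgue. g x * \<phi> x)"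
    using fg test_function_mono[OF test U] unfolding has_weak_deriv_def by simp
qed

text \<open>The density is extended by zero to the half-line. A primitive of the extension, adjusted
  to the value F a at a, has it as weak derivative there and coincides with F on U, so the statement
  follows by restriction.\<close>

lemma has_weak_deriv_on_interval:
  assumes F: "primitive_on {a..b} F k" and "0 < a" "a \<le> b" and U: "U \<subseteq> {a..b}"
  shows "has_weak_deriv U F k"
proof -
  define k' where "k' x = (if x \<in> {a..b} then k x else 0)" for x
  have ka: "k absolutely_integrable_on {a..b}" using primitive_onD(1)[OF F, of a b] \<open>a \<le> b\<close> by auto
  have "k' absolutely_integrable_on T" if "T \<in> sets lebesgue" for T
  proof -
    have "k' absolutely_integrable_on UNIV"
      using ka unfolding set_integrable_def k'_def
      by (rule Bochner_Integration.integrable_cong[THEN iffD1, rotated -1]) (auto simp: indicator_def)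
    then show ?thesis by (rule set_integrable_subset) (use that in auto)
  qed
  then have "locally_integrable {0<..} k'" by (simp add: locally_integrable_pos_iff)
  then obtain u where u: "primitive_on {0<..} u k'" using primitive_exists by blast
  define u' where "u' x = u x - (u a - F a)" for x
  have "primitive_on {0<..} u' k'" using u by (simp add: primitive_on_def u'_def)
  then have w: "has_weak_deriv {0<..} u' k'" by (rule has_weak_deriv_primitive)
  have eq: "F x = u' x" if "x \<in> U" for x
  proof -
    have x: "a \<le> x" "x \<le> b" using that U by auto
    have "integral {a..x} k' = integral {a..x} k" by (rule integral_cong) (use x in \<open>auto simp: k'_def\<close>)
    moreover have "integral {a..x} k' = u x - u a" using primitive_onD(3)[OF u, of a x] x \<open>0 < a\<close> by auto
    moreover have "integral {a..x} k = F x - F a" using primitive_onD(3)[OF F, of a x] x by auto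
    ultimately show ?thesis by (simp add: u'_def)
  qed
  have "U \<subseteq> {0<..}" using U \<open>0 < a\<close> by (auto simp: subset_eq)
  from has_weak_deriv_subset[OF w this eq] have "has_weak_deriv U F k'" .
  moreover have "locally_integrable U k"
    unfolding locally_integrable_def
  proof (intro allI impI)
    fix K assume K: "compact K \<and> K \<subseteq> U"
    then have "K \<in> sets lebesgue" using lmeasurable_compact fmeasurableD by blast
    then show "set_integrable lebesgue K k" by (rule set_integrable_subset[OF ka]) (use K U in auto)
  qed
  moreover have "(LINT x:U|lebesgue. k' x * \<phi> x) = (LINT x:U|lebesgue. k x * \<phi> x)" for \<phi>
    unfolding set_lebesgue_integral_def
    by (rule Bochner_Integration.integral_cong) (use U in \<open>auto simp: indicator_def k'_def\<close>)
  ultimately show ?thesis unfolding has_weak_deriv_def by simp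
qed

lemma L2_AE_bounded:
  assumes "f \<in> borel_measurable (lebesgue_on {a..b})" "AE x in lebesgue. \<bar>f x\<bar> \<le> M"
    and "U \<in> sets lebesgue" "U \<subseteq> {a..b}" "0 \<le> M"
  shows "f \<in> L2 U"
proof -
  have 1: "(\<lambda>_. 1) \<in> L2 {a..b}" by (rule L2_bounded_interval[of _ _ _ 1]) auto
  have "f \<in> L2 {a..b}"
    by (rule L2_bound(1)[OF _ assms(1) 1 _ assms(5)]) (use assms(2) in \<open>auto elim: eventually_mono\<close>)
  then show ?thesis using L2_subset(1)[OF _ assms(3,4)] by simp
qed

lemma L2_continuous:
  fixes f :: "real \<Rightarrow> real"
  assumes "continuous_on {a..b} f" "U \<in> sets lebesgue" "U \<subseteq> {a..b}"
  shows "f \<in> L2 U"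
proof -
  have "compact (f ` {a..b})" using assms(1) by (intro compact_continuous_image) auto
  then obtain M where M: "\<forall>y\<in>f ` {a..b}. norm y \<le> M" using compact_imp_bounded bounded_iff by metis
  have "f \<in> borel_measurable (lebesgue_on {a..b})"
    by (rule continuous_imp_measurable_on_sets_lebesgue[OF assms(1)]) simp
  then have "f \<in> L2 {a..b}" by (rule L2_bounded_interval) (use M in auto)
  then show ?thesis using L2_subset(1)[OF _ assms(2,3)] by simp
qed

lemma Lipschitz_sobolev_1:
  fixes F :: "real \<Rightarrow> real"
  assumes lip: "\<And>x y. x \<in> {a..b} \<Longrightarrow> y \<in> {a..b} \<Longrightarrow> \<bar>F x - F y\<bar> \<le> L * \<bar>x - y\<bar>" and "0 < L" "0 < a" "a \<le> b"
    and U: "U \<in> sets lebesgue" "U \<subseteq> {a..b}"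
  shows "F \<in> sobolev 1 U"
proof -
  obtain k where k: "k \<in> borel_measurable borel" "primitive_on {a..b} F k" "AE x in lebesgue. \<bar>k x\<bar> \<le> 2 * L"
    using Lipschitz_primitive[OF lip \<open>0 < L\<close> \<open>a \<le> b\<close>] by blast
  have "k \<in> borel_measurable (lebesgue_on {a..b})"
    using k(1) by (intro measurable_restrict_space1) (simp add: measurable_completion)
  then have "k \<in> L2 U" using k(3) U \<open>0 < L\<close> by (intro L2_AE_bounded) auto
  moreover have "F \<in> L2 U" by (rule L2_continuous[OF continuous_on_primitive[OF k(2)] U])
  moreover have "has_weak_deriv U F k"
    by (rule has_weak_deriv_on_interval[OF k(2) \<open>0 < a\<close> \<open>a \<le> b\<close> U(2)])
  ultimately show ?thesis by (auto simp: sobolev_1_iff)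
qed

section \<open>Necessity\<close>

lemma L2_norm_scale: "L2_norm S (\<lambda>x. c * f x) = \<bar>c\<bar> * L2_norm S f"
proof -
  have "(LINT x:S|lebesgue. (c * f x)\<^sup>2) = c\<^sup>2 * (LINT x:S|lebesgue. (f x)\<^sup>2)"
    by (simp add: power_mult_distrib)
  then show ?thesis by (simp add: L2_norm_def real_sqrt_mult)
qed

text \<open>The length of the support stays explicit, since the rescaled bumps live on intervals
  that shrink with d.\<close>

lemma L2_norm_interval_support:
  assumes "continuous_on UNIV f" "\<And>x. x \<notin> {a..b} \<Longrightarrow> f x = 0" "\<And>x. \<bar>f x\<bar> \<le> M" "0 < a" "a \<le> b"
  shows "f \<in> L2 {0<..}" and "L2_norm {0<..} f \<le> M * sqrt (b - a)"
proof -
  have M0: "0 \<le> M" using assms(3)[of 0] by linarith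
  have sq: "(LINT x|lebesgue_on {0<..}. (indicator {a..b} x :: real)\<^sup>2) = b - a"
    and i: "integrable (lebesgue_on {0<..}) (\<lambda>x. (indicator {a..b} x :: real)\<^sup>2)"
  proof -
    have eq: "indicator {0<..} x * (indicator {a..b} x :: real)\<^sup>2 = indicator {a..b} x" for x
      using \<open>0 < a\<close> by (auto simp: indicator_def)
    show "(LINT x|lebesgue_on {0<..}. (indicator {a..b} x :: real)\<^sup>2) = b - a"
      using \<open>a \<le> b\<close> by (simp add: integral_restrict_space eq)
    show "integrable (lebesgue_on {0<..}) (\<lambda>x. (indicator {a..b} x :: real)\<^sup>2)"
      by (simp add: integrable_restrict_space eq integrable_real_indicator emeasure_lborel_Icc_eq)
  qed
  have 1: "indicator {a..b} \<in> L2 {0<..}"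
    unfolding L2_iff[OF pos_in_sets_lebesgue]
    using i by (intro conjI measurable_restrict_space1 borel_measurable_indicator) auto
  have m: "f \<in> borel_measurable (lebesgue_on {0<..})"
    by (rule continuous_imp_measurable_on_sets_lebesgue) (use assms(1) continuous_on_subset in auto)
  have le: "AE x in lebesgue. x \<in> {0<..} \<longrightarrow> \<bar>f x\<bar> \<le> M * \<bar>indicator {a..b} x\<bar>"
    using assms(2,3) by (auto simp: indicator_def)
  show "f \<in> L2 {0<..}" by (rule L2_bound(1)[OF _ m 1 le M0]) simp
  show "L2_norm {0<..} f \<le> M * sqrt (b - a)"
    using L2_bound(2)[OF _ m 1 le M0] sq by (simp add: L2_norm_eq)
qed

lemma smooth_bounded:
  assumes "smooth f" "\<And>x. x \<notin> {a..b} \<Longrightarrow> f x = 0"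
  obtains M where "0 \<le> M" "\<And>x. \<bar>f x\<bar> \<le> M"
proof -
  have "compact (f ` {a..b})" using smooth_continuous[OF assms(1)] by (intro compact_continuous_image) auto
  then obtain M where M: "\<forall>y\<in>f ` {a..b}. norm y \<le> M" using compact_imp_bounded bounded_iff by metis
  show thesis
  proof (rule that[of "max M 0"])
    fix x show "\<bar>f x\<bar> \<le> max M 0" using M assms(2)[of x] by (cases "x \<in> {a..b}") (auto simp: le_max_iff_disj)
  qed simp
qed

section \<open>Sobolev norms of test functions\<close>

lemma test_function_L2:
  assumes "test_function {0<..} \<phi>"
  shows "\<phi> \<in> L2 {0<..}"
proof -
  obtain a b where ab: "0 < a" "a < b" "\<And>x. x \<notin> {a..b} \<Longrightarrow> \<phi> x = 0"
    using test_function_pos_support[OF assms] by metis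
  obtain M where M: "\<And>x. \<bar>\<phi> x\<bar> \<le> M" using smooth_bounded[OF smooth_test[OF assms] ab(3)] by metis
  show ?thesis
    using L2_norm_interval_support(1)[OF smooth_continuous[OF smooth_test[OF assms]] ab(3) M ab(1)] ab(2) by simp
qed

lemma test_function_weak_deriv:
  assumes "test_function {0<..} \<phi>"
  shows "primitive_on {0<..} \<phi> (deriv \<phi>)" "has_weak_deriv {0<..} \<phi> (deriv \<phi>)"
    "L2_norm {0<..} (weak_deriv {0<..} \<phi>) = L2_norm {0<..} (deriv \<phi>)"
proof -
  note s = smooth_test[OF assms]
  show *: "primitive_on {0<..} \<phi> (deriv \<phi>)"
    by (rule primitive_on_C1[OF smooth_has_deriv[OF s] smooth_continuous[OF smooth_deriv[OF s]]])
  show "has_weak_deriv {0<..} \<phi> (deriv \<phi>)" by (rule has_weak_deriv_primitive[OF *])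
  show "L2_norm {0<..} (weak_deriv {0<..} \<phi>) = L2_norm {0<..} (deriv \<phi>)"
    by (rule weak_deriv_of_AE_primitive(2)[OF * _ test_function_L2[OF test_function_deriv[OF assms]]]) simp
qed

lemma test_function_sobolev: "test_function {0<..} \<phi> \<Longrightarrow> \<phi> \<in> sobolev k {0<..}"
proof (induction k arbitrary: \<phi>)
  case (Suc k)
  have "deriv \<phi> \<in> sobolev k {0<..}" by (rule Suc.IH[OF test_function_deriv[OF Suc.prems]])
  then show ?case
    using test_function_L2[OF Suc.prems] test_function_weak_deriv(2)[OF Suc.prems] by auto
qed (simp add: test_function_L2)

text \<open>The second weak derivative is taken of the chosen first one, which equals
  \<open>deriv \<phi>\<close> only a.e.; it is therefore evaluated through an a.e.
  representative.\<close>

lemma sobolev_norm_2_test: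
  assumes "test_function {0<..} \<phi>"
  shows "sobolev_norm 2 {0<..} \<phi> \<le> L2_norm {0<..} \<phi> + L2_norm {0<..} (deriv \<phi>) + L2_norm {0<..} (deriv (deriv \<phi>))"
proof -
  let ?wd = "weak_deriv {0<..}"
  note t' = test_function_deriv[OF assms]
  have "AE x in lebesgue. x \<in> {0<..} \<longrightarrow> ?wd \<phi> x = deriv \<phi> x"
    using weak_deriv_eq_AE(2)[OF test_function_weak_deriv(2)[OF assms]] by simp
  from weak_deriv_of_AE_primitive(2)[OF test_function_weak_deriv(1)[OF t'] this test_function_L2[OF test_function_deriv[OF t']]]
  have 2: "L2_norm {0<..} (?wd (?wd \<phi>)) = L2_norm {0<..} (deriv (deriv \<phi>))" .
  have "sobolev_norm 2 {0<..} \<phi> = sqrt (((L2_norm {0<..} \<phi>)\<^sup>2 + (L2_norm {0<..} (deriv \<phi>))\<^sup>2) + (L2_norm {0<..} (deriv (deriv \<phi>)))\<^sup>2)"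
    unfolding sobolev_norm_def using 2 test_function_weak_deriv(3)[OF assms] by (simp add: numeral_2_eq_2)
  also have "\<dots> \<le> sqrt ((L2_norm {0<..} \<phi>)\<^sup>2 + (L2_norm {0<..} (deriv \<phi>))\<^sup>2) + sqrt ((L2_norm {0<..} (deriv (deriv \<phi>)))\<^sup>2)"
    by (rule sqrt_add_le_add_sqrt) auto
  also have "\<dots> \<le> (L2_norm {0<..} \<phi> + L2_norm {0<..} (deriv \<phi>)) + L2_norm {0<..} (deriv (deriv \<phi>))"
    by (intro add_mono sqrt_sum_squares_le_sum L2_norm_nonneg) (simp add: L2_norm_nonneg)
  finally show ?thesis by simp
qed

lemma test_function_scale:
  assumes "test_function {0<..} \<phi>"
  shows "test_function {0<..} (\<lambda>x. c * \<phi> x)" "deriv (\<lambda>x. c * \<phi> x) = (\<lambda>x. c * deriv \<phi> x)"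
proof -
  show "test_function {0<..} (\<lambda>x. c * \<phi> x)"
    using test_function_linear_combination[OF assms assms, of c 0] by simp
  show "deriv (\<lambda>x. c * \<phi> x) = (\<lambda>x. c * deriv \<phi> x)"
    by (intro ext DERIV_imp_deriv DERIV_cmult smooth_has_deriv[OF smooth_test[OF assms]])
qed

lemma sobolev_norm_2_scale:
  assumes "test_function {0<..} \<phi>"
  shows "sobolev_norm 2 {0<..} (\<lambda>x. c * \<phi> x)
    \<le> \<bar>c\<bar> * (L2_norm {0<..} \<phi> + L2_norm {0<..} (deriv \<phi>) + L2_norm {0<..} (deriv (deriv \<phi>)))"
proof -
  note 1 = test_function_scale[OF assms, of c] and 2 = test_function_scale[OF test_function_deriv[OF assms], of c]
  show ?thesis
    using sobolev_norm_2_test[OF 1(1)] unfolding 1(2) 2(2) by (simp add: L2_norm_scale algebra_simps)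
qed

lemma Lip_propertyE:
  assumes "Lip_property B N B' N' F"
  obtains C :: "real \<Rightarrow> real \<Rightarrow> real \<Rightarrow> real \<Rightarrow> real" where
    "\<forall>f\<in>B. F \<circ> f \<in> B'"
    "\<forall>a\<ge>0. \<forall>b\<ge>0. \<forall>c\<ge>0. \<forall>d\<ge>0. C a b c d > 0"
    "\<forall>a b c d a' b' c' d'. 0 \<le> a \<and> a \<le> a' \<and> 0 \<le> b \<and> b \<le> b' \<and> 0 \<le> c \<and> c \<le> c' \<and> 0 \<le> d \<and> d \<le> d'
       \<longrightarrow> C a b c d \<le> C a' b' c' d'"
    "\<forall>f\<in>B. \<forall>g\<in>B. N' (\<lambda>x. (F \<circ> f) x - (F \<circ> g) x)
       \<le> C (L2_norm {0<..} f) (L2_norm {0<..} g) (L2_norm {0<..} (weak_deriv {0<..} f)) (L2_norm {0<..} (weak_deriv {0<..} g))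
         * N (\<lambda>x. f x - g x)"
  using assms unfolding Lip_property_def by (elim conjE exE)

lemma Lip_H1_L2_imp_Lipschitz:
  assumes "Lip_property (sobolev 1 {0<..}) (sobolev_norm 1 {0<..}) (L2 {0<..}) (L2_norm {0<..}) F"
  shows "\<exists>L>0. \<forall>y z. \<bar>y\<bar> \<le> M \<longrightarrow> \<bar>z\<bar> \<le> M \<longrightarrow> \<bar>F y - F z\<bar> \<le> L * \<bar>y - z\<bar>"
proof -
  let ?P = "{0::real<..}"
  obtain C where C: "\<forall>f\<in>sobolev 1 ?P. F \<circ> f \<in> L2 ?P"
    "\<forall>a\<ge>0. \<forall>b\<ge>0. \<forall>c\<ge>0. \<forall>d\<ge>0. (C a b c d :: real) > 0"
    "\<forall>a b c d a' b' c' d'. 0 \<le> a \<and> a \<le> a' \<and> 0 \<le> b \<and> b \<le> b' \<and> 0 \<le> c \<and> c \<le> c' \<and> 0 \<le> d \<and> d \<le> d'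
       \<longrightarrow> C a b c d \<le> C a' b' c' d'"
    "\<forall>f\<in>sobolev 1 ?P. \<forall>g\<in>sobolev 1 ?P. L2_norm ?P (\<lambda>x. (F \<circ> f) x - (F \<circ> g) x)
       \<le> C (L2_norm ?P f) (L2_norm ?P g) (L2_norm ?P (weak_deriv ?P f)) (L2_norm ?P (weak_deriv ?P g))
         * sobolev_norm 1 ?P (\<lambda>x. f x - g x)"
    by (rule Lip_propertyE[OF assms])
  note FL = C(1)[rule_format] and Cpos = C(2)[rule_format] and Cmono = C(3)[rule_format] and Lip = C(4)[rule_format]
  obtain \<eta> where eta: "test_function ?P \<eta>" "\<And>x. x \<in> {2..3} \<Longrightarrow> \<eta> x = 1" using plateau_function by metis
  define N where "N = L2_norm ?P \<eta> + L2_norm ?P (deriv \<eta>) + L2_norm ?P (deriv (deriv \<eta>))"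
  have N0: "0 \<le> N" by (simp add: N_def L2_norm_nonneg)
  \<comment> \<open>Bounds on the norms of c \<eta> and of its derivative, uniform in |c| \<le> M.
    As \<open>C\<close> is monotone, \<open>C A A B B\<close> then serves for all pairs y,
    z.\<close>
  define A B where "A = \<bar>M\<bar> * L2_norm ?P \<eta>" and "B = \<bar>M\<bar> * L2_norm ?P (deriv \<eta>)"
  define L where "L = C A A B B * N + 1"
  have AB: "0 \<le> A" "0 \<le> B" by (simp_all add: A_def B_def L2_norm_nonneg)
  have C0: "0 < C A A B B" using Cpos AB by blast
  have "\<bar>F y - F z\<bar> \<le> L * \<bar>y - z\<bar>" if yz: "\<bar>y\<bar> \<le> M" "\<bar>z\<bar> \<le> M" for y z
  proof -
    define f g where "f = (\<lambda>x. y * \<eta> x)" and "g = (\<lambda>x. z * \<eta> x)"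
    have tf: "test_function ?P f" and tg: "test_function ?P g"
      unfolding f_def g_def by (rule test_function_scale[OF eta(1)])+
    have fS: "f \<in> sobolev 1 ?P" and gS: "g \<in> sobolev 1 ?P" using tf tg test_function_sobolev by blast+
    have nf: "L2_norm ?P f = \<bar>y\<bar> * L2_norm ?P \<eta>" "L2_norm ?P (weak_deriv ?P f) = \<bar>y\<bar> * L2_norm ?P (deriv \<eta>)"
      unfolding test_function_weak_deriv(3)[OF tf] unfolding f_def test_function_scale(2)[OF eta(1)] by (rule L2_norm_scale)+
    have ng: "L2_norm ?P g = \<bar>z\<bar> * L2_norm ?P \<eta>" "L2_norm ?P (weak_deriv ?P g) = \<bar>z\<bar> * L2_norm ?P (deriv \<eta>)"
      unfolding test_function_weak_deriv(3)[OF tg] unfolding g_def test_function_scale(2)[OF eta(1)] by (rule L2_norm_scale)+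
    let ?w = "\<lambda>x. (F \<circ> f) x - (F \<circ> g) x"
    have wL: "?w \<in> L2 ?P" by (rule L2_diff[OF _ FL[OF fS] FL[OF gS]]) simp
    \<comment> \<open>The plateau [2, 3] has length one, so the L^2 norm of a constant on it is its
      absolute value.\<close>
    have "\<bar>F y - F z\<bar> = L2_norm {2..3} (\<lambda>_. F y - F z)"
      by (simp add: L2_norm_eq measure_restrict_space)
    also have "\<dots> = L2_norm {2..3} ?w"
      unfolding L2_norm_def set_lebesgue_integral_def
      by (intro arg_cong[where f = sqrt] Bochner_Integration.integral_cong) (auto simp: indicator_def f_def g_def eta(2))
    also have "\<dots> \<le> L2_norm ?P ?w" by (rule L2_subset(2)[OF _ _ _ wL]) auto
    also have "\<dots> \<le> C (L2_norm ?P f) (L2_norm ?P g) (L2_norm ?P (weak_deriv ?P f)) (L2_norm ?P (weak_deriv ?P g))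
         * sobolev_norm 1 ?P (\<lambda>x. f x - g x)" by (rule Lip[OF fS gS])
    also have "\<dots> \<le> C A A B B * (\<bar>y - z\<bar> * N)"
    proof (rule mult_mono)
      show "C (L2_norm ?P f) (L2_norm ?P g) (L2_norm ?P (weak_deriv ?P f)) (L2_norm ?P (weak_deriv ?P g)) \<le> C A A B B"
        unfolding nf ng A_def B_def using yz
        by (intro Cmono conjI mult_nonneg_nonneg mult_right_mono L2_norm_nonneg) auto
      have "sobolev_norm 2 ?P (\<lambda>x. (y - z) * \<eta> x) \<le> \<bar>y - z\<bar> * N"
        unfolding N_def by (rule sobolev_norm_2_scale[OF eta(1)])
      then show "sobolev_norm 1 ?P (\<lambda>x. f x - g x) \<le> \<bar>y - z\<bar> * N"
        using sobolev_norm_1_le_2[of ?P "\<lambda>x. f x - g x"] by (simp add: f_def g_def left_diff_distrib)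
      show "0 \<le> C A A B B" using C0 by simp
      show "0 \<le> sobolev_norm 1 ?P (\<lambda>x. f x - g x)" unfolding sobolev_norm_1 by simp
    qed
    also have "\<dots> \<le> L * \<bar>y - z\<bar>" by (simp add: L_def algebra_simps)
    finally show ?thesis .
  qed
  moreover have "0 < L" using C0 N0 by (simp add: L_def add_nonneg_pos)
  ultimately show ?thesis by blast
qed

section \<open>Hoelder continuity and the second difference estimate\<close>

lemma sobolev_1_diff:
  assumes "f \<in> sobolev 1 {0<..}" "g \<in> sobolev 1 {0<..}"
  shows "(\<lambda>x. f x - g x) \<in> sobolev 1 {0<..}"
proof -
  obtain u where u: "primitive_on {0<..} u (weak_deriv {0<..} f)"
    "AE x in lebesgue. x \<in> {0<..} \<longrightarrow> f x = u x" "weak_deriv {0<..} f \<in> L2 {0<..}"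
    using sobolev_representative[OF assms(1)] by blast
  obtain v where v: "primitive_on {0<..} v (weak_deriv {0<..} g)"
    "AE x in lebesgue. x \<in> {0<..} \<longrightarrow> g x = v x" "weak_deriv {0<..} g \<in> L2 {0<..}"
    using sobolev_representative[OF assms(2)] by blast
  note D = L2_diff[OF pos_in_sets_lebesgue u(3) v(3)]
  have "AE x in lebesgue. x \<in> {0<..} \<longrightarrow> f x - g x = u x - v x"
    using u(2) v(2) by eventually_elim auto
  from weak_deriv_of_AE_primitive(1)[OF primitive_on_diff[OF u(1) v(1)] this D]
  have "has_weak_deriv {0<..} (\<lambda>x. f x - g x) (\<lambda>x. weak_deriv {0<..} f x - weak_deriv {0<..} g x)" .
  moreover have "(\<lambda>x. f x - g x) \<in> L2 {0<..}"
    using assms by (intro L2_diff[OF pos_in_sets_lebesgue]) (auto simp: sobolev_1_iff)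
  ultimately show ?thesis using D by (auto simp: sobolev_1_iff)
qed

text \<open>The set where w and u differ is open and negligible, hence empty.\<close>

lemma continuous_AE_eq:
  fixes u w :: "real \<Rightarrow> real"
  assumes "continuous_on {0<..} w" "continuous_on {0<..} u" "AE x in lebesgue. x \<in> {0<..} \<longrightarrow> w x = u x" "0 < x"
  shows "w x = u x"
proof (rule ccontr)
  assume neq: "w x \<noteq> u x"
  let ?S = "{x \<in> {0<..}. w x - u x \<noteq> 0}"
  have "open ?S"
  proof -
    have "open ({0<..} \<inter> (\<lambda>x. w x - u x) -` (- {0}))"
      by (rule continuous_open_preimage[OF continuous_on_diff[OF assms(1,2)]]) auto
    also have "{0<..} \<inter> (\<lambda>x. w x - u x) -` (- {0}) = ?S" by blast
    finally show ?thesis .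
  qed
  moreover have "negligible ?S"
  proof -
    obtain Z where Z: "negligible Z" "\<And>x. x \<notin> Z \<Longrightarrow> (x \<in> {0<..} \<longrightarrow> w x = u x)"
      using AE_lebesgue_negligible[OF assms(3)] by blast
    show ?thesis by (rule negligible_subset[OF Z(1)]) (use Z(2) in auto)
  qed
  ultimately show False using open_not_negligible[of ?S] neq assms(4) by auto
qed

lemma continuous_on_primitive_pos:
  assumes "primitive_on {0<..} u g"
  shows "continuous_on {0<..} u"
proof (rule continuous_at_imp_continuous_on, rule ballI)
  fix x :: real assume "x \<in> {0<..}"
  then have "primitive_on {x/2..x+1} u g" by (intro primitive_on_subset[OF assms]) auto
  from continuous_on_primitive[OF this] show "isCont u x"
    using \<open>x \<in> {0<..}\<close> by (intro continuous_on_interior[of "{x/2..x+1}"]) auto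
qed

text \<open>Continuity of w is what allows evaluation at given points: it forces w to equal its
  absolutely continuous representative everywhere on the half-line.\<close>

lemma sobolev_1_Hoelder:
  assumes w: "w \<in> sobolev 1 {0<..}" "continuous_on {0<..} w" and ab: "0 < a" "a \<le> b"
  shows "\<bar>w b - w a\<bar> \<le> sobolev_norm 1 {0<..} w * sqrt (b - a)"
proof -
  obtain u where u: "primitive_on {0<..} u (weak_deriv {0<..} w)"
    "AE x in lebesgue. x \<in> {0<..} \<longrightarrow> w x = u x" "weak_deriv {0<..} w \<in> L2 {0<..}"
    using sobolev_representative[OF w(1)] by blast
  have eq: "w x = u x" if "0 < x" for x
    by (rule continuous_AE_eq[OF w(2) continuous_on_primitive_pos[OF u(1)] u(2) that])
  have "w b - w a = integral {a..b} (weak_deriv {0<..} w)"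
    using primitive_onD(3)[OF u(1), of a b] ab eq[of a] eq[of b] by simp
  also have "\<bar>\<dots>\<bar> \<le> L2_norm {0<..} (weak_deriv {0<..} w) * sqrt (b - a)"
    by (rule L2_integral_interval_le[OF u(3) ab])
  also have "\<dots> \<le> sobolev_norm 1 {0<..} w * sqrt (b - a)"
    using ab by (intro mult_right_mono sobolev_norm_1_bounds) auto
  finally show ?thesis .
qed

text \<open>The second difference is the increment from x = 2 to x = 2 + d^2 of w = F \<circ> f (a +
  h) - F \<circ> f a. Both points lie on the plateau, and \<sigma> is 0 at the first and 1 at the
  second. Hoelder continuity gives the factor d, and the H^1 norm of w gives the factor h.\<close>

lemma Lip_H2_H1_imp_second_difference:
  assumes Lip: "Lip_property (sobolev 2 {0<..}) (sobolev_norm 2 {0<..}) (sobolev 1 {0<..}) (sobolev_norm 1 {0<..}) F"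
    and F: "continuous_on UNIV F"
  shows "\<exists>K\<ge>0. \<forall>a h d. \<bar>a\<bar> \<le> R \<longrightarrow> 0 < h \<longrightarrow> h \<le> 1 \<longrightarrow> 0 < d \<longrightarrow> d \<le> 1 \<longrightarrow>
    \<bar>F (a + d + h) - F (a + d) - F (a + h) + F a\<bar> \<le> K * h * d"
proof -
  let ?P = "{0::real<..}"
  obtain C where C: "\<forall>f\<in>sobolev 2 ?P. F \<circ> f \<in> sobolev 1 ?P"
    "\<forall>a\<ge>0. \<forall>b\<ge>0. \<forall>c\<ge>0. \<forall>d\<ge>0. (C a b c d :: real) > 0"
    "\<forall>a b c d a' b' c' d'. 0 \<le> a \<and> a \<le> a' \<and> 0 \<le> b \<and> b \<le> b' \<and> 0 \<le> c \<and> c \<le> c' \<and> 0 \<le> d \<and> d \<le> d'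
       \<longrightarrow> C a b c d \<le> C a' b' c' d'"
    "\<forall>f\<in>sobolev 2 ?P. \<forall>g\<in>sobolev 2 ?P. sobolev_norm 1 ?P (\<lambda>x. (F \<circ> f) x - (F \<circ> g) x)
       \<le> C (L2_norm ?P f) (L2_norm ?P g) (L2_norm ?P (weak_deriv ?P f)) (L2_norm ?P (weak_deriv ?P g))
         * sobolev_norm 2 ?P (\<lambda>x. f x - g x)"
    by (rule Lip_propertyE[OF Lip])
  note FS = C(1)[rule_format] and Cpos = C(2)[rule_format] and Cmono = C(3)[rule_format] and CLip = C(4)[rule_format]
  obtain \<eta> where eta: "test_function ?P \<eta>" "\<And>x. x \<in> {2..3} \<Longrightarrow> \<eta> x = 1" using plateau_function by metis
  define N where "N = L2_norm ?P \<eta> + L2_norm ?P (deriv \<eta>) + L2_norm ?P (deriv (deriv \<eta>))"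
  have N0: "0 \<le> N" by (simp add: N_def L2_norm_nonneg)
  define s where "s x = (1 / bump 0 2 1 1) * bump 0 2 1 x" for x
  have b1: "bump 0 2 1 1 \<noteq> 0" by (simp add: bump_eq)
  have s01: "s 0 = 0" "s 1 = 1" using b1 by (auto simp: s_def) (simp add: bump_eq)
  have "smooth (bump 0 2 1)" by (rule smooth_test[OF test_function_bump[OF _ subset_UNIV]]) simp
  then have ss: "smooth s" unfolding s_def[abs_def]
    using smooth_linear_combination[of "bump 0 2 1" "bump 0 2 1" "1 / bump 0 2 1 1" 0] by simp
  have sout: "s x = 0" if "x \<notin> {0..2}" for x using that by (auto simp: s_def bump_eq)
  have sout': "deriv s x = 0" if "x \<notin> {0..2}" for x
    using deriv_zero_outside[of "{0..2}" s x] sout that by auto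
  obtain S0 where S0: "0 \<le> S0" "\<And>x. \<bar>s x\<bar> \<le> S0" using smooth_bounded[OF ss sout] by metis
  obtain S1 where S1: "0 \<le> S1" "\<And>x. \<bar>deriv s x\<bar> \<le> S1" using smooth_bounded[OF smooth_deriv[OF ss] sout'] by metis
  \<comment> \<open>\<open>\<bar>R\<bar> + 1\<close> bounds both coefficients a and a + h of \<eta>,
    as h \<le> 1. The terms 2 S0 and 2 S1 bound the norms of d \<sigma> and d \<sigma>' for every d
    \<le> 1, so that \<open>C A A B B\<close> depends neither on h nor on d.\<close>
  define A B where "A = (\<bar>R\<bar> + 1) * L2_norm ?P \<eta> + 2 * S0" and "B = (\<bar>R\<bar> + 1) * L2_norm ?P (deriv \<eta>) + 2 * S1"
  have AB: "0 \<le> A" "0 \<le> B" using S0 S1 by (simp_all add: A_def B_def L2_norm_nonneg)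
  have C0: "0 < C A A B B" using Cpos AB by blast
  define K where "K = C A A B B * N"
  have K0: "0 \<le> K" using C0 N0 by (simp add: K_def)
  have "\<bar>F (a + d + h) - F (a + d) - F (a + h) + F a\<bar> \<le> K * h * d"
    if a: "\<bar>a\<bar> \<le> R" and h: "0 < h" "h \<le> 1" and d: "0 < d" "d \<le> 1" for a h d
  proof -
    have d2: "0 < d\<^sup>2" "d\<^sup>2 \<le> 1" using d by (auto simp: power_le_one)
    \<comment> \<open>The rescaled bump $\sigma$ satisfies $\|d\sigma\|_2 \le 2 d^2 S_0$ and $\|d\sigma'\|_2 \le 2 S_1$.\<close>
    define \<sigma> where "\<sigma> x = s ((1 / d\<^sup>2) * x + (- 2 / d\<^sup>2))" for x
    have arg: "(1 / d\<^sup>2) * x + (- 2 / d\<^sup>2) = (x - 2) / d\<^sup>2" for x by (simp add: diff_divide_distrib)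
    have sig_s: "smooth \<sigma>" unfolding \<sigma>_def[abs_def] by (rule smooth_affine[OF ss])
    have mem: "(1 / d\<^sup>2) * x + (- 2 / d\<^sup>2) \<notin> {0..2}" if "x \<notin> {2..2 + 2 * d\<^sup>2}" for x
      unfolding arg using that d2 by (auto simp: divide_le_eq zero_le_divide_iff)
    have sig_out: "\<sigma> x = 0" if "x \<notin> {2..2 + 2 * d\<^sup>2}" for x
      using sout[OF mem[OF that]] by (simp add: \<sigma>_def)
    have sig_test: "test_function ?P \<sigma>"
      by (rule test_functionI[OF sig_s _ sig_out]) auto
    have sig_deriv: "deriv \<sigma> x = (1 / d\<^sup>2) * deriv s ((1 / d\<^sup>2) * x + (- 2 / d\<^sup>2))" for x
    proof (rule DERIV_imp_deriv)
      have "((\<lambda>x. (1 / d\<^sup>2) * x + (- 2 / d\<^sup>2)) has_real_derivative 1 / d\<^sup>2) (at x)"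
        using DERIV_add[OF DERIV_cmult_Id[of "1 / d\<^sup>2"] DERIV_const[of "- 2 / d\<^sup>2"]] by simp
      from DERIV_chain2[OF smooth_has_deriv[OF ss] this]
      show "(\<sigma> has_real_derivative (1 / d\<^sup>2) * deriv s ((1 / d\<^sup>2) * x + (- 2 / d\<^sup>2))) (at x)"
        by (simp add: \<sigma>_def[abs_def] mult.commute)
    qed
    \<comment> \<open>2 d^2 is the length of the support of \<sigma>.\<close>
    have sq2: "sqrt (2 * d\<^sup>2) \<le> 2 * d"
      using d(1) by (intro real_le_lsqrt) (auto simp: power2_eq_square)
    have sig_n: "L2_norm ?P \<sigma> \<le> S0 * (2 * d)"
    proof -
      have "L2_norm ?P \<sigma> \<le> S0 * sqrt (2 + 2 * d\<^sup>2 - 2)"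
        by (rule L2_norm_interval_support(2)[OF smooth_continuous[OF sig_s] sig_out]) (use S0 d2 in \<open>auto simp: \<sigma>_def\<close>)
      also have "\<dots> \<le> S0 * (2 * d)" using sq2 S0(1) by (intro mult_left_mono) auto
      finally show ?thesis .
    qed
    have sig_n': "L2_norm ?P (deriv \<sigma>) \<le> 2 * S1 / d"
    proof -
      have "L2_norm ?P (deriv \<sigma>) \<le> (S1 / d\<^sup>2) * sqrt (2 + 2 * d\<^sup>2 - 2)"
      proof (rule L2_norm_interval_support(2)[OF smooth_continuous[OF smooth_deriv[OF sig_s]]])
        show "deriv \<sigma> x = 0" if "x \<notin> {2..2 + 2 * d\<^sup>2}" for x
          using sout'[OF mem[OF that]] by (simp add: sig_deriv)
        show "\<bar>deriv \<sigma> x\<bar> \<le> S1 / d\<^sup>2" for x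
          unfolding sig_deriv using S1(2) d2(1) by (simp add: abs_mult divide_right_mono)
      qed (use d2 in auto)
      also have "\<dots> \<le> (S1 / d\<^sup>2) * (2 * d)" using sq2 S1(1) d2 by (intro mult_left_mono) auto
      also have "\<dots> = 2 * S1 / d" using d(1) by (simp add: power2_eq_square)
      finally show ?thesis .
    qed
    \<comment> \<open>Both test arguments belong to this family: they share the steep part d
      \<sigma>, so f (a + h) - f a = h \<eta>.\<close>
    define f where "f c x = c * \<eta> x + d * \<sigma> x" for c x
    have f_test: "test_function ?P (f c)" for c
      unfolding f_def[abs_def] by (rule test_function_linear_combination[OF eta(1) sig_test])
    have f_deriv: "deriv (f c) = (\<lambda>x. c * deriv \<eta> x + d * deriv \<sigma> x)" for c
      unfolding f_def[abs_def]
      by (intro ext DERIV_imp_deriv DERIV_add DERIV_cmult smooth_has_deriv[OF smooth_test[OF eta(1)]] smooth_has_deriv[OF sig_s])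
    have fS: "f c \<in> sobolev 2 ?P" for c by (rule test_function_sobolev[OF f_test])
    note P = pos_in_sets_lebesgue
    have f_n: "L2_norm ?P (f c) \<le> A" and f_n': "L2_norm ?P (weak_deriv ?P (f c)) \<le> B" if "\<bar>c\<bar> \<le> \<bar>R\<bar> + 1" for c
    proof -
      note sc = test_function_L2[OF test_function_scale(1)]
      have "L2_norm ?P (f c) \<le> L2_norm ?P (\<lambda>x. c * \<eta> x) + L2_norm ?P (\<lambda>x. d * \<sigma> x)"
        unfolding f_def[abs_def] by (rule L2_norm_triangle(2)[OF P sc[OF eta(1)] sc[OF sig_test]])
      also have "\<dots> = \<bar>c\<bar> * L2_norm ?P \<eta> + d * L2_norm ?P \<sigma>" using d by (simp add: L2_norm_scale)
      also have "\<dots> \<le> (\<bar>R\<bar> + 1) * L2_norm ?P \<eta> + 1 * (S0 * (2 * 1))"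
        using that d S0(1) by (intro add_mono mult_mono order_trans[OF sig_n] L2_norm_nonneg) auto
      finally show "L2_norm ?P (f c) \<le> A" by (simp add: A_def)
      have "L2_norm ?P (weak_deriv ?P (f c)) = L2_norm ?P (\<lambda>x. c * deriv \<eta> x + d * deriv \<sigma> x)"
        unfolding test_function_weak_deriv(3)[OF f_test] f_deriv ..
      also have "\<dots> \<le> L2_norm ?P (\<lambda>x. c * deriv \<eta> x) + L2_norm ?P (\<lambda>x. d * deriv \<sigma> x)"
        by (rule L2_norm_triangle(2)[OF P sc[OF test_function_deriv[OF eta(1)]] sc[OF test_function_deriv[OF sig_test]]])
      also have "\<dots> = \<bar>c\<bar> * L2_norm ?P (deriv \<eta>) + d * L2_norm ?P (deriv \<sigma>)" using d by (simp add: L2_norm_scale)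
      also have "\<dots> \<le> (\<bar>R\<bar> + 1) * L2_norm ?P (deriv \<eta>) + d * (2 * S1 / d)"
        using that d by (intro add_mono mult_right_mono mult_left_mono sig_n' L2_norm_nonneg) auto
      finally show "L2_norm ?P (weak_deriv ?P (f c)) \<le> B" using d by (simp add: B_def)
    qed
    define w where "w x = (F \<circ> f (a + h)) x - (F \<circ> f a) x" for x
    have wS: "w \<in> sobolev 1 ?P" unfolding w_def[abs_def] by (rule sobolev_1_diff[OF FS[OF fS] FS[OF fS]])
    have wc: "continuous_on ?P w"
      unfolding w_def[abs_def] o_def
      by (intro continuous_on_diff continuous_on_compose2[OF F smooth_continuous[OF smooth_test[OF f_test]]]) auto
    have ca: "\<bar>a\<bar> \<le> \<bar>R\<bar> + 1" "\<bar>a + h\<bar> \<le> \<bar>R\<bar> + 1" using a h by auto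
    have "sobolev_norm 1 ?P w \<le> C (L2_norm ?P (f (a + h))) (L2_norm ?P (f a))
        (L2_norm ?P (weak_deriv ?P (f (a + h)))) (L2_norm ?P (weak_deriv ?P (f a)))
         * sobolev_norm 2 ?P (\<lambda>x. f (a + h) x - f a x)"
      unfolding w_def[abs_def] by (rule CLip[OF fS fS])
    also have "\<dots> \<le> C A A B B * (h * N)"
    proof (rule mult_mono)
      show "C (L2_norm ?P (f (a + h))) (L2_norm ?P (f a))
        (L2_norm ?P (weak_deriv ?P (f (a + h)))) (L2_norm ?P (weak_deriv ?P (f a))) \<le> C A A B B"
        by (intro Cmono conjI L2_norm_nonneg f_n f_n' ca)
      have "sobolev_norm 2 ?P (\<lambda>x. h * \<eta> x) \<le> \<bar>h\<bar> * N"
        unfolding N_def by (rule sobolev_norm_2_scale[OF eta(1)])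
      moreover have "(\<lambda>x. f (a + h) x - f a x) = (\<lambda>x. h * \<eta> x)" by (auto simp: f_def algebra_simps)
      ultimately show "sobolev_norm 2 ?P (\<lambda>x. f (a + h) x - f a x) \<le> h * N" using h by simp
      show "0 \<le> C A A B B" using C0 by simp
      show "0 \<le> sobolev_norm 2 ?P (\<lambda>x. f (a + h) x - f a x)" unfolding sobolev_norm_def by (simp add: sum_nonneg)
    qed
    finally have wn: "sobolev_norm 1 ?P w \<le> K * h" by (simp add: K_def mult_ac)
    have "\<bar>w (2 + d\<^sup>2) - w 2\<bar> \<le> sobolev_norm 1 ?P w * sqrt (2 + d\<^sup>2 - 2)"
      by (rule sobolev_1_Hoelder[OF wS wc]) auto
    also have "\<dots> \<le> K * h * d" using wn d by (simp add: mult_right_mono)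
    finally have "\<bar>w (2 + d\<^sup>2) - w 2\<bar> \<le> K * h * d" .
    moreover have "\<sigma> 2 = 0" "\<sigma> (2 + d\<^sup>2) = 1" unfolding \<sigma>_def arg using s01 d2 by auto
    moreover have "\<eta> 2 = 1" "\<eta> (2 + d\<^sup>2) = 1" using eta(2) d2 by auto
    ultimately show ?thesis by (simp add: w_def f_def add_ac)
  qed
  then show ?thesis using K0 by blast
qed

section \<open>From second differences to a Lipschitz derivative\<close>

lemma antiderivative_on_interval:
  fixes F :: "real \<Rightarrow> real"
  assumes "continuous_on UNIV F"
  obtains \<Phi> where "\<And>t. a < t \<Longrightarrow> t < b \<Longrightarrow> (\<Phi> has_real_derivative F t) (at t)"
proof -
  have "((\<lambda>y. integral {a..y} F) has_real_derivative F t) (at t)" if "a < t" "t < b" for t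
    using integral_has_real_derivative[OF continuous_on_subset[OF assms subset_UNIV], of t a b] that
      at_within_Icc_at[of a t b] by auto
  then show thesis using that by blast
qed

text \<open>$p$ is the uniform limit of the dyadic difference quotients.\<close>

lemma second_difference_imp_C11:
  fixes F :: "real \<Rightarrow> real"
  assumes F: "continuous_on UNIV F" and K: "0 \<le> K"
    and sd: "\<And>a h d. a \<in> {\<alpha>..\<beta>} \<Longrightarrow> 0 < h \<Longrightarrow> h \<le> 1 \<Longrightarrow> 0 < d \<Longrightarrow> d \<le> 1 \<Longrightarrow>
      \<bar>F (a + d + h) - F (a + d) - F (a + h) + F a\<bar> \<le> K * h * d"
  obtains p where "primitive_on {\<alpha>..\<beta>} F p"
    "\<And>x y. x \<in> {\<alpha>..\<beta>} \<Longrightarrow> y \<in> {\<alpha>..\<beta>} \<Longrightarrow> \<bar>p x - p y\<bar> \<le> K * \<bar>x - y\<bar>"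
proof -
  define h :: "nat \<Rightarrow> real" where "h n = (1 / 2) ^ n" for n
  have h0: "0 < h n" "h n \<le> 1" for n by (auto simp: h_def power_le_one)
  have hS: "h n = 2 * h (Suc n)" for n by (simp add: h_def)
  have h_lim: "h \<longlonglongrightarrow> 0" unfolding h_def[abs_def] by (rule LIMSEQ_power_zero) simp
  define q where "q n a = (F (a + h n) - F a) / h n" for n a
  have step: "\<bar>q (Suc n) a - q n a\<bar> \<le> K * h (Suc n)" if "a \<in> {\<alpha>..\<beta>}" for n a
  proof -
    let ?e = "h (Suc n)"
    \<comment> \<open>Halving the step changes the difference quotient by a second difference with
      both increments equal to h (Suc n), divided by h n.\<close>
    have "q (Suc n) a - q n a = - (F (a + ?e + ?e) - F (a + ?e) - F (a + ?e) + F a) / (2 * ?e)"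
      using h0(1)[of "Suc n"] unfolding q_def hS[of n] by (simp add: field_simps)
    also have "\<bar>\<dots>\<bar> = \<bar>F (a + ?e + ?e) - F (a + ?e) - F (a + ?e) + F a\<bar> / (2 * ?e)"
      using h0(1)[of "Suc n"] by (simp add: abs_divide)
    also have "\<dots> \<le> (K * ?e * ?e) / (2 * ?e)"
      using h0[of "Suc n"] by (intro divide_right_mono sd that) auto
    also have "\<dots> = K * ?e / 2" using h0(1)[of "Suc n"] by simp
    also have "\<dots> \<le> K * ?e" using K h0(1)[of "Suc n"] by simp
    finally show ?thesis .
  qed
  have conv: "\<exists>l. (\<lambda>n. q n a) \<longlonglongrightarrow> l" if "a \<in> {\<alpha>..\<beta>}" for a
  proof -
    have "summable (\<lambda>n. K * h (Suc n))"
      unfolding h_def by (intro summable_mult) (simp add: summable_geometric)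
    then have "summable (\<lambda>n. q (Suc n) a - q n a)"
      by (rule summable_comparison_test'[where N = 0]) (use step[OF that] in auto)
    then have "convergent (\<lambda>n. \<Sum>i<n. q (Suc i) a - q i a)" by (simp add: summable_iff_convergent)
    then have "convergent (\<lambda>n. q n a - q 0 a)" unfolding sum_lessThan_telescope[of "\<lambda>n. q n a"] .
    then have "convergent (\<lambda>n. (q n a - q 0 a) + q 0 a)" by (intro convergent_add convergent_const)
    then show ?thesis by (simp add: convergent_def)
  qed
  define p where "p a = lim (\<lambda>n. q n a)" for a
  have p: "(\<lambda>n. q n a) \<longlonglongrightarrow> p a" if "a \<in> {\<alpha>..\<beta>}" for a
    unfolding p_def using conv[OF that] convergent_LIMSEQ_iff convergent_def by metis
  \<comment> \<open>Since h (Suc n) = h n - h (Suc n), the bounds in \<open>step\<close> telescope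
    from h 0 = 1.\<close>
  have q_bound: "\<bar>q n a - q 0 a\<bar> \<le> K * (1 - h n)" if "a \<in> {\<alpha>..\<beta>}" for n a
  proof (induction n)
    case (Suc n)
    have "\<bar>q (Suc n) a - q 0 a\<bar> \<le> \<bar>q (Suc n) a - q n a\<bar> + \<bar>q n a - q 0 a\<bar>" by linarith
    also have "\<dots> \<le> K * h (Suc n) + K * (1 - h n)" using step[OF that, of n] Suc by linarith
    also have "\<dots> = K * (1 - h (Suc n))" unfolding hS[of n] by (simp add: algebra_simps)
    finally show ?case .
  qed (simp add: h_def)
  have q_bound': "\<bar>q n a - q 0 a\<bar> \<le> K" if "a \<in> {\<alpha>..\<beta>}" for n a
    using q_bound[OF that, of n] mult_left_mono[of "1 - h n" 1 K] K h0(1)[of n] by simp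
  have q_lip: "\<bar>q n y - q n x\<bar> \<le> K * (y - x)" if "x \<in> {\<alpha>..\<beta>}" "x < y" "y \<le> x + 1" for n x y
  proof -
    have "q n y - q n x = (F (x + (y - x) + h n) - F (x + (y - x)) - F (x + h n) + F x) / h n"
      using h0(1)[of n] by (simp add: q_def field_simps)
    also have "\<bar>\<dots>\<bar> = \<bar>F (x + (y - x) + h n) - F (x + (y - x)) - F (x + h n) + F x\<bar> / h n"
      using h0(1)[of n] by (simp add: abs_divide)
    also have "\<dots> \<le> (K * h n * (y - x)) / h n"
      using h0[of n] that by (intro divide_right_mono sd) auto
    also have "\<dots> = K * (y - x)" using h0(1)[of n] by simp
    finally show ?thesis .
  qed
  have p_lip1: "\<bar>p y - p x\<bar> \<le> K * (y - x)" if "x \<in> {\<alpha>..\<beta>}" "y \<in> {\<alpha>..\<beta>}" "x \<le> y" "y \<le> x + 1" for x y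
  proof (cases "x = y")
    case False
    have "(\<lambda>n. \<bar>q n y - q n x\<bar>) \<longlonglongrightarrow> \<bar>p y - p x\<bar>" by (intro tendsto_intros p that)
    then show ?thesis
      by (rule LIMSEQ_le_const2) (use q_lip[of x y] that False in auto)
  qed simp
  have p_lip2: "\<bar>p y - p x\<bar> \<le> K * (y - x)" if "x \<in> {\<alpha>..\<beta>}" "y \<in> {\<alpha>..\<beta>}" "x \<le> y" for x y
  proof -
    \<comment> \<open>Second differences are controlled only for increments up to 1. Bisection adds
      up the short-range estimates, as K (t - r) is additive over adjacent intervals.\<close>
    have "x \<le> x \<and> y \<le> y \<longrightarrow> \<bar>p y - p x\<bar> \<le> K * (y - x)"
    proof (rule Bolzano[of x y "\<lambda>r t. x \<le> r \<and> t \<le> y \<longrightarrow> \<bar>p t - p r\<bar> \<le> K * (t - r)", OF \<open>x \<le> y\<close>])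
      fix r s t assume *: "x \<le> r \<and> s \<le> y \<longrightarrow> \<bar>p s - p r\<bar> \<le> K * (s - r)"
        "x \<le> s \<and> t \<le> y \<longrightarrow> \<bar>p t - p s\<bar> \<le> K * (t - s)" "r \<le> s" "s \<le> t"
      show "x \<le> r \<and> t \<le> y \<longrightarrow> \<bar>p t - p r\<bar> \<le> K * (t - r)"
      proof
        assume "x \<le> r \<and> t \<le> y"
        then have "\<bar>p s - p r\<bar> \<le> K * (s - r)" "\<bar>p t - p s\<bar> \<le> K * (t - s)" using * by auto
        moreover have "K * (t - r) = K * (s - r) + K * (t - s)" by (simp add: algebra_simps)
        ultimately show "\<bar>p t - p r\<bar> \<le> K * (t - r)" by linarith
      qed
    next
      fix z assume "x \<le> z" "z \<le> y"
      have "\<bar>p t - p r\<bar> \<le> K * (t - r)" if "r \<le> z" "z \<le> t" "t - r < 1" "x \<le> r" "t \<le> y" for r t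
        by (rule p_lip1) (use that \<open>x \<in> _\<close> \<open>y \<in> _\<close> in auto)
      then show "\<exists>d>0. \<forall>r t. r \<le> z \<and> z \<le> t \<and> t - r < d \<longrightarrow> x \<le> r \<and> t \<le> y \<longrightarrow> \<bar>p t - p r\<bar> \<le> K * (t - r)"
        by (intro exI[of _ 1]) auto
    qed
    then show ?thesis by simp
  qed
  have p_lip: "\<bar>p x - p y\<bar> \<le> K * \<bar>x - y\<bar>" if "x \<in> {\<alpha>..\<beta>}" "y \<in> {\<alpha>..\<beta>}" for x y
    using p_lip2[OF that] p_lip2[OF that(2,1)] by (cases "x \<le> y") (auto simp: abs_minus_commute)
  have p_cont: "continuous_on {\<alpha>..\<beta>} p"
  proof (rule lipschitz_on_continuous_on[of K])
    show "K-lipschitz_on {\<alpha>..\<beta>} p"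
      by (rule lipschitz_onI) (use p_lip K in \<open>auto simp: dist_real_def\<close>)
  qed
  have "primitive_on {\<alpha>..\<beta>} F p"
    unfolding primitive_on_def
  proof (intro ballI impI conjI)
    fix x y assume xy: "x \<in> {\<alpha>..\<beta>}" "y \<in> {\<alpha>..\<beta>}" "x \<le> y"
    then have sub: "{x..y} \<subseteq> {\<alpha>..\<beta>}" by auto
    show "p absolutely_integrable_on {x..y}"
      by (rule absolutely_integrable_continuous_real[OF continuous_on_subset[OF p_cont sub]])
    \<comment> \<open>The margins give two-sided derivatives at x and y and keep t + h n inside the
      interval, because h n \<le> 1.\<close>
    obtain \<Phi> where Phi: "\<And>t. x - 1 < t \<Longrightarrow> t < y + 2 \<Longrightarrow> (\<Phi> has_real_derivative F t) (at t)"
      using antiderivative_on_interval[OF F] by blast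
    have cq: "continuous_on T (q n)" for n T
      unfolding q_def[abs_def] using h0(1)[of n]
      by (intro continuous_intros continuous_on_compose2[OF F]) auto
    \<comment> \<open>The integral of a difference quotient of F is a difference of two difference
      quotients of \<Phi>, whose limits are F y and F x.\<close>
    have int_q: "integral {x..y} (q n) = (\<Phi> (y + h n) - \<Phi> y) / h n - (\<Phi> (x + h n) - \<Phi> x) / h n" for n
    proof (rule integral_unique)
      have "(q n has_integral ((\<Phi> (y + h n) - \<Phi> y) / h n - (\<Phi> (x + h n) - \<Phi> x) / h n)) {x..y}"
      proof (rule fundamental_theorem_of_calculus[OF xy(3), of "\<lambda>t. (\<Phi> (t + h n) - \<Phi> t) / h n"])
        fix t assume t: "t \<in> {x..y}"
        have "((\<lambda>t. \<Phi> (t + h n)) has_real_derivative F (t + h n)) (at t)"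
          using DERIV_shift[of \<Phi> "F (t + h n)" t "h n"] Phi[of "t + h n"] t h0[of n] by auto
        moreover have "(\<Phi> has_real_derivative F t) (at t)" using Phi[of t] t by auto
        ultimately have "((\<lambda>t. (\<Phi> (t + h n) - \<Phi> t) / h n) has_real_derivative q n t) (at t)"
          unfolding q_def by (intro DERIV_cdivide DERIV_diff)
        then show "((\<lambda>t. (\<Phi> (t + h n) - \<Phi> t) / h n) has_vector_derivative q n t) (at t within {x..y})"
          by (simp add: has_real_derivative_iff_has_vector_derivative has_vector_derivative_at_within)
      qed
      then show "(q n has_integral ((\<Phi> (y + h n) - \<Phi> y) / h n - (\<Phi> (x + h n) - \<Phi> x) / h n)) {x..y}" .
    qed
    have lim_Phi: "(\<lambda>n. (\<Phi> (t + h n) - \<Phi> t) / h n) \<longlonglongrightarrow> F t" if "t \<in> {x..y}" for t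
    proof -
      have "(\<lambda>e. (\<Phi> (t + e) - \<Phi> t) / e) \<midarrow>0\<rightarrow> F t" using Phi[of t] that by (auto simp: DERIV_def)
      moreover have "filterlim h (at 0) sequentially"
        using h_lim h0(1) by (auto simp: filterlim_at intro!: always_eventually less_imp_neq[symmetric])
      ultimately show ?thesis by (rule filterlim_compose)
    qed
    have "(\<lambda>n. integral {x..y} (q n)) \<longlonglongrightarrow> F y - F x"
      unfolding int_q by (intro tendsto_diff lim_Phi) (use xy in auto)
    moreover have "(\<lambda>n. integral {x..y} (q n)) \<longlonglongrightarrow> integral {x..y} p"
    proof (rule dominated_convergence(2))
      show "q n integrable_on {x..y}" for n using cq by (rule integrable_continuous_real)
      show "(\<lambda>t. \<bar>q 0 t\<bar> + K) integrable_on {x..y}"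
        using cq by (intro integrable_continuous_real continuous_intros)
      show "norm (q n t) \<le> \<bar>q 0 t\<bar> + K" if "t \<in> {x..y}" for n t
        using q_bound'[of t n] that sub by auto
      show "(\<lambda>n. q n t) \<longlonglongrightarrow> p t" if "t \<in> {x..y}" for t using p that sub by auto
    qed
    ultimately show "integral {x..y} p = F y - F x" by (rule LIMSEQ_unique[symmetric])
  qed
  then show thesis using that p_lip by blast
qed

section \<open>Local Sobolev regularity of F\<close>

lemma sobolev_loc_1_of_Lip_property:
  assumes "Lip_property (sobolev 1 {0<..}) (sobolev_norm 1 {0<..}) (L2 {0<..}) (L2_norm {0<..}) F"
  shows "F \<in> sobolev_loc 1 {0<..}"
  unfolding sobolev_loc_def
proof (intro CollectI allI impI)
  fix U :: "real set" assume U: "open U \<and> compact (closure U) \<and> closure U \<subseteq> {0<..}"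
  obtain a b where ab: "0 < a" "a < b" "closure U \<subseteq> {a..b}" using compact_pos_subset_Icc U by metis
  obtain L where L: "0 < L" "\<forall>y z. \<bar>y\<bar> \<le> b \<longrightarrow> \<bar>z\<bar> \<le> b \<longrightarrow> \<bar>F y - F z\<bar> \<le> L * \<bar>y - z\<bar>"
    using Lip_H1_L2_imp_Lipschitz[OF assms] by blast
  show "F \<in> sobolev 1 U"
  proof (rule Lipschitz_sobolev_1[of a b F L])
    show "U \<in> sets lebesgue" using U by (simp add: borel_open)
    show "U \<subseteq> {a..b}" using ab(3) closure_subset by blast
  qed (use L ab in auto)
qed

lemma sobolev_loc_2_of_Lip_property:
  assumes "Lip_property (sobolev 2 {0<..}) (sobolev_norm 2 {0<..}) (sobolev 1 {0<..}) (sobolev_norm 1 {0<..}) F"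
    and F: "continuous_on UNIV F"
  shows "F \<in> sobolev_loc 2 {0<..}"
  unfolding sobolev_loc_def
proof (intro CollectI allI impI)
  fix U :: "real set" assume U: "open U \<and> compact (closure U) \<and> closure U \<subseteq> {0<..}"
  obtain a b where ab: "0 < a" "a < b" "closure U \<subseteq> {a..b}" using compact_pos_subset_Icc U by metis
  have U': "U \<in> sets lebesgue" "U \<subseteq> {a..b}"
    using U ab(3) closure_subset by (auto simp: borel_open)
  obtain K where K: "0 \<le> K" "\<forall>y h d. \<bar>y\<bar> \<le> b \<longrightarrow> 0 < h \<longrightarrow> h \<le> 1 \<longrightarrow> 0 < d \<longrightarrow> d \<le> 1 \<longrightarrow>
      \<bar>F (y + d + h) - F (y + d) - F (y + h) + F y\<bar> \<le> K * h * d"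
    using Lip_H2_H1_imp_second_difference[OF assms] by blast
  obtain p where p: "primitive_on {a..b} F p"
    "\<And>x y. x \<in> {a..b} \<Longrightarrow> y \<in> {a..b} \<Longrightarrow> \<bar>p x - p y\<bar> \<le> K * \<bar>x - y\<bar>"
  proof (rule second_difference_imp_C11[OF F K(1), of a b])
    show "\<bar>F (y + d + h) - F (y + d) - F (y + h) + F y\<bar> \<le> K * h * d"
      if "y \<in> {a..b}" "0 < h" "h \<le> 1" "0 < d" "d \<le> 1" for y h d
      using K(2) that ab(1) by simp
  qed (rule that)
  have "p \<in> sobolev 1 U"
  \<comment> \<open>K may be 0, whereas \<open>Lipschitz_sobolev_1\<close> asks for a positive
    constant.\<close>
  proof (rule Lipschitz_sobolev_1[of a b p "K + 1", OF _ _ ab(1) _ U'])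
    fix x y assume "x \<in> {a..b}" "y \<in> {a..b}"
    then have "\<bar>p x - p y\<bar> \<le> K * \<bar>x - y\<bar>" by (rule p(2))
    also have "\<dots> \<le> (K + 1) * \<bar>x - y\<bar>" by (rule mult_right_mono) auto
    finally show "\<bar>p x - p y\<bar> \<le> (K + 1) * \<bar>x - y\<bar>" .
  qed (use K(1) ab in auto)
  moreover have "has_weak_deriv U F p"
    by (rule has_weak_deriv_on_interval[OF p(1) ab(1) _ U'(2)]) (use ab in simp)
  moreover have "F \<in> L2 U" by (rule L2_continuous[OF continuous_on_subset[OF F] U']) simp
  ultimately show "F \<in> sobolev 2 U" by (auto simp: numeral_2_eq_2 One_nat_def)
qed

text \<open>The orders are matched: H^2 to H^1 goes with two derivatives of F, and H^1 to L^2 with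
  one. The crossed pairing fails for the necessity: F(x) = |x - 1| - 1 is 1-Lipschitz with F(0) = 0,
  so it has the property from H^1 to L^2, but its derivative jumps at 1 and F is not in
  H^2_loc.\<close>

theorem proposition2:
  fixes F :: "real \<Rightarrow> real"
  assumes "continuous_on UNIV F"
    and "F 0 = 0"
  shows
    "(Lip_property (sobolev 2 {0<..}) (sobolev_norm 2 {0<..})
                   (sobolev 1 {0<..}) (sobolev_norm 1 {0<..}) F
        \<longrightarrow> F \<in> sobolev_loc 2 {0<..})
     \<and> (Lip_property (sobolev 1 {0<..}) (sobolev_norm 1 {0<..})
                     (L2 {0<..}) (L2_norm {0<..}) F
        \<longrightarrow> F \<in> sobolev_loc 1 {0<..})
     \<and> (C_k 2 F
        \<longrightarrow> Lip_property (sobolev 2 {0<..}) (sobolev_norm 2 {0<..})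
                         (sobolev 1 {0<..}) (sobolev_norm 1 {0<..}) F)
     \<and> (C_k 1 F
        \<longrightarrow> Lip_property (sobolev 1 {0<..}) (sobolev_norm 1 {0<..})
                         (L2 {0<..}) (L2_norm {0<..}) F)"
  using sobolev_loc_2_of_Lip_property[OF _ assms(1)] sobolev_loc_1_of_Lip_property
    Lip_property_C2[of F, OF _ assms(2)] Lip_property_C1[of F, OF _ assms(2)] by blast

end
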